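(* Let $\bullet$ be "$\le 1$" or "$1$". Let $X$ be a topological space such that $\mathcal{L}X$ (with its Scott topology) is a locally convex semitopological cone with an almost open addition map, and assume moreover that $X$ is compact if $\bullet$ is "$1$". Then $r_{\mathsf{ADP}}$ restricts to a homeomorphism from $\mathcal{P}^{cvx}_{\mathcal V}(\mathbb{P}^\bullet_{\mathsf P,wk}(X))$ onto $\mathbb{P}^\bullet_{\mathsf{ADP},wk}(X)$ with inverse $s^\bullet_{\mathsf{ADP}}$, and an order-isomorphism between $\mathcal{P}^{cvx}(\mathbb{P}^\bullet_{\mathsf P,wk}(X))$ and $\mathbb{P}^\bullet_{\mathsf{ADP}}(X)$.
   Context: $\overline{\mathbb{R}}_+=[0,+\infty]$ with the Scott topology. $\mathcal{L}X$: continuous maps $X\to\overline{\mathbb{R}}_+$, pointwise order, Scott topology, cone under pointwise $+$ and scalar multiplication; $\mathbf 1$ the constant map $1$. A prevision is a Scott-continuous $F:\mathcal{L}X\to\overline{\mathbb{R}}_+$ with $F(ah)=aF(h)$ ($a\in\mathbb{R}_+$); linear if additive, Hoare if sublinear, Smyth if superlinear; subnormalized if $F(\mathbf 1+h)\le1+F(h)$ for all $h$, normalized if equality always holds. $\mathbb{P}^\bullet_{\mathsf P}(X)$ is the set of linear previsions that are subnormalized (if $\bullet$ is "$\le1$") or normalized (if "$1$"). A fork is a pair $(F^-,F^+)$ of a Smyth prevision $F^-$ and a Hoare prevision $F^+$ with $F^-(h+h')\le F^-(h)+F^+(h')\le F^+(h+h')$ for all $h,h'\in\mathcal{L}X$;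 $\mathbb{P}^\bullet_{\mathsf{ADP}}(X)$ is the set of forks with both components satisfying the normalization condition of $\bullet$, ordered componentwise pointwise. The weak topology (subscript $wk$) on linear previsions is generated by $[h>r]=\{G\mid G(h)>r\}$; on forks it is generated by $\{(F^-,F^+)\mid F^-(h)>r\}$ and $\{(F^-,F^+)\mid F^+(h)>r\}$, $h\in\mathcal LX$, $r\in\mathbb{R}_+$. A locally convex semitopological cone: every point has a base of convex open neighbourhoods; addition is almost open iff the upward closure of $U+V$ is open for all opens $U,V$. A lens of a space $Y$ is a nonempty set $Q\cap C$ with $Q$ compact saturated and $C$ closed; $\mathcal{P}_{\mathcal V}(Y)$ is the set of lenses with the Vietoris topology (subbase $\Box V=\{L\mid L\subseteq V\}$, $\Diamond V=\{L\mid L\cap V\ne\emptyset\}$); $\mathcal{P}(Y)$ is the set of lenses ordered by $L\sqsubseteq L'$ iff $\uparrow L\supseteq\uparrow L'$ and $cl(L)\subseteq cl(L')$; superscript $cvx$ restricts to convex lenses ($E$ convex iff $aG+(1-a)G'\in E$ for $G,G'\in E$, $a\in[0,1]$). For a nonempty set $E$ of linear previsions, $r_{\mathsf{ADP}}(E)=(h\mapsto\inf_{G\in E}G(h),\ h\mapsto\sup_{G\in E}G(h))$; for a fork, $s^\bullet_{\mathsf{ADP}}(F^-,F^+)=\{G\in\mathbb{P}^\bullet_{\mathsf P}(X)\mid F^-\le G\le F^+\}$. *)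

theory Defs
  imports "HOL-Analysis.Analysis" "HOL-Library.Extended_Nonnegative_Real"
begin

definition gen_top_on :: "'b set \<Rightarrow> 'b set set \<Rightarrow> 'b topology" where
  "gen_top_on P S = topology_generated_by (insert P ((\<lambda>U. U \<inter> P) ` S))"

definition spec_le :: "'b topology \<Rightarrow> 'b \<Rightarrow> 'b \<Rightarrow> bool" where
  "spec_le T x y \<longleftrightarrow> x \<in> topspace T \<and> y \<in> topspace T \<and>
     (\<forall>U. openin T U \<longrightarrow> x \<in> U \<longrightarrow> y \<in> U)"

definition upclosure :: "'b topology \<Rightarrow> 'b set \<Rightarrow> 'b set" where
  "upclosure T A = {y. \<exists>x\<in>A. spec_le T x y}"

definition saturatedin :: "'b topology \<Rightarrow> 'b set \<Rightarrow> bool" where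
  "saturatedin T Q \<longleftrightarrow> Q \<subseteq> topspace T \<and> upclosure T Q \<subseteq> Q"

definition directed_set :: "('c::order) set \<Rightarrow> bool" where
  "directed_set D \<longleftrightarrow> D \<noteq> {} \<and> (\<forall>a\<in>D. \<forall>b\<in>D. \<exists>c\<in>D. a \<le> c \<and> b \<le> c)"

section \<open>The cone LX of continuous maps X -> [0,infinity] (Scott topology on the target)\<close>

text \<open>Maps are represented extensionally: value 0 outside the topspace of X.\<close>
definition LX :: "'a topology \<Rightarrow> ('a \<Rightarrow> ennreal) set" where
  "LX X = {h. (\<forall>r. openin X {x \<in> topspace X. r < h x}) \<and> (\<forall>x. x \<notin> topspace X \<longrightarrow> h x = 0)}"

definition one_L :: "'a topology \<Rightarrow> 'a \<Rightarrow> ennreal" where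
  "one_L X = (\<lambda>x. if x \<in> topspace X then 1 else 0)"

definition addf :: "('a \<Rightarrow> ennreal) \<Rightarrow> ('a \<Rightarrow> ennreal) \<Rightarrow> 'a \<Rightarrow> ennreal" where
  "addf h k = (\<lambda>x. h x + k x)"

definition smul :: "real \<Rightarrow> ('a \<Rightarrow> ennreal) \<Rightarrow> 'a \<Rightarrow> ennreal" where
  "smul a h = (\<lambda>x. ennreal a * h x)"

text \<open>Scott topology on LX (pointwise order; directed sups are pointwise).\<close>
definition scott_open_LX :: "'a topology \<Rightarrow> ('a \<Rightarrow> ennreal) set \<Rightarrow> bool" where
  "scott_open_LX X U \<longleftrightarrow> U \<subseteq> LX X \<and>
     (\<forall>h\<in>U. \<forall>k\<in>LX X. h \<le> k \<longrightarrow> k \<in> U) \<and>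
     (\<forall>D. D \<subseteq> LX X \<longrightarrow> directed_set D \<longrightarrow> Sup D \<in> U \<longrightarrow> D \<inter> U \<noteq> {})"

definition scottLX :: "'a topology \<Rightarrow> ('a \<Rightarrow> ennreal) topology" where
  "scottLX X = topology (scott_open_LX X)"

definition upper_nonneg_reals :: "real topology" where
  "upper_nonneg_reals = gen_top_on {0..} (range greaterThan)"

definition cone_convex :: "('a \<Rightarrow> ennreal) set \<Rightarrow> bool" where
  "cone_convex V \<longleftrightarrow> (\<forall>h\<in>V. \<forall>k\<in>V. \<forall>a\<in>{0..1}. (\<lambda>x. smul a h x + smul (1 - a) k x) \<in> V)"

definition semitopological_cone_LX :: "'a topology \<Rightarrow> bool" where
  "semitopological_cone_LX X \<longleftrightarrow>
     (\<forall>h\<in>LX X. \<forall>k\<in>LX X. spec_le (scottLX X) h k \<and> spec_le (scottLX X) k h \<longrightarrow> h = k) \<and>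
     (\<forall>h\<in>LX X. continuous_map (scottLX X) (scottLX X) (addf h)) \<and>
     (\<forall>a\<ge>0. continuous_map (scottLX X) (scottLX X) (smul a)) \<and>
     (\<forall>h\<in>LX X. continuous_map upper_nonneg_reals (scottLX X) (\<lambda>a. smul a h))"

definition locally_convex_LX :: "'a topology \<Rightarrow> bool" where
  "locally_convex_LX X \<longleftrightarrow>
     (\<forall>h U. openin (scottLX X) U \<longrightarrow> h \<in> U \<longrightarrow>
        (\<exists>V. openin (scottLX X) V \<and> cone_convex V \<and> h \<in> V \<and> V \<subseteq> U))"

definition almost_open_addition_LX :: "'a topology \<Rightarrow> bool" where
  "almost_open_addition_LX X \<longleftrightarrow>
     (\<forall>U V. openin (scottLX X) U \<longrightarrow> openin (scottLX X) V \<longrightarrow>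
        openin (scottLX X) (upclosure (scottLX X) {addf u v | u v. u \<in> U \<and> v \<in> V}))"

type_synonym 'a prev = "('a \<Rightarrow> ennreal) \<Rightarrow> ennreal"

text \<open>Previsions are represented extensionally: value 0 outside LX.\<close>
definition prevision :: "'a topology \<Rightarrow> 'a prev \<Rightarrow> bool" where
  "prevision X F \<longleftrightarrow>
     (\<forall>h\<in>LX X. \<forall>k\<in>LX X. h \<le> k \<longrightarrow> F h \<le> F k) \<and>
     (\<forall>D. D \<subseteq> LX X \<longrightarrow> directed_set D \<longrightarrow> F (Sup D) = (SUP h\<in>D. F h)) \<and>
     (\<forall>a\<ge>0. \<forall>h\<in>LX X. F (smul a h) = ennreal a * F h) \<and>
     (\<forall>h. h \<notin> LX X \<longrightarrow> F h = 0)"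

definition linear_prev :: "'a topology \<Rightarrow> 'a prev \<Rightarrow> bool" where
  "linear_prev X F \<longleftrightarrow> prevision X F \<and> (\<forall>h\<in>LX X. \<forall>k\<in>LX X. F (addf h k) = F h + F k)"

definition hoare_prev :: "'a topology \<Rightarrow> 'a prev \<Rightarrow> bool" where
  "hoare_prev X F \<longleftrightarrow> prevision X F \<and> (\<forall>h\<in>LX X. \<forall>k\<in>LX X. F (addf h k) \<le> F h + F k)"

definition smyth_prev :: "'a topology \<Rightarrow> 'a prev \<Rightarrow> bool" where
  "smyth_prev X F \<longleftrightarrow> prevision X F \<and> (\<forall>h\<in>LX X. \<forall>k\<in>LX X. F (addf h k) \<ge> F h + F k)"

datatype bullet = SubNorm | Norm

definition normcond :: "bullet \<Rightarrow> 'a topology \<Rightarrow> 'a prev \<Rightarrow> bool" where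
  "normcond b X F \<longleftrightarrow> (case b of
      SubNorm \<Rightarrow> (\<forall>h\<in>LX X. F (addf (one_L X) h) \<le> 1 + F h)
    | Norm \<Rightarrow> (\<forall>h\<in>LX X. F (addf (one_L X) h) = 1 + F h))"

definition PP :: "bullet \<Rightarrow> 'a topology \<Rightarrow> 'a prev set" where
  "PP b X = {G. linear_prev X G \<and> normcond b X G}"

definition PP_wk :: "bullet \<Rightarrow> 'a topology \<Rightarrow> 'a prev topology" where
  "PP_wk b X = gen_top_on (PP b X) {{G. ennreal r < G h} | h r. h \<in> LX X \<and> r \<ge> 0}"

definition is_fork :: "'a topology \<Rightarrow> 'a prev \<times> 'a prev \<Rightarrow> bool" where
  "is_fork X FF \<longleftrightarrow> smyth_prev X (fst FF) \<and> hoare_prev X (snd FF) \<and>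
     (\<forall>h\<in>LX X. \<forall>k\<in>LX X. fst FF (addf h k) \<le> fst FF h + snd FF k \<and>
                          fst FF h + snd FF k \<le> snd FF (addf h k))"

definition PADP :: "bullet \<Rightarrow> 'a topology \<Rightarrow> ('a prev \<times> 'a prev) set" where
  "PADP b X = {FF. is_fork X FF \<and> normcond b X (fst FF) \<and> normcond b X (snd FF)}"

definition PADP_wk :: "bullet \<Rightarrow> 'a topology \<Rightarrow> ('a prev \<times> 'a prev) topology" where
  "PADP_wk b X = gen_top_on (PADP b X)
     ({{FF. ennreal r < fst FF h} | h r. h \<in> LX X \<and> r \<ge> 0} \<union>
      {{FF. ennreal r < snd FF h} | h r. h \<in> LX X \<and> r \<ge> 0})"

definition fork_le :: "'a prev \<times> 'a prev \<Rightarrow> 'a prev \<times> 'a prev \<Rightarrow> bool" where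
  "fork_le FF GG \<longleftrightarrow> fst FF \<le> fst GG \<and> snd FF \<le> snd GG"

definition r_ADP :: "'a prev set \<Rightarrow> 'a prev \<times> 'a prev" where
  "r_ADP E = ((\<lambda>h. INF G\<in>E. G h), (\<lambda>h. SUP G\<in>E. G h))"

definition s_ADP :: "bullet \<Rightarrow> 'a topology \<Rightarrow> 'a prev \<times> 'a prev \<Rightarrow> 'a prev set" where
  "s_ADP b X FF = {G \<in> PP b X. fst FF \<le> G \<and> G \<le> snd FF}"

definition lenses :: "'b topology \<Rightarrow> 'b set set" where
  "lenses T = {L. L \<noteq> {} \<and> (\<exists>Q C. compactin T Q \<and> saturatedin T Q \<and> closedin T C \<and> L = Q \<inter> C)}"

definition vietoris :: "'b topology \<Rightarrow> 'b set set \<Rightarrow> 'b set topology" where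
  "vietoris T P = gen_top_on P
     ({{L. L \<subseteq> V} | V. openin T V} \<union> {{L. L \<inter> V \<noteq> {}} | V. openin T V})"

definition lens_le :: "'b topology \<Rightarrow> 'b set \<Rightarrow> 'b set \<Rightarrow> bool" where
  "lens_le T L L' \<longleftrightarrow> upclosure T L' \<subseteq> upclosure T L \<and> T closure_of L \<subseteq> T closure_of L'"

definition prev_convex :: "'a prev set \<Rightarrow> bool" where
  "prev_convex E \<longleftrightarrow> (\<forall>G\<in>E. \<forall>G'\<in>E. \<forall>a\<in>{0..1::real}.
      (\<lambda>h. ennreal a * G h + ennreal (1 - a) * G' h) \<in> E)"

definition cvx_lenses :: "bullet \<Rightarrow> 'a topology \<Rightarrow> 'a prev set set" where
  "cvx_lenses b X = {L \<in> lenses (PP_wk b X). prev_convex L}"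

end

theory Submission
  imports Defs
begin

text \<open>
  Everything rests on a sandwich theorem: between a Smyth prevision \<open>q\<close> and any sublinear map
  \<open>p \<ge> q\<close>, continuous or not, lies a linear prevision. Indeed a maximal Smyth prevision below \<open>p\<close> is
  linear. Applied to infima of suprema of linear previsions, it yields compactness of
  \<open>{G. F\<^sup>- \<le> G}\<close> through Alexander's subbase lemma, and the semicontinuity of \<open>s\<close> for the box part of
  the Vietoris topology. Applied to the inf-convolution of \<open>F\<^sup>+\<close> with \<open>F\<^sup>-\<close> along a ray, it shows that
  \<open>F\<^sup>-\<close> is attained on \<open>s (F\<^sup>-, F\<^sup>+)\<close>. Local convexity and almost openness of addition only enter in
  showing that \<open>F\<^sup>+\<close> is the supremum of \<open>s (F\<^sup>-, F\<^sup>+)\<close>.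
  Conversely, separation in the plane and induction give finite minimax principles, by which a compact
  convex set \<open>L\<close> has an element below every \<open>G \<ge> inf L\<close>, and every \<open>G \<le> sup L\<close> is in the closure of \<open>L\<close>.
\<close>

section \<open>Extended nonnegative reals\<close>

text \<open>Two obstacles shape the proof. A pointwise limit of linear previsions is in general not
  Scott-continuous, so compactness cannot be obtained by taking limits of nets. The sandwich theorem
  repairs this: Zorn's lemma is applied among Smyth previsions only, so continuity is never lost,
  while the upper bound may be as irregular as an upper limit along a filter base. The linear
  prevision found may lie strictly below that limit; this is harmless, because escaping a subbasic
  set \<open>[h > r]\<close> only takes the upper bound \<open>G h \<le> r\<close>, and lower bounds
  come from the Smyth prevision. The second obstacle is that values range over
  \<open>ennreal\<close>: there is no genuine subtraction, and values may be infinite. Differences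
  are therefore expressed by adding the subtrahend on the other side, and separation is carried out
  on convex sets of real vectors that bound tuples of values from below or above, instead of on the
  tuples themselves.\<close>

lemma ennreal_Sup_add_le:
  fixes A B :: "ennreal set"
  assumes "A \<noteq> {}" "B \<noteq> {}" "\<And>a b. a \<in> A \<Longrightarrow> b \<in> B \<Longrightarrow> a + b \<le> c"
  shows "Sup A + Sup B \<le> c"
proof -
  have "Sup A + Sup B = (SUP a\<in>A. a + Sup B)"
    using ennreal_SUP_add_left[OF assms(1), of "\<lambda>a. a" "Sup B"] by simp
  also have "\<dots> \<le> c"
  proof (rule SUP_least)
    fix a assume a: "a \<in> A"
    have "a + Sup B = (SUP b\<in>B. a + b)"
      using ennreal_SUP_add_right[OF assms(2), of a "\<lambda>b. b"] by simp
    then show "a + Sup B \<le> c" using a assms(3) by (auto intro: SUP_least)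
  qed
  finally show ?thesis .
qed

lemma ennreal_le_Inf_add:
  fixes A B :: "ennreal set"
  assumes "\<And>a b. a \<in> A \<Longrightarrow> b \<in> B \<Longrightarrow> c \<le> a + b"
  shows "c \<le> Inf A + Inf B"
proof (rule ennreal_le_epsilon)
  fix e :: real assume fin: "Inf A + Inf B < top" and e: "0 < e"
  have eps: "x < x + ennreal (e/2)" if "x < top" for x :: ennreal
    using that e by (cases x) (auto simp flip: ennreal_plus intro: ennreal_lessI)
  have "Inf A < Inf A + ennreal (e/2)" "Inf B < Inf B + ennreal (e/2)"
    by (rule eps; metis fin ennreal_add_less_top)+
  then obtain a b where ab: "a \<in> A" "a < Inf A + ennreal (e/2)" "b \<in> B" "b < Inf B + ennreal (e/2)"
    by (meson Inf_less_iff)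
  have "c \<le> a + b" using assms ab by blast
  also have "\<dots> \<le> (Inf A + ennreal (e/2)) + (Inf B + ennreal (e/2))"
    using ab by (intro add_mono) auto
  also have "\<dots> = Inf A + Inf B + (ennreal (e/2) + ennreal (e/2))" by (simp add: ac_simps)
  also have "ennreal (e/2) + ennreal (e/2) = ennreal e" using e by (simp flip: ennreal_plus)
  finally show "c \<le> Inf A + Inf B + ennreal e" .
qed

text \<open>The first two alternatives absorb \<open>u = 0\<close> and \<open>v = 0\<close>, where
  nothing lies strictly below. Otherwise \<open>u\<close> and \<open>v\<close> are the suprema of
  what lies strictly below them. This is what decomposes superlevel sets of sums into open
  pieces.\<close>

lemma less_add_ennrealE:
  fixes r u v :: ennreal
  assumes "r < u + v"
  obtains "r < u" | "r < v" | a b where "a < u" "b < v" "r < a + b"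
proof -
  have "u + v \<le> r" if u: "\<not> r < u" and v: "\<not> r < v" and n: "\<not> (\<exists>a b. a < u \<and> b < v \<and> r < a + b)"
  proof (cases "u = 0 \<or> v = 0")
    case True then show ?thesis using u v by (auto simp: not_less)
  next
    case False
    then have "{..<u} \<noteq> {}" "{..<v} \<noteq> {}" by (auto simp: zero_less_iff_neq_zero[symmetric])
    then have "Sup {..<u} + Sup {..<v} \<le> r"
      by (rule ennreal_Sup_add_le) (use n in \<open>meson lessThan_iff not_less\<close>)
    then show ?thesis by (simp add: Sup_lessThan False bot_ennreal)
  qed
  then show thesis using assms that by (meson not_le)
qed

lemma ennreal_scale_cancel:
  fixes u :: ennreal
  assumes "0 < a"
  shows "ennreal a * (ennreal (1 / a) * u) = u" "ennreal (1 / a) * (ennreal a * u) = u"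
  using assms by (simp_all flip: mult.assoc ennreal_mult)

lemma ennreal_less_smult_iff:
  fixes u r :: ennreal
  assumes "0 < a"
  shows "r < ennreal a * u \<longleftrightarrow> ennreal (1 / a) * r < u"
proof -
  have mono: "ennreal c * x < ennreal c * y" if "0 < c" "x < y" for c x and y :: ennreal
    using that by (intro ennreal_mult_strict_left_mono) auto
  show ?thesis
  proof
    assume "r < ennreal a * u"
    from mono[OF _ this, of "1/a"] show "ennreal (1 / a) * r < u"
      using assms by (simp add: ennreal_scale_cancel del: ennreal_1)
  next
    assume "ennreal (1 / a) * r < u"
    from mono[OF assms this] show "r < ennreal a * u"
      using assms by (simp add: ennreal_scale_cancel)
  qed
qed

section \<open>The cone of lower semicontinuous maps\<close>

lemma zero_in_LX: "(\<lambda>_. 0) \<in> LX X"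
  by (simp add: LX_def)

lemma one_in_LX: "one_L X \<in> LX X"
proof -
  have "{x \<in> topspace X. r < one_L X x} = (if r < 1 then topspace X else {})" for r
    by (auto simp: one_L_def)
  then show ?thesis by (simp add: LX_def one_L_def)
qed

lemma Sup_in_LX:
  assumes "D \<subseteq> LX X"
  shows "Sup D \<in> LX X"
proof -
  have "{x \<in> topspace X. r < (Sup D) x} = (\<Union>h\<in>D. {x \<in> topspace X. r < h x})" for r
    by (auto simp: less_SUP_iff)
  moreover have "(Sup D) x = 0" if "x \<notin> topspace X" for x
    using that assms unfolding Sup_apply
    by (intro antisym SUP_least) (auto simp: LX_def)
  ultimately show ?thesis using assms by (force simp: LX_def intro!: openin_Union)
qed

lemma addf_in_LX:
  assumes "h \<in> LX X" "k \<in> LX X"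
  shows "addf h k \<in> LX X"
proof -
  let ?P = "\<lambda>f r. {x \<in> topspace X. r < f x}"
  have "?P (addf h k) r = ?P h r \<union> ?P k r \<union> \<Union> ((\<lambda>(a,b). ?P h a \<inter> ?P k b) ` {(a,b). r < a + b})" for r
  proof (intro set_eqI iffI)
    fix x assume "x \<in> ?P (addf h k) r"
    then show "x \<in> ?P h r \<union> ?P k r \<union> \<Union> ((\<lambda>(a,b). ?P h a \<inter> ?P k b) ` {(a,b). r < a + b})"
      by (auto simp: addf_def elim: less_add_ennrealE)
  next
    fix x assume "x \<in> ?P h r \<union> ?P k r \<union> \<Union> ((\<lambda>(a,b). ?P h a \<inter> ?P k b) ` {(a,b). r < a + b})"
    then show "x \<in> ?P (addf h k) r"
      by (auto simp: addf_def intro: less_le_trans[OF _ add_increasing2]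
          less_le_trans[OF _ add_increasing] less_trans[OF _ add_strict_mono])
  qed
  moreover have "openin X (?P h r \<union> ?P k r \<union> \<Union> ((\<lambda>(a,b). ?P h a \<inter> ?P k b) ` {(a,b). r < a + b}))" for r
    using assms by (intro openin_Un openin_Union) (auto simp: LX_def intro!: openin_Int)
  ultimately show ?thesis using assms by (simp add: LX_def addf_def)
qed

lemma smul_in_LX:
  assumes "0 \<le> a" "h \<in> LX X"
  shows "smul a h \<in> LX X"
proof (cases "a = 0")
  case True
  then show ?thesis by (simp add: smul_def zero_in_LX)
next
  case False
  then have "{x \<in> topspace X. r < smul a h x} = {x \<in> topspace X. ennreal (1/a) * r < h x}" for r
    using assms by (simp add: smul_def ennreal_less_smult_iff)
  then show ?thesis using assms by (simp add: LX_def smul_def)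
qed

lemmas LX_closed = zero_in_LX one_in_LX addf_in_LX smul_in_LX

lemma addf_assoc: "addf (addf h k) l = addf h (addf k l)"
  by (simp add: addf_def ac_simps)

lemma addf_commute: "addf h k = addf k h"
  by (simp add: addf_def ac_simps)

lemma addf_left_commute: "addf h (addf k l) = addf k (addf h l)"
  by (simp add: addf_def ac_simps)

lemma addf_zero [simp]: "addf h (\<lambda>_. 0) = h" "addf (\<lambda>_. 0) h = h"
  by (simp_all add: addf_def)

lemma smul_zero [simp]: "smul 0 h = (\<lambda>_. 0)" "smul a (\<lambda>_. 0) = (\<lambda>_. 0)"
  by (simp_all add: smul_def)

lemma smul_one [simp]: "smul 1 h = h"
  by (simp add: smul_def)

lemma smul_addf: "smul a (addf h k) = addf (smul a h) (smul a k)"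
  by (simp add: smul_def addf_def distrib_left)

lemma addf_smul: "0 \<le> a \<Longrightarrow> 0 \<le> b \<Longrightarrow> smul (a + b) h = addf (smul a h) (smul b h)"
  by (simp add: smul_def addf_def distrib_right)

lemma smul_smul: "0 \<le> a \<Longrightarrow> 0 \<le> b \<Longrightarrow> smul a (smul b h) = smul (a * b) h"
  by (simp add: smul_def ennreal_mult mult.assoc)

lemma addf_mono: "h \<le> h' \<Longrightarrow> k \<le> k' \<Longrightarrow> addf h k \<le> addf h' k'"
  by (auto simp: le_fun_def addf_def intro: add_mono)

lemma smul_mono: "h \<le> h' \<Longrightarrow> smul a h \<le> smul a h'"
  by (auto simp: le_fun_def smul_def intro: mult_left_mono)

lemma directed_image:
  assumes "directed_set D" "\<And>h k. h \<in> D \<Longrightarrow> k \<in> D \<Longrightarrow> h \<le> k \<Longrightarrow> f h \<le> f k"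
  shows "directed_set (f ` D)"
  using assms unfolding directed_set_def by (simp add: ball_simps) meson

lemma addf_Sup:
  assumes "D \<noteq> {}"
  shows "addf (Sup D) k = Sup ((\<lambda>d. addf d k) ` D)"
  using assms by (auto simp: addf_def fun_eq_iff image_image ennreal_SUP_add_left)

section \<open>Previsions\<close>

lemma prevision_mono: "prevision X F \<Longrightarrow> h \<in> LX X \<Longrightarrow> k \<in> LX X \<Longrightarrow> h \<le> k \<Longrightarrow> F h \<le> F k"
  by (simp add: prevision_def)

lemma prevision_smul: "prevision X F \<Longrightarrow> h \<in> LX X \<Longrightarrow> 0 \<le> a \<Longrightarrow> F (smul a h) = ennreal a * F h"
  by (simp add: prevision_def)

lemma prevision_outside: "prevision X F \<Longrightarrow> h \<notin> LX X \<Longrightarrow> F h = 0"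
  by (simp add: prevision_def)

lemma prevision_zero: "prevision X F \<Longrightarrow> F (\<lambda>_. 0) = 0"
  using prevision_smul[of X F "\<lambda>_. 0" 0] by (simp add: zero_in_LX)

lemma prevision_Sup:
  "prevision X F \<Longrightarrow> D \<subseteq> LX X \<Longrightarrow> directed_set D \<Longrightarrow> F (Sup D) = (SUP h\<in>D. F h)"
  by (simp add: prevision_def)

lemma prevision_le: "prevision X F \<Longrightarrow> (\<And>h. h \<in> LX X \<Longrightarrow> F h \<le> G h) \<Longrightarrow> F \<le> G"
  by (auto simp: le_fun_def) (metis prevision_outside zero_le)

lemma linear_prevD:
  assumes "linear_prev X G"
  shows "prevision X G" "h \<in> LX X \<Longrightarrow> k \<in> LX X \<Longrightarrow> G (addf h k) = G h + G k"
  using assms by (auto simp: linear_prev_def)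

lemma smyth_prevD:
  assumes "smyth_prev X G"
  shows "prevision X G" "h \<in> LX X \<Longrightarrow> k \<in> LX X \<Longrightarrow> G h + G k \<le> G (addf h k)"
  using assms by (auto simp: smyth_prev_def)

lemma hoare_prevD:
  assumes "hoare_prev X G"
  shows "prevision X G" "h \<in> LX X \<Longrightarrow> k \<in> LX X \<Longrightarrow> G (addf h k) \<le> G h + G k"
  using assms by (auto simp: hoare_prev_def)

text \<open>One inequality per equation suffices: monotonicity gives the other half of Scott
  continuity, and \<open>hom\<close> applied to \<open>1 / a\<close> and \<open>smul a h\<close>
  reverses itself. The weak bound \<open>t \<le> F d\<close> is enough because
  \<open>ennreal\<close> is densely ordered, and it suits functionals defined as suprema.\<close>

lemma previsionI:
  assumes mono: "\<And>h k. h \<in> LX X \<Longrightarrow> k \<in> LX X \<Longrightarrow> h \<le> k \<Longrightarrow> F h \<le> F k"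
    and cont: "\<And>D t. D \<subseteq> LX X \<Longrightarrow> directed_set D \<Longrightarrow> t < F (Sup D) \<Longrightarrow> \<exists>d\<in>D. t \<le> F d"
    and hom: "\<And>a h. 0 < a \<Longrightarrow> h \<in> LX X \<Longrightarrow> ennreal a * F h \<le> F (smul a h)"
    and zero: "F (\<lambda>_. 0) = 0"
    and outside: "\<And>h. h \<notin> LX X \<Longrightarrow> F h = 0"
  shows "prevision X F"
  unfolding prevision_def
proof (intro conjI allI ballI impI)
  fix D assume D: "D \<subseteq> LX X" "directed_set D"
  show "F (Sup D) = (SUP h\<in>D. F h)"
  proof (rule antisym)
    show "F (Sup D) \<le> (SUP h\<in>D. F h)"
    proof (rule dense_le)
      fix t assume "t < F (Sup D)"
      then obtain d where "d \<in> D" "t \<le> F d" using cont D by blast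
      then show "t \<le> (SUP h\<in>D. F h)" by (meson SUP_upper order_trans)
    qed
    show "(SUP h\<in>D. F h) \<le> F (Sup D)"
      using D by (intro SUP_least mono Sup_in_LX) (auto intro: Sup_upper)
  qed
next
  fix a :: real and h assume a: "0 \<le> a" and h: "h \<in> LX X"
  show "F (smul a h) = ennreal a * F h"
  proof (cases "a = 0")
    case True then show ?thesis by (simp add: zero)
  next
    case False
    with a have a: "0 < a" by simp
    have "ennreal (1/a) * F (smul a h) \<le> F (smul (1/a) (smul a h))"
      using a h by (intro hom smul_in_LX) auto
    also have "smul (1/a) (smul a h) = h" using a by (simp add: smul_smul)
    finally have "ennreal a * (ennreal (1/a) * F (smul a h)) \<le> ennreal a * F h"
      by (rule mult_left_mono) simp
    then have "F (smul a h) \<le> ennreal a * F h" by (simp add: ennreal_scale_cancel a)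
    with hom[OF a h] show ?thesis by simp
  qed
qed (use mono outside in auto)

text \<open>Suprema commute with directed suprema. The dual fact for infima,
  \<open>prevision_INF_compact\<close>, rests on compactness.\<close>

lemma prevision_SUP:
  assumes "\<And>G. G \<in> E \<Longrightarrow> prevision X G"
  shows "prevision X (\<lambda>h. SUP G\<in>E. G h)"
proof (rule previsionI)
  fix D t assume D: "D \<subseteq> LX X" "directed_set D" and t: "t < (SUP G\<in>E. G (Sup D))"
  then obtain G where G: "G \<in> E" "t < G (Sup D)" by (auto simp: less_SUP_iff)
  then have "t < (SUP d\<in>D. G d)" using prevision_Sup[OF assms] D by metis
  then obtain d where "d \<in> D" "t < G d" by (auto simp: less_SUP_iff)
  then show "\<exists>d\<in>D. t \<le> (SUP G\<in>E. G d)" using G(1)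
    by (meson SUP_upper less_imp_le order_trans)
next
  fix a :: real and h assume "0 < a" "h \<in> LX X"
  then have "\<And>G. G \<in> E \<Longrightarrow> G (smul a h) = ennreal a * G h"
    using assms by (intro prevision_smul) auto
  then show "ennreal a * (SUP G\<in>E. G h) \<le> (SUP G\<in>E. G (smul a h))"
    by (simp add: SUP_mult_left_ennreal)
next
  show "(SUP G\<in>E. G (\<lambda>_. 0)) = 0"
    using assms prevision_zero by (intro antisym SUP_least) auto
next
  fix h assume "h \<notin> LX X"
  then show "(SUP G\<in>E. G h) = 0"
    using assms prevision_outside by (intro antisym SUP_least) auto
next
  fix h k assume "h \<in> LX X" "k \<in> LX X" "h \<le> k"
  then show "(SUP G\<in>E. G h) \<le> (SUP G\<in>E. G k)"
    using assms by (intro SUP_mono) (metis prevision_mono)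
qed

section \<open>The sandwich theorem\<close>

text \<open>Continuity and monotonicity are left out on purpose: the upper bounds fed into the
  sandwich theorem are infima of suprema and inf-convolutions, which need not be
  Scott-continuous.\<close>

definition sublinear_on :: "'a topology \<Rightarrow> 'a prev \<Rightarrow> bool" where
  "sublinear_on X p \<longleftrightarrow>
     (\<forall>a\<ge>0. \<forall>h\<in>LX X. p (smul a h) \<le> ennreal a * p h) \<and>
     (\<forall>h\<in>LX X. \<forall>k\<in>LX X. p (addf h k) \<le> p h + p k)"

text \<open>Zorn's lemma. The pointwise supremum of a chain keeps Scott continuity because suprema
  commute, and superadditivity because any two members of a chain have a common upper bound in
  it.\<close>

lemma maximal_smyth_prev_below:
  assumes q0: "smyth_prev X q0" "\<And>h. h \<in> LX X \<Longrightarrow> q0 h \<le> p h"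
  obtains q where "smyth_prev X q" "q0 \<le> q" "\<And>h. h \<in> LX X \<Longrightarrow> q h \<le> p h"
    "\<And>q'. smyth_prev X q' \<Longrightarrow> q \<le> q' \<Longrightarrow> (\<And>h. h \<in> LX X \<Longrightarrow> q' h \<le> p h) \<Longrightarrow> q' = q"
proof -
  define A where "A = {q. smyth_prev X q \<and> q0 \<le> q \<and> (\<forall>h\<in>LX X. q h \<le> p h)}"
  have "\<exists>m\<in>A. \<forall>a\<in>A. m \<le> a \<longrightarrow> a = m"
  proof (rule predicate_Zorn)
    show "partial_order_on A (relation_of (\<le>) A)"
      by (rule partial_order_on_relation_ofI) auto
  next
    fix C assume "C \<in> Chains (relation_of (\<le>) A)"
    then have CA: "C \<subseteq> A" and lin: "\<And>q q'. q \<in> C \<Longrightarrow> q' \<in> C \<Longrightarrow> q \<le> q' \<or> q' \<le> q"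
      by (auto simp: Chains_def relation_of_def)
    show "\<exists>u\<in>A. \<forall>q\<in>C. q \<le> u"
    proof (cases "C = {}")
      case True
      then show ?thesis using q0 by (auto simp: A_def intro!: bexI[of _ q0])
    next
      case False
      define u where "u = (\<lambda>h. SUP q\<in>C. q h)"
      have ub: "q \<le> u" if "q \<in> C" for q
        using that by (auto simp: u_def le_fun_def intro: SUP_upper)
      have "prevision X u"
        unfolding u_def using CA by (intro prevision_SUP) (auto simp: A_def smyth_prev_def)
      moreover have "u h + u k \<le> u (addf h k)" if "h \<in> LX X" "k \<in> LX X" for h k
        unfolding u_def
      proof (rule ennreal_Sup_add_le)
        fix a b assume "a \<in> (\<lambda>q. q h) ` C" "b \<in> (\<lambda>q. q k) ` C"
        then obtain q q' where q: "q \<in> C" "a = q h" "q' \<in> C" "b = q' k" by auto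
        then obtain r where r: "r \<in> C" "q \<le> r" "q' \<le> r" using lin by blast
        have "a + b \<le> r h + r k" using q r by (auto simp: le_fun_def intro: add_mono)
        also have "\<dots> \<le> r (addf h k)"
          using r CA that by (intro smyth_prevD) (auto simp: A_def)
        also have "\<dots> \<le> (SUP q\<in>C. q (addf h k))" using r by (auto intro: SUP_upper)
        finally show "a + b \<le> (SUP q\<in>C. q (addf h k))" .
      qed (use False in auto)
      ultimately have "smyth_prev X u" by (simp add: smyth_prev_def)
      moreover have "q0 \<le> u" using False CA ub by (force simp: A_def intro: order_trans)
      moreover have "u h \<le> p h" if "h \<in> LX X" for h
        unfolding u_def using that CA by (auto simp: A_def intro: SUP_least)
      ultimately show ?thesis using ub by (auto simp: A_def)
    qed
  qed
  then show thesis using that by (auto simp: A_def)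
qed

text \<open>Otherwise \<open>x \<mapsto> sup\<^sub>l (q (x + l k) - l p k)\<close> would be a larger Smyth prevision below \<open>p\<close>.\<close>
lemma maximal_smyth_prev_subadd:
  assumes q: "smyth_prev X q" and p: "sublinear_on X p"
    and qp: "\<And>h. h \<in> LX X \<Longrightarrow> q h \<le> p h"
    and max: "\<And>q'. smyth_prev X q' \<Longrightarrow> q \<le> q' \<Longrightarrow> (\<And>h. h \<in> LX X \<Longrightarrow> q' h \<le> p h) \<Longrightarrow> q' = q"
    and h: "h \<in> LX X" and k: "k \<in> LX X"
  shows "q (addf h k) \<le> q h + p k"
proof (cases "p k")
  case top then show ?thesis by simp
next
  case (real c)
  note q_prev = smyth_prevD(1)[OF q]
  \<comment> \<open>Subtraction in \<open>ennreal\<close> truncates, so the term subtracted,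
    \<open>l\<close> times the finite value \<open>c\<close> of \<open>p k\<close>, is moved to the
    other side. Taking \<open>l = 0\<close> shows that \<open>q x\<close> itself is a
    candidate.\<close>
  define T where "T x = {t. \<exists>l\<ge>0. t + ennreal (l * c) \<le> q (addf x (smul l k))}" for x
  define q' where "q' x = (if x \<in> LX X then Sup (T x) else 0)" for x
  have T_ge: "q x \<in> T x" for x by (auto simp: T_def intro!: exI[of _ 0])
  have "prevision X q'"
  proof (rule previsionI)
    fix x y assume xy: "x \<in> LX X" "y \<in> LX X" "x \<le> y"
    have "q (addf x (smul l k)) \<le> q (addf y (smul l k))" if "0 \<le> l" for l
      using xy k that by (intro prevision_mono[OF q_prev] addf_mono) (auto intro: LX_closed)
    then have "T x \<subseteq> T y" unfolding T_def by (blast intro: order_trans)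
    then show "q' x \<le> q' y" using xy by (simp add: q'_def Sup_subset_mono)
  next
    fix D t assume D: "D \<subseteq> LX X" "directed_set D" and t: "t < q' (Sup D)"
    then obtain u l where u: "t < u" "0 \<le> l" "u + ennreal (l * c) \<le> q (addf (Sup D) (smul l k))"
      by (auto simp: q'_def Sup_in_LX less_Sup_iff T_def)
    have "t + ennreal (l * c) < u + ennreal (l * c)"
      using u(1) by (simp add: ennreal_add_left_cancel_less add.commute[of _ "ennreal (l * c)"])
    also note u(3)
    also have "addf (Sup D) (smul l k) = Sup ((\<lambda>d. addf d (smul l k)) ` D)"
      using D by (intro addf_Sup) (auto simp: directed_set_def)
    also have "q \<dots> = (SUP e\<in>(\<lambda>d. addf d (smul l k)) ` D. q e)"
      using D k u(2) by (intro prevision_Sup[OF q_prev] directed_image)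
        (auto intro: LX_closed addf_mono)
    finally obtain d where "d \<in> D" "t + ennreal (l * c) < q (addf d (smul l k))"
      by (auto simp: less_SUP_iff)
    then have "d \<in> D" "t \<in> T d" using u(2) by (auto simp: T_def intro: less_imp_le)
    then show "\<exists>d\<in>D. t \<le> q' d" using D by (auto simp: q'_def intro!: bexI[of _ d] Sup_upper)
  next
    fix a :: real and x assume a: "0 < a" and x: "x \<in> LX X"
    have "ennreal a * t \<in> T (smul a x)" if t: "t \<in> T x" for t
    proof -
      from t obtain l where l: "0 \<le> l" "t + ennreal (l * c) \<le> q (addf x (smul l k))"
        by (auto simp: T_def)
      have "ennreal a * t + ennreal (a * l * c) = ennreal a * (t + ennreal (l * c))"
        using a real l by (simp add: distrib_left ennreal_mult mult.assoc)
      also have "\<dots> \<le> ennreal a * q (addf x (smul l k))" using l by (intro mult_left_mono) auto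
      also have "\<dots> = q (smul a (addf x (smul l k)))"
        using a x k l by (subst prevision_smul[OF q_prev]) (auto intro: LX_closed)
      also have "smul a (addf x (smul l k)) = addf (smul a x) (smul (a * l) k)"
        using a l by (simp add: smul_addf smul_smul)
      finally show ?thesis using a l unfolding T_def by (auto intro!: exI[of _ "a * l"])
    qed
    moreover have "ennreal a * Sup (T x) = (SUP t\<in>T x. ennreal a * t)"
      using SUP_mult_left_ennreal[of "ennreal a" "\<lambda>t. t" "T x"] by simp
    ultimately show "ennreal a * q' x \<le> q' (smul a x)"
      using a x by (auto simp: q'_def smul_in_LX intro!: Sup_subset_mono)
  next
    \<comment> \<open>Since \<open>q k \<le> p k\<close>, the value \<open>q (smul l k)\<close> is
      at most \<open>l * c\<close>, exactly what is subtracted.\<close>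
    have "Sup (T (\<lambda>_. 0)) \<le> 0"
    proof (rule Sup_least)
      fix t assume "t \<in> T (\<lambda>_. 0)"
      then obtain l where l: "0 \<le> l" "t + ennreal (l * c) \<le> q (smul l k)" by (auto simp: T_def)
      note l(2)
      also have "q (smul l k) = ennreal l * q k"
        using l k by (intro prevision_smul[OF q_prev]) auto
      also have "\<dots> \<le> ennreal l * ennreal c" using qp[OF k] real by (intro mult_left_mono) auto
      also have "\<dots> = 0 + ennreal (l * c)" using l real by (simp add: ennreal_mult)
      finally show "t \<le> 0" by (simp add: ennreal_add_left_cancel_le add.commute[of _ "ennreal (l * c)"])
    qed
    then show "q' (\<lambda>_. 0) = 0" by (simp add: q'_def zero_in_LX)
  qed (simp add: q'_def)
  moreover have "q' x + q' y \<le> q' (addf x y)" if xy: "x \<in> LX X" "y \<in> LX X" for x y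
  proof -
    have "Sup (T x) + Sup (T y) \<le> Sup (T (addf x y))"
    proof (rule ennreal_Sup_add_le)
      fix s t assume "s \<in> T x" "t \<in> T y"
      then obtain l m where lm: "0 \<le> l" "0 \<le> m" "s + ennreal (l * c) \<le> q (addf x (smul l k))"
         "t + ennreal (m * c) \<le> q (addf y (smul m k))" by (auto simp: T_def)
      have "s + t + ennreal ((l + m) * c) = (s + ennreal (l * c)) + (t + ennreal (m * c))"
        using lm real by (simp add: distrib_right add_ac)
      also have "\<dots> \<le> q (addf x (smul l k)) + q (addf y (smul m k))" using lm by (intro add_mono)
      also have "\<dots> \<le> q (addf (addf x (smul l k)) (addf y (smul m k)))"
        using lm xy k by (intro smyth_prevD(2)[OF q] LX_closed)
      also have "addf (addf x (smul l k)) (addf y (smul m k)) = addf (addf x y) (smul (l + m) k)"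
        using lm by (simp add: addf_smul addf_assoc addf_left_commute)
      finally have "s + t \<in> T (addf x y)" using lm by (auto simp: T_def intro!: exI[of _ "l + m"])
      then show "s + t \<le> Sup (T (addf x y))" by (rule Sup_upper)
    qed (use T_ge in blast)+
    then show ?thesis using xy by (simp add: q'_def addf_in_LX)
  qed
  ultimately have "smyth_prev X q'" by (simp add: smyth_prev_def)
  moreover have "q \<le> q'" 
    by (rule prevision_le[OF q_prev]) (auto simp: q'_def intro: Sup_upper T_ge)
  moreover have "q' x \<le> p x" if x: "x \<in> LX X" for x
  proof -
    have "t \<le> p x" if "t \<in> T x" for t
    proof -
      from that obtain l where l: "0 \<le> l" "t + ennreal (l * c) \<le> q (addf x (smul l k))"
        by (auto simp: T_def)
      note l(2)
      also have "q (addf x (smul l k)) \<le> p (addf x (smul l k))"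
        using x k l by (intro qp LX_closed)
      also have "\<dots> \<le> p x + p (smul l k)"
        using p x k l by (auto simp: sublinear_on_def LX_closed)
      also have "\<dots> \<le> p x + ennreal l * p k"
        using p k l by (intro add_mono) (auto simp: sublinear_on_def)
      also have "ennreal l * p k = ennreal (l * c)" using l real by (simp add: ennreal_mult)
      finally show ?thesis by (simp add: ennreal_add_left_cancel_le add.commute[of _ "ennreal (l * c)"])
    qed
    then show ?thesis using x by (simp add: q'_def Sup_least)
  qed
  ultimately have "q' = q" by (rule max)
  \<comment> \<open>The candidate for \<open>l = 1\<close>. If the difference is truncated, then
    \<open>q (addf h k) \<le> p k\<close> and the claim is immediate.\<close>
  moreover have "q (addf h k) - ennreal c \<in> T h \<or> q (addf h k) \<le> ennreal c"
    using real(2) by (cases "q (addf h k) \<le> ennreal c")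
      (auto simp: T_def not_le diff_add_cancel_ennreal less_imp_le intro!: exI[of _ 1])
  ultimately have "q (addf h k) - ennreal c \<le> q h \<or> q (addf h k) \<le> ennreal c"
    using h by (metis Sup_upper q'_def)
  then show ?thesis
    using real(2) by (auto simp: ennreal_minus_le_iff add.commute add_increasing2)
qed

text \<open>The inf-convolution of \<open>p\<close> with the map \<open>l k \<mapsto> l c\<close> on
  the ray through \<open>k\<close>. For sublinear \<open>p\<close> it is, on the cone, the largest
  sublinear map below \<open>p\<close> whose value at \<open>k\<close> is at most
  \<open>c\<close>.\<close>

definition inf_conv :: "'a topology \<Rightarrow> 'a prev \<Rightarrow> ('a \<Rightarrow> ennreal) \<Rightarrow> ennreal \<Rightarrow> 'a prev" where
  "inf_conv X p k c = (\<lambda>x. Inf {p z + ennreal l * c | z l. z \<in> LX X \<and> 0 \<le> l \<and> x = addf z (smul l k)})"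

lemma sublinear_on_zero: "sublinear_on X p \<Longrightarrow> p (\<lambda>_. 0) = 0"
  using zero_in_LX[of X] by (force simp: sublinear_on_def dest: spec[of _ "0::real"])

lemma inf_conv_le: "x \<in> LX X \<Longrightarrow> inf_conv X p k c x \<le> p x"
  unfolding inf_conv_def by (rule Inf_lower) force

lemma inf_conv_self_le:
  assumes "sublinear_on X p"
  shows "inf_conv X p k c k \<le> c"
  unfolding inf_conv_def
  by (rule Inf_lower) (use sublinear_on_zero[OF assms] in
      \<open>auto intro!: exI[of _ "\<lambda>_. 0"] exI[of _ "1::real"] simp: zero_in_LX\<close>)

text \<open>Decompositions \<open>x = z + l k\<close> can be scaled and added, and by sublinearity
  of \<open>p\<close> their costs \<open>p z + l c\<close> grow no faster. The factor 0 is treated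
  apart because the scaling argument divides by \<open>a\<close>.\<close>

lemma sublinear_on_inf_conv:
  assumes p: "sublinear_on X p" and k: "k \<in> LX X"
  shows "sublinear_on X (inf_conv X p k c)"
proof -
  define T where "T x = {p z + ennreal l * c | z l. z \<in> LX X \<and> 0 \<le> l \<and> x = addf z (smul l k)}" for x
  define p' where "p' x = Inf (T x)" for x
  have "sublinear_on X p'"
    unfolding sublinear_on_def
  proof (intro conjI allI impI ballI)
    fix a :: real and x assume a: "0 \<le> a" and x: "x \<in> LX X"
    show "p' (smul a x) \<le> ennreal a * p' x"
    proof (cases "a = 0")
      case True
      have "p (\<lambda>_. 0) = 0" using p by (rule sublinear_on_zero)
      then have "0 \<in> T (\<lambda>_. 0)"
        unfolding T_def by (auto intro!: exI[of _ "\<lambda>_. 0"] exI[of _ "0::real"] simp: zero_in_LX)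
      then have "p' (\<lambda>_. 0) \<le> 0" unfolding p'_def by (rule Inf_lower)
      then show ?thesis using True by simp
    next
      case False
      with a have a: "0 < a" by simp
      have le: "p' (smul a x) \<le> ennreal a * t" if "t \<in> T x" for t
      proof -
        from that obtain z l where zl: "z \<in> LX X" "0 \<le> l" "x = addf z (smul l k)"
          and t: "t = p z + ennreal l * c" by (auto simp: T_def)
        have "smul a x = addf (smul a z) (smul (a * l) k)"
          using a zl by (simp add: smul_addf smul_smul)
        then have "p (smul a z) + ennreal (a * l) * c \<in> T (smul a x)"
          unfolding T_def using a zl by (auto intro!: exI[of _ "smul a z"] exI[of _ "a * l"] LX_closed)
        then have "p' (smul a x) \<le> p (smul a z) + ennreal (a * l) * c"
          unfolding p'_def by (rule Inf_lower)
        also have "\<dots> \<le> ennreal a * p z + ennreal (a * l) * c"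
          using p a zl by (intro add_mono) (auto simp: sublinear_on_def)
        also have "\<dots> = ennreal a * t"
          using a zl by (simp add: t distrib_left ennreal_mult mult.assoc)
        finally show ?thesis .
      qed
      have "ennreal (1/a) * p' (smul a x) \<le> p' x"
        unfolding p'_def[of x]
      proof (rule Inf_greatest)
        fix t assume "t \<in> T x"
        then have "ennreal (1/a) * p' (smul a x) \<le> ennreal (1/a) * (ennreal a * t)"
          by (intro mult_left_mono le) auto
        then show "ennreal (1/a) * p' (smul a x) \<le> t" using a by (simp add: ennreal_scale_cancel)
      qed
      then have "ennreal a * (ennreal (1/a) * p' (smul a x)) \<le> ennreal a * p' x"
        by (rule mult_left_mono) simp
      then show ?thesis using a by (simp add: ennreal_scale_cancel)
    qed
  next
    fix x y assume xy: "x \<in> LX X" "y \<in> LX X"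
    show "p' (addf x y) \<le> p' x + p' y"
      unfolding p'_def[of x] p'_def[of y]
    proof (rule ennreal_le_Inf_add)
      fix s t assume "s \<in> T x" "t \<in> T y"
      then obtain z l w m where z: "z \<in> LX X" "0 \<le> l" "x = addf z (smul l k)" "s = p z + ennreal l * c"
        and w: "w \<in> LX X" "0 \<le> m" "y = addf w (smul m k)" "t = p w + ennreal m * c"
        by (auto simp: T_def)
      have "addf x y = addf (addf z w) (smul (l + m) k)"
        using z w by (simp add: addf_smul addf_assoc addf_left_commute)
      then have "p (addf z w) + ennreal (l + m) * c \<in> T (addf x y)"
        unfolding T_def using z w by (auto intro!: exI[of _ "addf z w"] exI[of _ "l + m"] LX_closed)
      then have "p' (addf x y) \<le> p (addf z w) + ennreal (l + m) * c"
        unfolding p'_def by (rule Inf_lower)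
      also have "\<dots> \<le> (p z + p w) + ennreal (l + m) * c"
        using p z w by (intro add_mono) (auto simp: sublinear_on_def)
      also have "\<dots> = s + t" using z w by (simp add: algebra_simps)
      finally show "p' (addf x y) \<le> s + t" .
    qed
  qed
  then show ?thesis unfolding inf_conv_def p'_def[abs_def] T_def .
qed

text \<open>Subadditivity of a maximal \<open>q\<close> comes from using
  \<open>maximal_smyth_prev_subadd\<close> twice. The first use bounds \<open>q (z + l k)\<close> by
  \<open>p z + l (q k)\<close>, so \<open>q\<close> lies below the inf-convolution of
  \<open>p\<close> at cost \<open>q k\<close>. The second use has this inf-convolution as upper
  bound, and there \<open>k\<close> costs at most \<open>q k\<close>.\<close>

theorem sandwich:
  assumes q0: "smyth_prev X q0" and p: "sublinear_on X p"
    and q0p: "\<And>h. h \<in> LX X \<Longrightarrow> q0 h \<le> p h"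
  obtains G where "linear_prev X G" "q0 \<le> G" "\<And>h. h \<in> LX X \<Longrightarrow> G h \<le> p h"
proof -
  obtain q where q: "smyth_prev X q" and q0q: "q0 \<le> q"
    and qp: "\<And>h. h \<in> LX X \<Longrightarrow> q h \<le> p h"
    and max: "\<And>q'. smyth_prev X q' \<Longrightarrow> q \<le> q' \<Longrightarrow> (\<And>h. h \<in> LX X \<Longrightarrow> q' h \<le> p h) \<Longrightarrow> q' = q"
    using maximal_smyth_prev_below[OF q0 q0p] by blast
  note q_prev = smyth_prevD(1)[OF q]
  have "q (addf h k) \<le> q h + q k" if h: "h \<in> LX X" and k: "k \<in> LX X" for h k
  proof -
    txt \<open>\<open>q\<close> is also maximal below the smaller sublinear map \<open>p'\<close>, which satisfies \<open>p' k \<le> q k\<close>.\<close>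
    define p' where "p' = inf_conv X p k (q k)"
    have "q x \<le> p' x" if "x \<in> LX X" for x
      unfolding p'_def inf_conv_def
    proof (rule Inf_greatest, elim CollectE exE conjE)
      fix t z and l :: real assume zl: "t = p z + ennreal l * q k" "z \<in> LX X" "0 \<le> l" "x = addf z (smul l k)"
      have "q x \<le> q (smul l k) + p z"
        unfolding zl(4) addf_commute[of z]
        using zl k by (intro maximal_smyth_prev_subadd[OF q p qp max] LX_closed) auto
      also have "q (smul l k) = ennreal l * q k"
        using zl k by (intro prevision_smul[OF q_prev]) auto
      finally show "q x \<le> t" by (simp add: zl add.commute)
    qed
    moreover have "p' x \<le> p x" if "x \<in> LX X" for x
      unfolding p'_def using that by (rule inf_conv_le)
    moreover have "sublinear_on X p'" unfolding p'_def using p k by (rule sublinear_on_inf_conv)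
    ultimately have "q (addf h k) \<le> q h + p' k"
      using h k by (intro maximal_smyth_prev_subadd[OF q _ _ max]) (auto intro: order_trans)
    also have "p' k \<le> q k" unfolding p'_def using p by (rule inf_conv_self_le)
    finally show ?thesis by (simp add: add_left_mono)
  qed
  then have "linear_prev X q"
    using q by (auto simp: linear_prev_def smyth_prev_def intro: antisym)
  then show thesis using q0q qp by (rule that)
qed

text \<open>A replacement for a limit along the filter base \<open>BB\<close>. The upper limit
  \<open>p\<close>, the infimum over \<open>B\<close> of the suprema over \<open>B\<close>, is
  sublinear: for two members of \<open>BB\<close>, additivity is applied on a common refinement. It
  need not be continuous, and the sandwich theorem puts a linear prevision between \<open>q\<close>
  and it.\<close>

lemma filtered_sandwich:
  assumes q: "smyth_prev X q" and ne: "BB \<noteq> {}"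
    and dir: "\<And>B B'. B \<in> BB \<Longrightarrow> B' \<in> BB \<Longrightarrow> \<exists>B''\<in>BB. B'' \<subseteq> B \<inter> B'"
    and lin: "\<And>B G. B \<in> BB \<Longrightarrow> G \<in> B \<Longrightarrow> linear_prev X G"
    and le: "\<And>B h. B \<in> BB \<Longrightarrow> h \<in> LX X \<Longrightarrow> q h \<le> (SUP G\<in>B. G h)"
  obtains G where "linear_prev X G" "q \<le> G"
    "\<And>B h. B \<in> BB \<Longrightarrow> h \<in> LX X \<Longrightarrow> G h \<le> (SUP G'\<in>B. G' h)"
proof -
  define p where "p h = (INF B\<in>BB. SUP G\<in>B. G h)" for h
  have "sublinear_on X p"
    unfolding sublinear_on_def
  proof (intro conjI allI impI ballI)
    fix a :: real and h assume a: "0 \<le> a" and h: "h \<in> LX X"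
    have hom: "(SUP G\<in>B. G (smul a h)) = ennreal a * (SUP G\<in>B. G h)" if "B \<in> BB" for B
    proof -
      have "G (smul a h) = ennreal a * G h" if "G \<in> B" for G
        using lin[OF \<open>B \<in> BB\<close> that] a h by (intro prevision_smul linear_prevD)
      then show ?thesis by (simp add: SUP_mult_left_ennreal)
    qed
    show "p (smul a h) \<le> ennreal a * p h"
    proof (cases "a = 0")
      case True
      obtain B where "B \<in> BB" using ne by blast
      then have "p (smul a h) \<le> (SUP G\<in>B. G (smul a h))" unfolding p_def by (rule INF_lower)
      also have "\<dots> \<le> 0" using hom[OF \<open>B \<in> BB\<close>] True by (simp del: smul_zero)
      finally show ?thesis by simp
    next
      case False
      with a have a: "0 < a" by simp
      have "ennreal (1/a) * p (smul a h) \<le> p h"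
        unfolding p_def[of h]
      proof (rule INF_greatest)
        fix B assume B: "B \<in> BB"
        then have "p (smul a h) \<le> (SUP G\<in>B. G (smul a h))" unfolding p_def by (rule INF_lower)
        then have "ennreal (1/a) * p (smul a h) \<le> ennreal (1/a) * (ennreal a * (SUP G\<in>B. G h))"
          unfolding hom[OF B] by (rule mult_left_mono) simp
        then show "ennreal (1/a) * p (smul a h) \<le> (SUP G\<in>B. G h)"
          using a by (simp add: ennreal_scale_cancel)
      qed
      then have "ennreal a * (ennreal (1/a) * p (smul a h)) \<le> ennreal a * p h"
        by (rule mult_left_mono) simp
      then show ?thesis using a by (simp add: ennreal_scale_cancel)
    qed
  next
    fix h k assume hk: "h \<in> LX X" "k \<in> LX X"
    show "p (addf h k) \<le> p h + p k"
      unfolding p_def[of h] p_def[of k]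
    proof (rule ennreal_le_Inf_add)
      fix s t assume "s \<in> (\<lambda>B. SUP G\<in>B. G h) ` BB" "t \<in> (\<lambda>B. SUP G\<in>B. G k) ` BB"
      then obtain B B' where B: "B \<in> BB" "s = (SUP G\<in>B. G h)" "B' \<in> BB" "t = (SUP G\<in>B'. G k)"
        by auto
      then obtain C where C: "C \<in> BB" "C \<subseteq> B" "C \<subseteq> B'" using dir by (metis le_inf_iff)
      have "p (addf h k) \<le> (SUP G\<in>C. G (addf h k))" unfolding p_def using C(1) by (rule INF_lower)
      also have "\<dots> \<le> s + t"
      proof (rule SUP_least)
        fix G assume G: "G \<in> C"
        then have "G (addf h k) = G h + G k" using hk lin[OF C(1)] by (intro linear_prevD) auto
        also have "\<dots> \<le> s + t" using G C B by (intro add_mono) (auto intro!: SUP_upper)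
        finally show "G (addf h k) \<le> s + t" .
      qed
      finally show "p (addf h k) \<le> s + t" .
    qed
  qed
  moreover have "q h \<le> p h" if "h \<in> LX X" for h
    unfolding p_def using le that by (intro INF_greatest)
  ultimately obtain G where G: "linear_prev X G" "q \<le> G" "\<And>h. h \<in> LX X \<Longrightarrow> G h \<le> p h"
    using sandwich[OF q] by blast
  show thesis
  proof (rule that[OF G(1,2)])
    fix B h assume "B \<in> BB" "h \<in> LX X"
    then show "G h \<le> (SUP G'\<in>B. G' h)"
      using G(3)[of h] by (auto simp: p_def intro: order_trans INF_lower)
  qed
qed

section \<open>Topologies generated by a subbase\<close>

lemma topspace_gen_top_on [simp]: "topspace (gen_top_on P S) = P"
  by (auto simp: gen_top_on_def)

lemma openin_gen_top_on: "U \<in> S \<Longrightarrow> openin (gen_top_on P S) (U \<inter> P)"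
  unfolding gen_top_on_def by (rule topology_generated_by_Basis) auto

lemma continuous_map_gen_top_on:
  assumes "\<And>x. x \<in> topspace T \<Longrightarrow> f x \<in> P"
    and "\<And>U. U \<in> S \<Longrightarrow> openin T {x \<in> topspace T. f x \<in> U}"
  shows "continuous_map T (gen_top_on P S) f"
  unfolding gen_top_on_def
proof (rule continuous_on_generated_topo)
  fix U assume "U \<in> insert P ((\<lambda>U. U \<inter> P) ` S)"
  then consider "U = P" | V where "V \<in> S" "U = V \<inter> P" by blast
  then show "openin T (f -` U \<inter> topspace T)"
  proof cases
    case 1
    then have "f -` U \<inter> topspace T = topspace T" using assms(1) by auto
    then show ?thesis by simp
  next
    case 2
    then have "f -` U \<inter> topspace T = {x \<in> topspace T. f x \<in> V}" using assms(1) by auto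
    then show ?thesis using assms(2) 2 by simp
  qed
qed (use assms(1) in auto)

text \<open>Induction on the generation of open sets. The empty family \<open>A\<close> is allowed
  and stands for the neighbourhood \<open>P\<close>.\<close>

lemma gen_top_on_nhd:
  assumes "openin (gen_top_on P S) V" "x \<in> V"
  shows "\<exists>A. finite A \<and> A \<subseteq> S \<and> x \<in> \<Inter>A \<and> P \<inter> \<Inter>A \<subseteq> V" (is "\<exists>A. ?nhd A V")
proof -
  have "generate_topology_on (insert P ((\<lambda>U. U \<inter> P) ` S)) V"
    using assms(1) by (simp add: gen_top_on_def openin_topology_generated_by_iff)
  then show ?thesis using assms(2)
  proof (induction)
    case (Int V W)
    from Int.prems have "x \<in> V" "x \<in> W" by simp_all
    obtain A where "?nhd A V" using Int.IH(1)[OF \<open>x \<in> V\<close>] ..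
    moreover obtain B where "?nhd B W" using Int.IH(2)[OF \<open>x \<in> W\<close>] ..
    ultimately have "?nhd (A \<union> B) (V \<inter> W)" by (simp add: Inter_Un_distrib) blast
    then show ?case ..
  next
    case (UN K)
    then obtain k where "k \<in> K" "x \<in> k" by blast
    from UN.IH[OF this] obtain A where "?nhd A k" ..
    with \<open>k \<in> K\<close> have "?nhd A (\<Union>K)" by blast
    then show ?case ..
  next
    case (Basis V)
    then consider "V = P" | W where "W \<in> S" "V = W \<inter> P" by blast
    then show ?case
    proof cases
      case 1
      then have "?nhd {} V" by simp
      then show ?thesis ..
    next
      case 2
      then have "?nhd {W} V" using Basis by blast
      then show ?thesis ..
    qed
  qed simp
qed

lemma compactin_gen_top_on:
  assumes "Q \<subseteq> P"
    and fin: "\<And>C. C \<subseteq> S \<Longrightarrow> Q \<subseteq> \<Union>C \<Longrightarrow> \<exists>C'. finite C' \<and> C' \<subseteq> C \<and> Q \<subseteq> \<Union>C'"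
  shows "compactin (gen_top_on P S) Q"
proof -
  \<comment> \<open>Alexander's lemma speaks about a whole space, so it is applied to the space
    \<open>Y\<close> on \<open>Q\<close> whose subbase consists of the traces of \<open>B\<close>;
    covers of \<open>Q\<close> by open sets of the ambient topology are then transferred to
    \<open>Y\<close>.\<close>
  define B where "B = insert P S"
  let ?open = "arbitrary union_of (finite intersection_of (\<lambda>x. x \<in> B) relative_to Q)"
  define Y where "Y = topology ?open"
  have compact: "compact_space Y"
  proof (rule Alexander_subbase_alt)
    show "Q \<subseteq> \<Union>B" using assms(1) by (auto simp: B_def)
    show "topology ?open = Y" by (simp add: Y_def)
    fix C assume C: "C \<subseteq> B" "Q \<subseteq> \<Union>C"
    show "\<exists>C'. finite C' \<and> C' \<subseteq> C \<and> Q \<subseteq> \<Union>C'"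
    \<comment> \<open>\<open>P\<close> is itself one of the generators; a cover that contains it has
      the subcover \<open>{P}\<close>.\<close>
    proof (cases "P \<in> C")
      case True
      then have "finite {P} \<and> {P} \<subseteq> C \<and> Q \<subseteq> \<Union>{P}" using assms(1) by simp
      then show ?thesis ..
    next
      case False
      then have "C \<subseteq> S" using C(1) by (auto simp: B_def)
      then show ?thesis using C(2) by (rule fin)
    qed
  qed
  have basic: "openin Y (Q \<inter> U)" if "U \<in> insert P ((\<lambda>U. U \<inter> P) ` S)" for U
  proof -
    have "\<exists>V. V \<in> B \<and> Q \<inter> U = Q \<inter> V"
    proof (cases "U = P")
      case True then show ?thesis by (auto simp: B_def)
    next
      case False
      with that obtain W where "W \<in> S" "U = W \<inter> P" by blast
      then have "W \<in> B \<and> Q \<inter> U = Q \<inter> W" using assms(1) by (auto simp: B_def)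
      then show ?thesis ..
    qed
    then obtain V where "V \<in> B" "Q \<inter> U = Q \<inter> V" by blast
    then show ?thesis
      unfolding Y_def openin_subbase
      by (simp add: arbitrary_union_of_inc finite_intersection_of_inc relative_to_inc)
  qed
  have open_Y: "openin Y (Q \<inter> U)" if "openin (gen_top_on P S) U" for U
    using that unfolding gen_top_on_def openin_topology_generated_by_iff
  proof (induction rule: generate_topology_on.induct)
    case (Int a b)
    have "openin Y ((Q \<inter> a) \<inter> (Q \<inter> b))" by (rule openin_Int[OF Int.IH])
    also have "(Q \<inter> a) \<inter> (Q \<inter> b) = Q \<inter> (a \<inter> b)" by blast
    finally show ?case .
  next
    case (UN K)
    have "openin Y V" if "V \<in> (\<inter>) Q ` K" for V using that UN.IH by blast
    then have "openin Y (\<Union>((\<inter>) Q ` K))" by (rule openin_Union)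
    also have "\<Union>((\<inter>) Q ` K) = Q \<inter> \<Union>K" by blast
    finally show ?case .
  next
    case (Basis s)
    then show ?case by (rule basic)
  qed simp
  have "topspace Y = Q" by (simp add: Y_def)
  show ?thesis
    unfolding compactin_def
  proof (intro conjI allI impI)
    show "Q \<subseteq> topspace (gen_top_on P S)" using assms(1) by simp
    fix UU assume UU: "(\<forall>U\<in>UU. openin (gen_top_on P S) U) \<and> Q \<subseteq> \<Union>UU"
    have "topspace Y \<subseteq> \<Union>((\<inter>) Q ` UU)" using UU \<open>topspace Y = Q\<close> by auto
    moreover have "openin Y U" if "U \<in> (\<inter>) Q ` UU" for U using that UU open_Y by blast
    ultimately have "\<exists>F. finite F \<and> F \<subseteq> (\<inter>) Q ` UU \<and> topspace Y \<subseteq> \<Union>F"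
      using compactinD[OF compact[unfolded compact_space_def]] by simp
    then obtain F where F: "finite F" "F \<subseteq> UU" "Q \<subseteq> \<Union>((\<inter>) Q ` F)"
      unfolding ex_finite_subset_image \<open>topspace Y = Q\<close> by blast
    then have "Q \<subseteq> \<Union>F" by auto
    with F show "\<exists>F. finite F \<and> F \<subseteq> UU \<and> Q \<subseteq> \<Union>F" by metis
  qed
qed

lemma compactin_finite_subcover:
  assumes "compactin T K" "\<And>j. j \<in> J \<Longrightarrow> openin T (N j)" "K \<subseteq> \<Union>(N ` J)"
  obtains I where "finite I" "I \<subseteq> J" "K \<subseteq> \<Union>(N ` I)"
proof -
  have "openin T U" if "U \<in> N ` J" for U using assms(2) that by blast
  from compactinD[OF assms(1) this assms(3)]
  obtain F where F: "finite F" "F \<subseteq> N ` J" "K \<subseteq> \<Union>F" by blast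
  from finite_subset_image[OF F(1,2)] obtain I where "I \<subseteq> J" "finite I" "F = N ` I" by blast
  then show thesis using that F(3) by blast
qed

section \<open>Linear previsions and the weak topology\<close>

lemma topspace_PP_wk [simp]: "topspace (PP_wk b X) = PP b X"
  by (simp add: PP_wk_def)

lemma topspace_PADP_wk [simp]: "topspace (PADP_wk b X) = PADP b X"
  by (simp add: PADP_wk_def)

lemma openin_PP_wk:
  assumes "h \<in> LX X" "0 \<le> r"
  shows "openin (PP_wk b X) {G \<in> PP b X. ennreal r < G h}"
proof -
  have "openin (PP_wk b X) ({G. ennreal r < G h} \<inter> PP b X)"
    unfolding PP_wk_def using assms by (intro openin_gen_top_on; blast)
  moreover have "{G \<in> PP b X. ennreal r < G h} = {G. ennreal r < G h} \<inter> PP b X" by auto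
  ultimately show ?thesis by simp
qed

lemma openin_PADP_wk:
  assumes "h \<in> LX X" "0 \<le> r"
  shows "openin (PADP_wk b X) {F \<in> PADP b X. ennreal r < fst F h}"
    "openin (PADP_wk b X) {F \<in> PADP b X. ennreal r < snd F h}"
proof -
  have "{F \<in> PADP b X. ennreal r < fst F h} = {F. ennreal r < fst F h} \<inter> PADP b X"
    "{F \<in> PADP b X. ennreal r < snd F h} = {F. ennreal r < snd F h} \<inter> PADP b X" by auto
  moreover have "openin (PADP_wk b X) ({F. ennreal r < fst F h} \<inter> PADP b X)"
    "openin (PADP_wk b X) ({F. ennreal r < snd F h} \<inter> PADP b X)"
    unfolding PADP_wk_def using assms by (intro openin_gen_top_on UnI1 UnI2; blast)+
  ultimately show "openin (PADP_wk b X) {F \<in> PADP b X. ennreal r < fst F h}"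
    "openin (PADP_wk b X) {F \<in> PADP b X. ennreal r < snd F h}" by simp_all
qed

lemma PP_wk_nhd:
  assumes "openin (PP_wk b X) V" "G \<in> V"
  obtains I where "finite I" "I \<subseteq> LX X \<times> {0..}" "\<And>h r. (h, r) \<in> I \<Longrightarrow> ennreal r < G h"
    "\<And>G'. G' \<in> PP b X \<Longrightarrow> (\<And>h r. (h, r) \<in> I \<Longrightarrow> ennreal r < G' h) \<Longrightarrow> G' \<in> V"
proof -
  let ?S = "(\<lambda>(h, r). {G :: 'a prev. ennreal r < G h}) ` (LX X \<times> {0..})"
  have "{{G. ennreal r < G h} | h r. h \<in> LX X \<and> r \<ge> 0} = ?S" by auto
  with gen_top_on_nhd[OF assms[unfolded PP_wk_def]]
  obtain A where A: "finite A" "A \<subseteq> ?S" "G \<in> \<Inter>A" "PP b X \<inter> \<Inter>A \<subseteq> V" by auto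
  from finite_subset_image[OF A(1,2)] obtain I where I: "I \<subseteq> LX X \<times> {0..}" "finite I"
    "A = (\<lambda>(h, r). {G. ennreal r < G h}) ` I" by blast
  show thesis
  proof (rule that[OF I(2,1)])
    show "ennreal r < G h" if "(h, r) \<in> I" for h r using A(3) that unfolding I(3) by auto
    show "G' \<in> V" if "G' \<in> PP b X" "\<And>h r. (h, r) \<in> I \<Longrightarrow> ennreal r < G' h" for G'
      using A(4) that unfolding I(3) by auto
  qed
qed

lemma normcond_one:
  assumes "prevision X F" "normcond b X F"
  shows "F (one_L X) \<le> 1" "b = Norm \<Longrightarrow> F (one_L X) = 1"
proof -
  have "F (addf (one_L X) (\<lambda>_. 0)) \<le> 1 + F (\<lambda>_. 0)"
    using assms(2) zero_in_LX[of X] by (cases b) (auto simp: normcond_def simp del: addf_zero)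
  then show "F (one_L X) \<le> 1" by (simp add: prevision_zero[OF assms(1)])
  assume "b = Norm"
  then have "F (addf (one_L X) (\<lambda>_. 0)) = 1 + F (\<lambda>_. 0)"
    using assms(2) zero_in_LX[of X] by (auto simp: normcond_def simp del: addf_zero)
  then show "F (one_L X) = 1" by (simp add: prevision_zero[OF assms(1)])
qed

lemma PP_linear: "G \<in> PP b X \<Longrightarrow> linear_prev X G"
  by (simp add: PP_def)

lemma PP_prevision: "G \<in> PP b X \<Longrightarrow> prevision X G"
  by (simp add: PP_def linear_prev_def)

lemma PP_one_le: "G \<in> PP b X \<Longrightarrow> G (one_L X) \<le> 1"
  by (metis (mono_tags) PP_def PP_prevision mem_Collect_eq normcond_one(1))

text \<open>For a linear prevision the normalization condition only concerns the value at
  \<open>one_L X\<close>. The upper bound is assumed; the lower bound needed for \<open>Norm\<close>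
  is inherited from \<open>q\<close>.\<close>

lemma PP_above:
  assumes "linear_prev X G" "prevision X q" "normcond b X q" "q \<le> G" "G (one_L X) \<le> 1"
  shows "G \<in> PP b X"
proof -
  have "G (one_L X) = 1" if "b = Norm"
    using normcond_one(2)[OF assms(2,3) that] assms(4,5) by (metis antisym le_funD)
  moreover have "G (addf (one_L X) h) = G (one_L X) + G h" if "h \<in> LX X" for h
    using assms(1) one_in_LX that by (rule linear_prevD(2))
  ultimately show ?thesis
    using assms(1,5) by (cases b) (auto simp: PP_def normcond_def intro: add_right_mono)
qed

text \<open>If a subbasic cover has no finite subcover, the complements of its finite subfamilies
  form a filter base of nonempty sets. \<open>filtered_sandwich\<close> gives a linear prevision
  above \<open>q\<close> that is at most \<open>r\<close> at \<open>h\<close> for every member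
  \<open>[h > r]\<close> of the cover, hence an uncovered point.\<close>

lemma compactin_above:
  assumes q: "smyth_prev X q" "normcond b X q"
  shows "compactin (PP_wk b X) {G \<in> PP b X. q \<le> G}"
  unfolding PP_wk_def
proof (rule compactin_gen_top_on)
  let ?Q = "{G \<in> PP b X. q \<le> G}"
  fix C assume C: "C \<subseteq> {{G. ennreal r < G h} | h r. h \<in> LX X \<and> r \<ge> 0}" "?Q \<subseteq> \<Union>C"
  show "\<exists>C'. finite C' \<and> C' \<subseteq> C \<and> ?Q \<subseteq> \<Union>C'"
  proof (rule ccontr)
    assume contra: "\<not> ?thesis"
    define BB where "BB = (\<lambda>C'. ?Q - \<Union>C') ` {C'. finite C' \<and> C' \<subseteq> C}"
    have ne: "B \<noteq> {}" if "B \<in> BB" for B using that contra by (auto simp: BB_def)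
    have sub: "B \<subseteq> ?Q" if "B \<in> BB" for B using that by (auto simp: BB_def)
    have "?Q \<in> BB" unfolding BB_def by (rule image_eqI[of _ _ "{}"]) auto
    obtain G where G: "linear_prev X G" "q \<le> G"
      "\<And>B h. B \<in> BB \<Longrightarrow> h \<in> LX X \<Longrightarrow> G h \<le> (SUP G'\<in>B. G' h)"
    proof (rule filtered_sandwich[OF q(1)])
      show "BB \<noteq> {}" using \<open>?Q \<in> BB\<close> by blast
      show "linear_prev X G" if "B \<in> BB" "G \<in> B" for B G using sub that PP_linear by blast
      fix B h assume B: "B \<in> BB"
      then obtain G where "G \<in> B" using ne by blast
      then show "q h \<le> (SUP G\<in>B. G h)" using sub[OF B] by (auto intro!: SUP_upper2[of G] simp: le_fun_def)
    next
      fix B B' assume "B \<in> BB" "B' \<in> BB"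
      then obtain C1 C2 where "finite C1" "C1 \<subseteq> C" "B = ?Q - \<Union>C1" "finite C2" "C2 \<subseteq> C" "B' = ?Q - \<Union>C2"
        by (auto simp: BB_def)
      then have "?Q - \<Union>(C1 \<union> C2) \<in> BB" "?Q - \<Union>(C1 \<union> C2) \<subseteq> B \<inter> B'"
        by (auto simp: BB_def simp del: Union_Un_distrib intro!: imageI)
      then show "\<exists>B''\<in>BB. B'' \<subseteq> B \<inter> B'" by blast
    qed (use that in blast)
    \<comment> \<open>The complement of the empty subfamily is \<open>?Q\<close> itself; its upper
      bound at \<open>one_L X\<close> keeps the limit subnormalized.\<close>
    have "G (one_L X) \<le> (SUP G'\<in>?Q. G' (one_L X))" by (rule G(3)[OF \<open>?Q \<in> BB\<close> one_in_LX])
    also have "\<dots> \<le> 1" by (rule SUP_least) (use PP_one_le in blast)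
    finally have "G \<in> ?Q" using PP_above[OF G(1) smyth_prevD(1)[OF q(1)] q(2)] G(2) by blast
    then obtain U where "U \<in> C" "G \<in> U" using C by blast
    then obtain h r where U: "h \<in> LX X" "{G. ennreal r < G h} \<in> C" "ennreal r < G h" using C(1) by blast
    then have "?Q - \<Union>{{G. ennreal r < G h}} \<in> BB" unfolding BB_def by (intro imageI) auto
    then have "G h \<le> (SUP G'\<in>?Q - \<Union>{{G. ennreal r < G h}}. G' h)" using U(1) by (rule G(3))
    also have "\<dots> \<le> ennreal r" by (rule SUP_least) auto
    finally show False using U(3) by simp
  qed
qed auto

section \<open>Finite minimax principles\<close>

text \<open>Otherwise a line separates \<open>S\<close> from the open positive quadrant. Its normal
  vector has nonnegative entries, as the quadrant is unbounded in both directions, and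
  \<open>c \<le> 0\<close>, as the quadrant comes arbitrarily close to the origin. Normalizing the
  vector to total weight 1 contradicts \<open>pos\<close>.\<close>

lemma convex_meets_quadrant:
  fixes S :: "(real \<times> real) set"
  assumes "convex S"
    and pos: "\<And>a. 0 \<le> a \<Longrightarrow> a \<le> 1 \<Longrightarrow> \<exists>(x, y)\<in>S. 0 < a * x + (1 - a) * y"
  shows "\<exists>(x, y)\<in>S. 0 < x \<and> 0 < y"
proof (rule ccontr)
  assume contra: "\<not> ?thesis"
  define T where "T = {0<..} \<times> {0<..} \<inter> (UNIV :: (real \<times> real) set)"
  have T: "(x, y) \<in> T \<longleftrightarrow> 0 < x \<and> 0 < y" for x y by (auto simp: T_def)
  have "convex T" unfolding T_def by (intro convex_Int convex_Times) auto
  moreover have "S \<noteq> {}" using pos[of 0] by auto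
  moreover have "T \<noteq> {}" using T by (metis empty_iff zero_less_one)
  moreover have "S \<inter> T = {}" using contra T by auto
  ultimately obtain u c where u: "u \<noteq> 0" "\<And>v. v \<in> S \<Longrightarrow> inner u v \<le> c" "\<And>v. v \<in> T \<Longrightarrow> c \<le> inner u v"
    using separating_hyperplane_sets[of S T] \<open>convex S\<close> by blast
  obtain a b where ab: "u = (a, b)" by force
  have le: "c \<le> a * x + b * y" if "0 < x" "0 < y" for x y
    using u(3)[of "(x, y)"] that by (simp add: ab T)
  have c: "c \<le> 0"
  proof (rule field_le_epsilon)
    fix e :: real assume e: "0 < e"
    \<comment> \<open>The point \<open>(d, d)\<close> is so close to the origin that the separating
      functional is at most \<open>e\<close> there; the summand 1 keeps the denominator
      positive.\<close>
    define d where "d = e / (\<bar>a\<bar> + \<bar>b\<bar> + 1)"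
    have "0 < \<bar>a\<bar> + \<bar>b\<bar> + 1" by (rule add_nonneg_pos) auto
    with e have "0 < d" unfolding d_def by (rule divide_pos_pos)
    then have "c \<le> a * d + b * d" using le by blast
    also have "\<dots> \<le> (\<bar>a\<bar> + \<bar>b\<bar> + 1) * d" 
      using \<open>0 < d\<close> by (simp add: distrib_right[symmetric] mult_right_mono)
    also have "\<dots> = e" unfolding d_def using add_nonneg_pos[of "\<bar>a\<bar> + \<bar>b\<bar>" 1] by simp
    finally show "c \<le> 0 + e" by simp
  qed
  have "0 \<le> a"
  proof (rule ccontr)
    assume "\<not> 0 \<le> a"
    \<comment> \<open>The first coordinate is chosen so that its product with \<open>a\<close> is
      \<open>- (\<bar>c\<bar> + \<bar>b\<bar> + 1)\<close>, which pushes the functional below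
      \<open>c\<close>.\<close>
    then have "c \<le> a * ((\<bar>c\<bar> + \<bar>b\<bar> + 1) / - a) + b * 1"
      by (intro le divide_pos_pos) auto
    also have "\<dots> = - (\<bar>c\<bar> + \<bar>b\<bar> + 1) + b" using \<open>\<not> 0 \<le> a\<close> by (simp add: field_simps)
    finally show False by linarith
  qed
  moreover have "0 \<le> b"
  proof (rule ccontr)
    assume "\<not> 0 \<le> b"
    then have "c \<le> a * 1 + b * ((\<bar>c\<bar> + \<bar>a\<bar> + 1) / - b)"
      by (intro le divide_pos_pos) auto
    also have "\<dots> = a - (\<bar>c\<bar> + \<bar>a\<bar> + 1)" using \<open>\<not> 0 \<le> b\<close> by (simp add: field_simps)
    finally show False by linarith
  qed
  ultimately have ab_pos: "0 < a + b" "0 \<le> a" "0 \<le> b" using u(1) ab by (auto simp: zero_prod_def)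
  obtain x y where xy: "(x, y) \<in> S" "0 < a / (a + b) * x + (1 - a / (a + b)) * y"
    using pos[of "a / (a + b)"] ab_pos by auto
  have "1 - a / (a + b) = b / (a + b)" using ab_pos by (simp add: field_simps)
  then have "0 < (a * x + b * y) / (a + b)" using xy by (simp add: add_divide_distrib)
  then have "0 < a * x + b * y" using ab_pos by (simp add: zero_less_divide_iff)
  then show False using u(2)[OF xy(1)] c by (simp add: ab)
qed

text \<open>Induction on the number of coordinates: cut \<open>S\<close> down to the vectors
  positive at \<open>k\<close>. The weighted positivity required of the smaller set is the planar
  case, with \<open>v k\<close> as one coordinate and the weighted sum of the others as the
  second.\<close>

lemma convex_meets_orthant:
  fixes S :: "('i \<Rightarrow> real) set"
  assumes "finite I" "I = {} \<Longrightarrow> S \<noteq> {}"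
    and "\<And>u v a. u \<in> S \<Longrightarrow> v \<in> S \<Longrightarrow> 0 \<le> a \<Longrightarrow> a \<le> 1 \<Longrightarrow> (\<lambda>i. a * u i + (1 - a) * v i) \<in> S"
    and "\<And>a. (\<And>i. i \<in> I \<Longrightarrow> 0 \<le> a i) \<Longrightarrow> sum a I = 1 \<Longrightarrow> \<exists>v\<in>S. 0 < (\<Sum>i\<in>I. a i * v i)"
  shows "\<exists>v\<in>S. \<forall>i\<in>I. 0 < v i"
  using assms
proof (induction I arbitrary: S rule: finite_induct)
  case empty
  then show ?case by auto
next
  case (insert k J)
  note conv = insert.prems(2) and pos = insert.prems(3)
  define S' where "S' = {v \<in> S. 0 < v k}"
  have "\<exists>v\<in>S'. \<forall>i\<in>J. 0 < v i"
  proof (rule insert.IH)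
    \<comment> \<open>The unit weight at \<open>k\<close> provides a vector positive at
      \<open>k\<close>, as the induction hypothesis demands when \<open>J\<close> is empty.\<close>
    let ?a = "\<lambda>i. if i = k then 1 else 0 :: real"
    have "sum ?a (insert k J) = 1" using insert.hyps by (simp add: sum.delta)
    then have "\<exists>v\<in>S. 0 < (\<Sum>i\<in>insert k J. ?a i * v i)" by (intro pos) simp_all
    then obtain v where "v \<in> S" "0 < (\<Sum>i\<in>insert k J. ?a i * v i)" by blast
    moreover have "(\<Sum>i\<in>insert k J. ?a i * v i) = v k"
      using insert.hyps by (simp add: if_distrib[of "\<lambda>x. x * _"] sum.delta cong: if_cong)
    ultimately show "S' \<noteq> {}" by (auto simp: S'_def)
  next
    fix u v and a :: real assume uv: "u \<in> S'" "v \<in> S'" "0 \<le> a" "a \<le> 1"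
    then have "0 < a * u k + (1 - a) * v k"
      by (cases "a = 0") (auto simp: S'_def intro!: add_pos_nonneg)
    then show "(\<lambda>i. a * u i + (1 - a) * v i) \<in> S'" using uv conv by (auto simp: S'_def)
  next
    fix a :: "'i \<Rightarrow> real" assume a: "\<And>i. i \<in> J \<Longrightarrow> 0 \<le> a i" "sum a J = 1"
    define g where "g v = (v k, \<Sum>i\<in>J. a i * v i)" for v
    have "\<exists>(x, y)\<in>g ` S. 0 < x \<and> 0 < y"
    proof (rule convex_meets_quadrant)
      show "convex (g ` S)"
      proof (rule convexI, elim imageE)
        fix x y u v and s t :: real
        assume st: "0 \<le> s" "0 \<le> t" "s + t = 1" and uv: "x = g u" "u \<in> S" "y = g v" "v \<in> S"
        have "s *\<^sub>R x + t *\<^sub>R y = g (\<lambda>i. s * u i + t * v i)"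
          by (simp add: g_def uv sum.distrib sum_distrib_left distrib_left mult.left_commute)
        moreover have "(\<lambda>i. s * u i + (1 - s) * v i) \<in> S"
          using uv(2,4) st by (intro conv) auto
        moreover have "t = 1 - s" using st by simp
        ultimately show "s *\<^sub>R x + t *\<^sub>R y \<in> g ` S" by (simp only: image_eqI)
      qed
    next
      fix c :: real assume c: "0 \<le> c" "c \<le> 1"
      \<comment> \<open>Mixing the unit weight at \<open>k\<close> with \<open>a\<close> in
        proportion \<open>c\<close> to \<open>1 - c\<close> turns the planar condition into an
        instance of \<open>pos\<close>.\<close>
      let ?a = "\<lambda>i. if i = k then c else (1 - c) * a i"
      have J: "(\<Sum>i\<in>J. ?a i * f i) = (1 - c) * (\<Sum>i\<in>J. a i * f i)" for f :: "'i \<Rightarrow> real"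
        using insert.hyps unfolding sum_distrib_left by (intro sum.cong) auto
      have "sum ?a (insert k J) = 1" using insert.hyps J[of "\<lambda>_. 1"] a by simp
      moreover have "0 \<le> ?a i" if "i \<in> insert k J" for i using that c a by auto
      ultimately have "\<exists>v\<in>S. 0 < (\<Sum>i\<in>insert k J. ?a i * v i)" by (intro pos)
      then obtain v where "v \<in> S" "0 < (\<Sum>i\<in>insert k J. ?a i * v i)" by blast
      then show "\<exists>(x, y)\<in>g ` S. 0 < c * x + (1 - c) * y"
        using insert.hyps J[of v] by (auto simp: g_def intro!: bexI[of _ v])
    qed
    then show "\<exists>v\<in>S'. 0 < (\<Sum>i\<in>J. a i * v i)" by (auto simp: g_def S'_def)
  qed
  then show ?case by (auto simp: S'_def)
qed

section \<open>Weighted sums of possibly infinite values\<close>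

lemma ennreal_weighted_sum:
  assumes "finite I" "\<And>i. i \<in> I \<Longrightarrow> 0 \<le> a i" "\<And>i. i \<in> I \<Longrightarrow> 0 \<le> v i"
  shows "(\<Sum>i\<in>I. ennreal (a i) * ennreal (v i)) = ennreal (\<Sum>i\<in>I. a i * v i)"
proof -
  have "(\<Sum>i\<in>I. ennreal (a i) * ennreal (v i)) = (\<Sum>i\<in>I. ennreal (a i * v i))"
    using assms by (intro sum.cong refl) (simp add: ennreal_mult)
  then show ?thesis using assms by (simp add: sum_ennreal)
qed

lemma ennreal_dense_real:
  fixes x y :: ennreal
  assumes "x < y"
  obtains r where "0 \<le> r" "x < ennreal r" "ennreal r < y"
proof -
  obtain z where z: "x < z" "z < y" using assms dense by blast
  then have "z < top" by (metis top.not_eq_extremum order.strict_trans2 top_greatest)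
  then obtain r where "0 \<le> r" "z = ennreal r" by (cases z) auto
  then show thesis using z that by blast
qed

text \<open>If an infinite value has positive weight, that coordinate alone can be set high enough
  to exceed \<open>t\<close>. Otherwise infinite values have weight 0 and may be replaced by
  anything finite; \<open>enn2real\<close> replaces them by 0.\<close>

lemma weighted_sum_finite_below:
  assumes "finite I" "\<And>i. i \<in> I \<Longrightarrow> 0 \<le> a i" "0 \<le> t"
    and less: "ennreal t < (\<Sum>i\<in>I. ennreal (a i) * g i)"
  obtains v where "\<And>i. i \<in> I \<Longrightarrow> 0 \<le> v i" "\<And>i. i \<in> I \<Longrightarrow> ennreal (v i) \<le> g i"
    "t < (\<Sum>i\<in>I. a i * v i)"
proof (cases "\<exists>k\<in>I. 0 < a k \<and> g k = top")
  case True
  then obtain k where k: "k \<in> I" "0 < a k" "g k = top" by blast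
  define v where "v i = (if i = k then (t + 1) / a k else 0)" for i
  have "(\<Sum>i\<in>I. a i * v i) = t + 1"
    using k assms(1) by (simp add: v_def if_distrib[of "\<lambda>x. _ * x"] sum.delta cong: if_cong)
  then show thesis using k assms(3) by (intro that[of v]) (auto simp: v_def)
next
  case False
  define v where "v i = enn2real (g i)" for i
  have fin: "ennreal (a i) * g i = ennreal (a i) * ennreal (v i)" if "i \<in> I" for i
  proof (cases "a i = 0")
    case True then show ?thesis by simp
  next
    case nz: False
    then have "0 < a i" using assms(2)[OF that] by simp
    then have "g i < top" using False that by (auto simp: less_top)
    then show ?thesis by (simp add: v_def)
  qed
  have "ennreal t < (\<Sum>i\<in>I. ennreal (a i) * ennreal (v i))"
    using less fin by (simp cong: sum.cong)
  also have "\<dots> = ennreal (\<Sum>i\<in>I. a i * v i)"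
    using assms by (intro ennreal_weighted_sum) (auto simp: v_def)
  finally have "t < (\<Sum>i\<in>I. a i * v i)" using assms(3) by (simp add: ennreal_less_iff)
  then show thesis
    by (intro that[of v]) (auto simp: v_def ennreal_enn2real_if)
qed

text \<open>Strictness survives because weights with sum 1 include a positive one. The real numbers
  \<open>v i\<close> squeezed between \<open>r i\<close> and \<open>g i\<close> allow the comparison
  to be made in the reals.\<close>

lemma ennreal_weighted_sum_less:
  assumes "finite I" "\<And>i. i \<in> I \<Longrightarrow> 0 \<le> a i" "sum a I = 1"
    and less: "\<And>i. i \<in> I \<Longrightarrow> 0 \<le> r i" "\<And>i. i \<in> I \<Longrightarrow> ennreal (r i) < g i"
  shows "ennreal (\<Sum>i\<in>I. a i * r i) < (\<Sum>i\<in>I. ennreal (a i) * g i)"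
proof -
  have "\<forall>i\<in>I. \<exists>v. r i < v \<and> ennreal v \<le> g i"
  proof
    fix i assume i: "i \<in> I"
    obtain v where "0 \<le> v" "ennreal (r i) < ennreal v" "ennreal v < g i"
      using ennreal_dense_real[OF less(2)[OF i]] .
    then show "\<exists>v. r i < v \<and> ennreal v \<le> g i"
      using less(1)[OF i] by (intro exI[of _ v]) (simp add: ennreal_less_iff)
  qed
  then obtain v where v: "\<And>i. i \<in> I \<Longrightarrow> r i < v i" "\<And>i. i \<in> I \<Longrightarrow> ennreal (v i) \<le> g i"
    by (metis bchoice)
  obtain k where k: "k \<in> I" "a k \<noteq> 0" using assms(3) by (metis sum.neutral zero_neq_one)
  have "(\<Sum>i\<in>I. a i * r i) < (\<Sum>i\<in>I. a i * v i)"
  proof (rule sum_strict_mono_ex1[OF assms(1)])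
    show "\<forall>i\<in>I. a i * r i \<le> a i * v i" using v assms(2) by (meson less_imp_le mult_left_mono)
    have "0 < a k" using k assms(2)[of k] by simp
    then show "\<exists>i\<in>I. a i * r i < a i * v i" using k v by (meson mult_strict_left_mono)
  qed
  moreover have "0 \<le> (\<Sum>i\<in>I. a i * r i)" using assms(2) less(1) by (simp add: sum_nonneg)
  ultimately have "ennreal (\<Sum>i\<in>I. a i * r i) < ennreal (\<Sum>i\<in>I. a i * v i)"
    by (simp add: ennreal_less_iff)
  also have "\<dots> = (\<Sum>i\<in>I. ennreal (a i) * ennreal (v i))"
    using v less(1) assms by (intro ennreal_weighted_sum[symmetric]) (meson less_imp_le order_trans)+
  also have "\<dots> \<le> (\<Sum>i\<in>I. ennreal (a i) * g i)"
    using v by (intro sum_mono mult_left_mono) auto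
  finally show ?thesis .
qed

lemma prev_convexD:
  "prev_convex L \<Longrightarrow> G \<in> L \<Longrightarrow> G' \<in> L \<Longrightarrow> 0 \<le> a \<Longrightarrow> a \<le> 1 \<Longrightarrow>
    (\<lambda>h. ennreal a * G h + ennreal (1 - a) * G' h) \<in> L"
  by (simp add: prev_convex_def)

text \<open>\<open>S\<close> consists of the real vectors \<open>w\<close> for which
  \<open>w + r\<close> is dominated by the values of some \<open>G\<close> in \<open>L\<close>.
  Passing to dominated real vectors removes infinite values and keeps convexity, so a strictly
  positive element of \<open>S\<close> is what is sought.\<close>

lemma minimax_above:
  fixes h :: "'i \<Rightarrow> 'a \<Rightarrow> ennreal"
  assumes I: "finite I" and L: "prev_convex L" "L \<noteq> {}"
    and r: "\<And>i. i \<in> I \<Longrightarrow> 0 \<le> r i"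
    and ex: "\<And>a. (\<And>i. i \<in> I \<Longrightarrow> 0 \<le> a i) \<Longrightarrow> sum a I = 1 \<Longrightarrow>
      \<exists>G\<in>L. ennreal (\<Sum>i\<in>I. a i * r i) < (\<Sum>i\<in>I. ennreal (a i) * G (h i))"
  shows "\<exists>G\<in>L. \<forall>i\<in>I. ennreal (r i) < G (h i)"
proof -
  define S where "S = {w. \<exists>G\<in>L. \<forall>i\<in>I. 0 \<le> w i + r i \<and> ennreal (w i + r i) \<le> G (h i)}"
  have "\<exists>w\<in>S. \<forall>i\<in>I. 0 < w i"
  proof (rule convex_meets_orthant[OF I])
    assume "I = {}" then show "S \<noteq> {}" using L by (auto simp: S_def)
  next
    fix u v and a :: real assume uv: "u \<in> S" "v \<in> S" and a: "0 \<le> a" "a \<le> 1"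
    from uv(1) obtain G where G: "G \<in> L" "\<And>i. i \<in> I \<Longrightarrow> 0 \<le> u i + r i \<and> ennreal (u i + r i) \<le> G (h i)"
      by (auto simp: S_def)
    from uv(2) obtain G' where G': "G' \<in> L" "\<And>i. i \<in> I \<Longrightarrow> 0 \<le> v i + r i \<and> ennreal (v i + r i) \<le> G' (h i)"
      by (auto simp: S_def)
    have "0 \<le> (a * u i + (1 - a) * v i) + r i \<and>
        ennreal ((a * u i + (1 - a) * v i) + r i) \<le> ennreal a * G (h i) + ennreal (1 - a) * G' (h i)"
      if i: "i \<in> I" for i
    proof -
      have eq: "(a * u i + (1 - a) * v i) + r i = a * (u i + r i) + (1 - a) * (v i + r i)"
        by (simp add: algebra_simps)
      have "ennreal (a * (u i + r i) + (1 - a) * (v i + r i))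
          = ennreal a * ennreal (u i + r i) + ennreal (1 - a) * ennreal (v i + r i)"
        using a G(2)[OF i] G'(2)[OF i] by (simp add: ennreal_mult)
      also have "\<dots> \<le> ennreal a * G (h i) + ennreal (1 - a) * G' (h i)"
        using G(2)[OF i] G'(2)[OF i] by (intro add_mono mult_left_mono) auto
      finally show ?thesis unfolding eq using a G(2)[OF i] G'(2)[OF i] by simp
    qed
    then show "(\<lambda>i. a * u i + (1 - a) * v i) \<in> S"
      unfolding S_def by (intro CollectI bexI[OF _ prev_convexD[OF L(1) G(1) G'(1) a]] ballI)
  next
    fix a :: "'i \<Rightarrow> real" assume a: "\<And>i. i \<in> I \<Longrightarrow> 0 \<le> a i" "sum a I = 1"
    then obtain G where G: "G \<in> L" "ennreal (\<Sum>i\<in>I. a i * r i) < (\<Sum>i\<in>I. ennreal (a i) * G (h i))"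
      using ex by blast
    have "0 \<le> (\<Sum>i\<in>I. a i * r i)" using a r by (simp add: sum_nonneg)
    then obtain v where v: "\<And>i. i \<in> I \<Longrightarrow> 0 \<le> v i" "\<And>i. i \<in> I \<Longrightarrow> ennreal (v i) \<le> G (h i)"
      "(\<Sum>i\<in>I. a i * r i) < (\<Sum>i\<in>I. a i * v i)"
      using weighted_sum_finite_below[OF I a(1) _ G(2)] by blast
    have "(\<lambda>i. v i - r i) \<in> S" using v G by (auto simp: S_def)
    moreover have "0 < (\<Sum>i\<in>I. a i * (v i - r i))"
      using v(3) by (simp add: right_diff_distrib sum_subtractf)
    ultimately show "\<exists>w\<in>S. 0 < (\<Sum>i\<in>I. a i * w i)" by (intro bexI[of _ "\<lambda>i. v i - r i"])
  qed
  then obtain w G where w: "\<forall>i\<in>I. 0 < w i" and G: "G \<in> L"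
    "\<forall>i\<in>I. 0 \<le> w i + r i \<and> ennreal (w i + r i) \<le> G (h i)" by (auto simp: S_def)
  have "ennreal (r i) < G (h i)" if i: "i \<in> I" for i
  proof -
    have "ennreal (r i) < ennreal (w i + r i)"
      using w r[OF i] i by (simp add: ennreal_less_iff del: ennreal_plus)
    also have "\<dots> \<le> G (h i)" using G i by blast
    finally show ?thesis .
  qed
  with G show ?thesis by blast
qed

text \<open>Here infinite values cannot be cut off, since the real vector has to dominate the values
  of \<open>G\<close>. For this reason \<open>ex\<close> ranges over all nonnegative weights, not
  only those of sum 1: they can be perturbed to be strictly positive. The bound \<open>t\<close>
  stands for an infimum that need not be attained.\<close>

lemma minimax_below:
  fixes h :: "'i \<Rightarrow> 'a \<Rightarrow> ennreal"
  assumes I: "finite I" and L: "prev_convex L"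
    and cr: "\<And>i. i \<in> I \<Longrightarrow> c i < ennreal (r i)"
    and ex: "\<And>a t. (\<And>i. i \<in> I \<Longrightarrow> 0 \<le> a i) \<Longrightarrow> (\<Sum>i\<in>I. ennreal (a i) * c i) < t \<Longrightarrow>
      \<exists>G\<in>L. (\<Sum>i\<in>I. ennreal (a i) * G (h i)) < t"
  shows "\<exists>G\<in>L. \<forall>i\<in>I. G (h i) < ennreal (r i)"
proof -
  define S where "S = {w. \<exists>G\<in>L. \<forall>i\<in>I. 0 \<le> r i - w i \<and> G (h i) \<le> ennreal (r i - w i)}"
  have "\<exists>w\<in>S. \<forall>i\<in>I. 0 < w i"
  proof (rule convex_meets_orthant[OF I])
    assume "I = {}" then show "S \<noteq> {}" using ex[of "\<lambda>_. 0" 1] by (auto simp: S_def)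
  next
    fix u v and a :: real assume uv: "u \<in> S" "v \<in> S" and a: "0 \<le> a" "a \<le> 1"
    from uv(1) obtain G where G: "G \<in> L" "\<And>i. i \<in> I \<Longrightarrow> 0 \<le> r i - u i \<and> G (h i) \<le> ennreal (r i - u i)"
      by (auto simp: S_def)
    from uv(2) obtain G' where G': "G' \<in> L" "\<And>i. i \<in> I \<Longrightarrow> 0 \<le> r i - v i \<and> G' (h i) \<le> ennreal (r i - v i)"
      by (auto simp: S_def)
    have "0 \<le> r i - (a * u i + (1 - a) * v i) \<and>
        ennreal a * G (h i) + ennreal (1 - a) * G' (h i) \<le> ennreal (r i - (a * u i + (1 - a) * v i))"
      if i: "i \<in> I" for i
    proof -
      have eq: "r i - (a * u i + (1 - a) * v i) = a * (r i - u i) + (1 - a) * (r i - v i)"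
        by (simp add: algebra_simps)
      have "ennreal a * G (h i) + ennreal (1 - a) * G' (h i)
          \<le> ennreal a * ennreal (r i - u i) + ennreal (1 - a) * ennreal (r i - v i)"
        using G(2)[OF i] G'(2)[OF i] by (intro add_mono mult_left_mono) auto
      also have "\<dots> = ennreal (a * (r i - u i) + (1 - a) * (r i - v i))"
        using a G(2)[OF i] G'(2)[OF i] by (simp add: ennreal_mult)
      finally show ?thesis unfolding eq using a G(2)[OF i] G'(2)[OF i] by simp
    qed
    then show "(\<lambda>i. a * u i + (1 - a) * v i) \<in> S"
      unfolding S_def by (intro CollectI bexI[OF _ prev_convexD[OF L G(1) G'(1) a]] ballI)
  next
    fix a :: "'i \<Rightarrow> real" assume a: "\<And>i. i \<in> I \<Longrightarrow> 0 \<le> a i" "sum a I = 1"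
    define d where "d i = enn2real (c i)" for i
    have c: "c i = ennreal (d i)" "0 \<le> d i" "d i < r i" if "i \<in> I" for i
    proof -
      have "c i < top" using cr[OF that] by (metis ennreal_less_top order.strict_trans)
      then show cd: "c i = ennreal (d i)" by (simp add: d_def)
      show nonneg: "0 \<le> d i" by (simp add: d_def)
      show "d i < r i" using cr[OF that] nonneg unfolding cd by (simp add: ennreal_less_iff)
    qed
    obtain k where k: "k \<in> I" "a k \<noteq> 0" using a(2) by (metis sum.neutral zero_neq_one)
    have "(\<Sum>i\<in>I. a i * d i) < (\<Sum>i\<in>I. a i * r i)"
    proof (rule sum_strict_mono_ex1[OF I])
      show "\<forall>i\<in>I. a i * d i \<le> a i * r i" using c a(1) by (meson less_imp_le mult_left_mono)
      have "0 < a k" using k a(1)[of k] by simp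
      then show "\<exists>i\<in>I. a i * d i < a i * r i" using k c by (meson mult_strict_left_mono)
    qed
    moreover define D where "D = (\<Sum>i\<in>I. d i)"
    moreover have "0 \<le> D" unfolding D_def using c by (simp add: sum_nonneg)
    \<comment> \<open>Adding \<open>e\<close> to every weight raises the sum over \<open>d\<close>
      by \<open>e * D\<close>. Dividing the gap by \<open>D + 1\<close> keeps this strictly smaller
      than the gap and avoids dividing by 0.\<close>
    moreover define e where "e = ((\<Sum>i\<in>I. a i * r i) - (\<Sum>i\<in>I. a i * d i)) / (D + 1)"
    ultimately have e: "0 < e" and "e * (D + 1) = (\<Sum>i\<in>I. a i * r i) - (\<Sum>i\<in>I. a i * d i)" by auto
    then have sum_less: "(\<Sum>i\<in>I. a i * d i) + e * D < (\<Sum>i\<in>I. a i * r i)"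
      by (simp add: distrib_left)
    txt \<open>The perturbation by \<open>e\<close> forces all values \<open>G (h i)\<close> to be finite, also where \<open>a i = 0\<close>.\<close>
    have ae: "0 < a i + e" if "i \<in> I" for i using a(1)[OF that] e by simp
    have "(\<Sum>i\<in>I. ennreal (a i + e) * c i) = (\<Sum>i\<in>I. ennreal (a i + e) * ennreal (d i))"
      using c by (intro sum.cong) auto
    also have "\<dots> = ennreal (\<Sum>i\<in>I. (a i + e) * d i)"
      using ae c by (intro ennreal_weighted_sum[OF I]) (auto simp: less_imp_le)
    also have "(\<Sum>i\<in>I. (a i + e) * d i) = (\<Sum>i\<in>I. a i * d i) + e * D"
      by (simp add: distrib_right sum.distrib sum_distrib_left D_def)
    also have "ennreal \<dots> < ennreal (\<Sum>i\<in>I. a i * r i)"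
    proof -
      have "0 \<le> (\<Sum>i\<in>I. a i * d i)" using a c by (simp add: sum_nonneg)
      then show ?thesis using sum_less \<open>0 \<le> D\<close> e by (simp add: ennreal_less_iff del: ennreal_plus)
    qed
    finally obtain G where G: "G \<in> L"
      "(\<Sum>i\<in>I. ennreal (a i + e) * G (h i)) < ennreal (\<Sum>i\<in>I. a i * r i)"
      using ex[of "\<lambda>i. a i + e"] ae by (meson less_imp_le)
    define g where "g i = enn2real (G (h i))" for i
    have fin: "G (h i) = ennreal (g i)" if i: "i \<in> I" for i
    proof -
      have "ennreal (a i + e) * G (h i) \<le> (\<Sum>i\<in>I. ennreal (a i + e) * G (h i))"
        by (rule member_le_sum[OF i _ I]) simp
      then have "ennreal (a i + e) * G (h i) < top"
        using G(2) by (metis ennreal_less_top order.strict_trans order.strict_trans1)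
      then have "G (h i) < top" using ae[OF i] by (auto simp: ennreal_mult_less_top)
      then show ?thesis by (simp add: g_def)
    qed
    have "ennreal (\<Sum>i\<in>I. a i * g i) = (\<Sum>i\<in>I. ennreal (a i) * ennreal (g i))"
      using a by (intro ennreal_weighted_sum[symmetric] I) (auto simp: g_def)
    also have "\<dots> \<le> (\<Sum>i\<in>I. ennreal (a i + e) * G (h i))"
      using fin e by (intro sum_mono mult_mono) (auto intro!: ennreal_leI)
    also note G(2)
    finally have less: "(\<Sum>i\<in>I. a i * g i) < (\<Sum>i\<in>I. a i * r i)"
      using a by (subst (asm) ennreal_less_iff) (auto simp: g_def intro!: sum_nonneg)
    have "(\<lambda>i. r i - g i) \<in> S" using G(1) fin by (auto simp: S_def g_def)
    moreover have "0 < (\<Sum>i\<in>I. a i * (r i - g i))"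
      using less by (simp add: right_diff_distrib sum_subtractf)
    ultimately show "\<exists>w\<in>S. 0 < (\<Sum>i\<in>I. a i * w i)" by (intro bexI[of _ "\<lambda>i. r i - g i"])
  qed
  then obtain w G where w: "\<forall>i\<in>I. 0 < w i" and G: "G \<in> L"
    "\<forall>i\<in>I. 0 \<le> r i - w i \<and> G (h i) \<le> ennreal (r i - w i)" by (auto simp: S_def)
  have "G (h i) < ennreal (r i)" if i: "i \<in> I" for i
  proof -
    have "G (h i) \<le> ennreal (r i - w i)" using G i by blast
    also have "\<dots> < ennreal (r i)" using w G(2) i by (simp add: ennreal_less_iff)
    finally show ?thesis .
  qed
  with G show ?thesis by blast
qed

section \<open>Finite linear combinations in the cone\<close>

definition lincomb :: "'i set \<Rightarrow> ('i \<Rightarrow> real) \<Rightarrow> ('i \<Rightarrow> 'a \<Rightarrow> ennreal) \<Rightarrow> 'a \<Rightarrow> ennreal" where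
  "lincomb I a h = (\<lambda>x. \<Sum>i\<in>I. ennreal (a i) * h i x)"

lemma lincomb_insert:
  "finite I \<Longrightarrow> i \<notin> I \<Longrightarrow> lincomb (insert i I) a h = addf (smul (a i) (h i)) (lincomb I a h)"
  by (simp add: lincomb_def addf_def smul_def)

lemma lincomb_in_LX:
  assumes "finite I" "\<And>i. i \<in> I \<Longrightarrow> 0 \<le> a i" "\<And>i. i \<in> I \<Longrightarrow> h i \<in> LX X"
  shows "lincomb I a h \<in> LX X"
  using assms
proof (induction I rule: finite_induct)
  case empty
  then show ?case by (simp add: lincomb_def zero_in_LX)
next
  case (insert i I)
  then show ?case unfolding lincomb_insert[OF insert.hyps] by (intro LX_closed) auto
qed

lemma lincomb_mono: "(\<And>i. i \<in> I \<Longrightarrow> a i \<le> b i) \<Longrightarrow> lincomb I a h \<le> lincomb I b h"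
  by (auto simp: lincomb_def le_fun_def intro!: sum_mono mult_right_mono ennreal_leI)

lemma linear_prev_lincomb:
  assumes "finite I" "linear_prev X G" "\<And>i. i \<in> I \<Longrightarrow> 0 \<le> a i" "\<And>i. i \<in> I \<Longrightarrow> h i \<in> LX X"
  shows "G (lincomb I a h) = (\<Sum>i\<in>I. ennreal (a i) * G (h i))"
  using assms
proof (induction I rule: finite_induct)
  case empty
  then show ?case by (simp add: lincomb_def prevision_zero[OF linear_prevD(1)])
next
  case (insert i I)
  then have LX: "smul (a i) (h i) \<in> LX X" "lincomb I a h \<in> LX X"
    by (auto intro!: smul_in_LX lincomb_in_LX)
  have IH: "G (lincomb I a h) = (\<Sum>i\<in>I. ennreal (a i) * G (h i))"
    using insert by blast
  have "G (smul (a i) (h i)) = ennreal (a i) * G (h i)"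
    using insert.prems by (intro prevision_smul linear_prevD) auto
  then show ?case
    unfolding lincomb_insert[OF insert.hyps] linear_prevD(2)[OF insert.prems(1) LX] IH
    using insert.hyps by simp
qed

section \<open>Convex sets of linear previsions between their bounds\<close>

text \<open>If each member of \<open>L\<close> exceeds \<open>G\<close> somewhere, compactness
  reduces the witnesses to finitely many pairs \<open>(h, r)\<close> with \<open>G h < r\<close>,
  one of which satisfies \<open>r < G' h\<close> for each \<open>G'\<close> in \<open>L\<close>. By
  linearity, weighted sums of values are values at \<open>lincomb\<close>, so the bound by the
  infimum is what \<open>minimax_below\<close> takes, and it yields an element of \<open>L\<close>
  that violates all pairs.\<close>

lemma convex_set_below:
  assumes L: "prev_convex L" "compactin (PP_wk b X) L" and G: "linear_prev X G"
    and le: "\<And>h. h \<in> LX X \<Longrightarrow> (INF G'\<in>L. G' h) \<le> G h"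
  shows "\<exists>G'\<in>L. G' \<le> G"
proof (rule ccontr)
  assume contra: "\<not> ?thesis"
  have LPP: "L \<subseteq> PP b X" using compactin_subset_topspace[OF L(2)] by simp
  define J where "J = {(h, r). h \<in> LX X \<and> 0 \<le> r \<and> G h < ennreal r}"
  define N where "N = (\<lambda>(h, r). {G' \<in> PP b X. ennreal r < G' h})"
  have "L \<subseteq> \<Union>(N ` J)"
  proof
    fix G' assume G': "G' \<in> L"
    then have "\<not> G' \<le> G" "prevision X G'" using contra LPP PP_prevision by blast+
    then obtain h where h: "h \<in> LX X" "G h < G' h" using prevision_le[of X G' G] by (meson not_le)
    obtain r where "0 \<le> r" "G h < ennreal r" "ennreal r < G' h" using ennreal_dense_real[OF h(2)] .
    then have "(h, r) \<in> J" "G' \<in> N (h, r)" using h G' LPP by (auto simp: J_def N_def)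
    then show "G' \<in> \<Union>(N ` J)" by blast
  qed
  moreover have "openin (PP_wk b X) (N i)" if "i \<in> J" for i
    using that openin_PP_wk by (auto simp: J_def N_def)
  ultimately obtain I where I: "finite I" "I \<subseteq> J" "L \<subseteq> \<Union>(N ` I)"
    using compactin_finite_subcover[OF L(2)] by metis
  have "\<exists>G'\<in>L. \<forall>i\<in>I. G' (fst i) < ennreal (snd i)"
  proof (rule minimax_below[OF I(1) L(1)])
    show "G (fst i) < ennreal (snd i)" if "i \<in> I" for i using that I(2) by (auto simp: J_def)
    fix a t assume a: "\<And>i. i \<in> I \<Longrightarrow> 0 \<le> a i" and t: "(\<Sum>i\<in>I. ennreal (a i) * G (fst i)) < t"
    have LX: "fst i \<in> LX X" if "i \<in> I" for i using that I(2) by (auto simp: J_def)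
    have eq: "F (lincomb I a fst) = (\<Sum>i\<in>I. ennreal (a i) * F (fst i))" if "linear_prev X F" for F
      by (rule linear_prev_lincomb[OF I(1) that]) (fact a LX)+
    have "(INF G'\<in>L. G' (lincomb I a fst)) \<le> G (lincomb I a fst)"
      by (intro le lincomb_in_LX I a LX)
    also have "\<dots> < t" using t eq[OF G] by simp
    finally have "(INF G'\<in>L. G' (lincomb I a fst)) < t" .
    then obtain G' where G': "G' \<in> L" "G' (lincomb I a fst) < t" by (auto simp: INF_less_iff)
    then have "linear_prev X G'" using LPP PP_linear by blast
    then have "(\<Sum>i\<in>I. ennreal (a i) * G' (fst i)) < t"
      using G'(2) by (simp only: eq)
    then show "\<exists>G'\<in>L. (\<Sum>i\<in>I. ennreal (a i) * G' (fst i)) < t"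
      using G'(1) by (rule bexI)
  qed
  then obtain G' where G': "G' \<in> L" "\<forall>i\<in>I. G' (fst i) < ennreal (snd i)" by blast
  then obtain i where "i \<in> I" "G' \<in> N i" using I(3) by blast
  then show False using G'(2) by (auto simp: N_def split: prod.splits)
qed

text \<open>\<open>minimax_above\<close> with the weighted sums read, by linearity, as values at a
  single combination. The condition thereby involves only the supremum of \<open>L\<close>, so for
  forks it becomes a condition on the second component.\<close>

lemma convex_set_meets_nhd:
  fixes h :: "'i \<Rightarrow> 'a \<Rightarrow> ennreal"
  assumes L: "prev_convex L" "L \<noteq> {}" "L \<subseteq> PP b X"
    and I: "finite I" "\<And>i. i \<in> I \<Longrightarrow> h i \<in> LX X" "\<And>i. i \<in> I \<Longrightarrow> 0 \<le> r i"
    and less: "\<And>a. (\<And>i. i \<in> I \<Longrightarrow> 0 \<le> a i) \<Longrightarrow> sum a I = 1 \<Longrightarrow>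
      ennreal (\<Sum>i\<in>I. a i * r i) < (SUP G\<in>L. G (lincomb I a h))"
  shows "\<exists>G\<in>L. \<forall>i\<in>I. ennreal (r i) < G (h i)"
proof (rule minimax_above[OF I(1) L(1,2) I(3)])
  fix a :: "'i \<Rightarrow> real" assume a: "\<And>i. i \<in> I \<Longrightarrow> 0 \<le> a i" "sum a I = 1"
  then obtain G where G: "G \<in> L" "ennreal (\<Sum>i\<in>I. a i * r i) < G (lincomb I a h)"
    using less[of a] by (auto simp: less_SUP_iff)
  then have "linear_prev X G" using L(3) PP_linear by blast
  then have "G (lincomb I a h) = (\<Sum>i\<in>I. ennreal (a i) * G (h i))"
    by (rule linear_prev_lincomb[OF I(1)]) (fact a I)+
  with G show "\<exists>G\<in>L. ennreal (\<Sum>i\<in>I. a i * r i) < (\<Sum>i\<in>I. ennreal (a i) * G (h i))"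
    by auto
qed

lemma convex_set_closure:
  assumes L: "prev_convex L" "L \<noteq> {}" "L \<subseteq> PP b X" and G: "G \<in> PP b X"
    and le: "\<And>h. h \<in> LX X \<Longrightarrow> G h \<le> (SUP G'\<in>L. G' h)"
  shows "G \<in> PP_wk b X closure_of L"
  unfolding in_closure_of
proof (intro conjI allI impI)
  show "G \<in> topspace (PP_wk b X)" using G by simp
  fix V assume V: "G \<in> V \<and> openin (PP_wk b X) V"
  then obtain I where I: "finite I" "I \<subseteq> LX X \<times> {0..}" "\<And>h r. (h, r) \<in> I \<Longrightarrow> ennreal r < G h"
    "\<And>G'. G' \<in> PP b X \<Longrightarrow> (\<And>h r. (h, r) \<in> I \<Longrightarrow> ennreal r < G' h) \<Longrightarrow> G' \<in> V"
    using PP_wk_nhd by metis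
  have LX: "fst i \<in> LX X" and pos: "0 \<le> snd i" if "i \<in> I" for i using that I(2) by auto
  have "\<exists>G'\<in>L. \<forall>i\<in>I. ennreal (snd i) < G' (fst i)"
  proof (rule convex_set_meets_nhd[OF L I(1) LX pos])
    fix a :: "('a \<Rightarrow> ennreal) \<times> real \<Rightarrow> real" assume a: "\<And>i. i \<in> I \<Longrightarrow> 0 \<le> a i" "sum a I = 1"
    have "ennreal (\<Sum>i\<in>I. a i * snd i) < (\<Sum>i\<in>I. ennreal (a i) * G (fst i))"
      using I(3) by (intro ennreal_weighted_sum_less I(1) a pos) auto
    also have "\<dots> = G (lincomb I a fst)"
      by (rule linear_prev_lincomb[OF I(1) PP_linear[OF G], symmetric]) (fact a LX)+
    also have "\<dots> \<le> (SUP G'\<in>L. G' (lincomb I a fst))"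
      by (intro le lincomb_in_LX I(1) a LX)
    finally show "ennreal (\<Sum>i\<in>I. a i * snd i) < (SUP G'\<in>L. G' (lincomb I a fst))" .
  qed
  then obtain G' where "G' \<in> L" "\<forall>i\<in>I. ennreal (snd i) < G' (fst i)" by blast
  then show "\<exists>G'. G' \<in> L \<and> G' \<in> V" using I(4)[of G'] L(3) by force
qed

section \<open>The Scott topology on the cone\<close>

lemma scott_open_LXD:
  assumes "scott_open_LX X U"
  shows "U \<subseteq> LX X" "h \<in> U \<Longrightarrow> k \<in> LX X \<Longrightarrow> h \<le> k \<Longrightarrow> k \<in> U"
    "D \<subseteq> LX X \<Longrightarrow> directed_set D \<Longrightarrow> Sup D \<in> U \<Longrightarrow> D \<inter> U \<noteq> {}"
  using assms unfolding scott_open_LX_def by simp_all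

lemma istopology_scott_open_LX: "istopology (scott_open_LX X)"
proof -
  have "scott_open_LX X (U \<inter> V)" if U: "scott_open_LX X U" and V: "scott_open_LX X V" for U V
    unfolding scott_open_LX_def
  proof (intro conjI allI impI ballI)
    show "U \<inter> V \<subseteq> LX X" using U by (auto simp: scott_open_LX_def)
    show "k \<in> U \<inter> V" if "h \<in> U \<inter> V" "k \<in> LX X" "h \<le> k" for h k
      using scott_open_LXD(2)[OF U, of h k] scott_open_LXD(2)[OF V, of h k] that by simp
    fix D assume D: "D \<subseteq> LX X" "directed_set D" "Sup D \<in> U \<inter> V"
    then have "D \<inter> U \<noteq> {}" "D \<inter> V \<noteq> {}"
      using scott_open_LXD(3)[OF U D(1,2)] scott_open_LXD(3)[OF V D(1,2)] by simp_all
    then obtain u v where uv: "u \<in> D" "u \<in> U" "v \<in> D" "v \<in> V" by blast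
    then obtain d where d: "d \<in> D" "u \<le> d" "v \<le> d"
      using D(2) unfolding directed_set_def by blast
    have "d \<in> LX X" using d(1) D(1) by blast
    then have "d \<in> U" "d \<in> V"
      using scott_open_LXD(2)[OF U uv(2)] scott_open_LXD(2)[OF V uv(4)] d by simp_all
    then show "D \<inter> (U \<inter> V) \<noteq> {}" using d by blast
  qed
  moreover have "scott_open_LX X (\<Union>K)" if K: "\<forall>U\<in>K. scott_open_LX X U" for K
    unfolding scott_open_LX_def
  proof (intro conjI allI impI ballI)
    show "\<Union>K \<subseteq> LX X" using K by (auto simp: scott_open_LX_def)
    show "k \<in> \<Union>K" if hk: "h \<in> \<Union>K" "k \<in> LX X" "h \<le> k" for h k
    proof -
      obtain U where "U \<in> K" "h \<in> U" using hk(1) by blast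
      then show ?thesis using scott_open_LXD(2)[of X U h k] K hk by blast
    qed
    fix D assume D: "D \<subseteq> LX X" "directed_set D" "Sup D \<in> \<Union>K"
    then obtain U where "U \<in> K" "Sup D \<in> U" by blast
    moreover have "scott_open_LX X U" using \<open>U \<in> K\<close> K by blast
    then have "D \<inter> U \<noteq> {}" using D(1,2) \<open>Sup D \<in> U\<close> by (rule scott_open_LXD(3))
    ultimately show "D \<inter> \<Union>K \<noteq> {}" by blast
  qed
  ultimately show ?thesis by (simp add: istopology_def)
qed

lemma openin_scottLX: "openin (scottLX X) U \<longleftrightarrow> scott_open_LX X U"
  unfolding scottLX_def by (simp add: topology_inverse'[OF istopology_scott_open_LX])

lemma topspace_scottLX [simp]: "topspace (scottLX X) = LX X"
proof -
  have "scott_open_LX X (LX X)"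
    by (auto simp: scott_open_LX_def directed_set_def)
  then show ?thesis
    by (metis openin_scottLX openin_subset openin_topspace scott_open_LX_def subset_antisym)
qed

lemma scott_open_superlevel:
  assumes mono: "\<And>h k. h \<in> LX X \<Longrightarrow> k \<in> LX X \<Longrightarrow> h \<le> k \<Longrightarrow> F h \<le> F k"
    and cont: "\<And>D. D \<subseteq> LX X \<Longrightarrow> directed_set D \<Longrightarrow> F (Sup D) \<le> (SUP d\<in>D. F d)"
  shows "openin (scottLX X) {h \<in> LX X. (t :: ennreal) < F h}"
  unfolding openin_scottLX scott_open_LX_def
proof (intro conjI allI impI ballI)
  fix h k assume "h \<in> {h \<in> LX X. t < F h}" "k \<in> LX X" "h \<le> k"
  then show "k \<in> {h \<in> LX X. t < F h}" using mono[of h k] by auto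
next
  fix D assume D: "D \<subseteq> LX X" "directed_set D" "Sup D \<in> {h \<in> LX X. t < F h}"
  then have "t < (SUP d\<in>D. F d)" using cont[OF D(1,2)] by auto
  then show "D \<inter> {h \<in> LX X. t < F h} \<noteq> {}" using D(1) by (auto simp: less_SUP_iff)
qed auto

text \<open>Superlevel sets of evaluation at a point are Scott-open, and they separate maps that are
  not pointwise comparable. With this the upward closures in almost openness become pointwise
  comparisons.\<close>

lemma spec_le_scottLX: "spec_le (scottLX X) h k \<longleftrightarrow> h \<in> LX X \<and> k \<in> LX X \<and> h \<le> k"
proof
  assume le: "spec_le (scottLX X) h k"
  then have LX: "h \<in> LX X" "k \<in> LX X" by (auto simp: spec_le_def)
  have "h x \<le> k x" for x
  proof (rule ccontr)
    assume "\<not> h x \<le> k x"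
    then have "k x < h x" by simp
    moreover have "openin (scottLX X) {g \<in> LX X. k x < g x}"
      by (rule scott_open_superlevel) (auto simp: le_fun_def)
    ultimately have "k \<in> {g \<in> LX X. k x < g x}" using le LX unfolding spec_le_def by blast
    then show False by simp
  qed
  with LX show "h \<in> LX X \<and> k \<in> LX X \<and> h \<le> k" by (simp add: le_fun_def)
next
  assume "h \<in> LX X \<and> k \<in> LX X \<and> h \<le> k"
  then show "spec_le (scottLX X) h k"
    unfolding spec_le_def by (auto simp: openin_scottLX scott_open_LX_def)
qed

section \<open>Forks and the linear previsions between them\<close>

lemma PADP_dest:
  assumes "F \<in> PADP b X"
  shows "smyth_prev X (fst F)" "hoare_prev X (snd F)"
    "normcond b X (fst F)" "normcond b X (snd F)"
    "h \<in> LX X \<Longrightarrow> k \<in> LX X \<Longrightarrow> fst F (addf h k) \<le> fst F h + snd F k"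
    "h \<in> LX X \<Longrightarrow> k \<in> LX X \<Longrightarrow> fst F h + snd F k \<le> snd F (addf h k)"
  using assms by (auto simp: PADP_def is_fork_def)

lemma PADP_prevision:
  assumes "F \<in> PADP b X"
  shows "prevision X (fst F)" "prevision X (snd F)"
  using PADP_dest(1,2)[OF assms] by (auto simp: smyth_prev_def hoare_prev_def)

lemma sublinear_on_snd:
  assumes "F \<in> PADP b X"
  shows "sublinear_on X (snd F)"
  unfolding sublinear_on_def
  using prevision_smul[OF PADP_prevision(2)[OF assms]] hoare_prevD(2)[OF PADP_dest(2)[OF assms]]
  by auto

text \<open>Normalization of \<open>G\<close> follows from the bounds: the second component caps the
  value at \<open>one_L X\<close>, and the first secures it from below under
  \<open>Norm\<close>.\<close>

lemma s_ADP_I: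
  assumes F: "F \<in> PADP b X" and G: "linear_prev X G" "fst F \<le> G"
    "\<And>h. h \<in> LX X \<Longrightarrow> G h \<le> snd F h"
  shows "G \<in> s_ADP b X F"
proof -
  have "G (one_L X) \<le> 1"
    using G(3)[OF one_in_LX] normcond_one(1)[OF PADP_prevision(2)[OF F] PADP_dest(4)[OF F]]
    by (rule order_trans)
  then have "G \<in> PP b X" using PP_above[OF G(1) PADP_prevision(1)[OF F] PADP_dest(3)[OF F] G(2)] by simp
  moreover have "G \<le> snd F" using prevision_le[OF linear_prevD(1)[OF G(1)] G(3)] .
  ultimately show ?thesis using G(2) by (simp add: s_ADP_def)
qed

text \<open>The fork inequality \<open>fst F (h + k) \<le> fst F h + snd F k\<close> says precisely
  that \<open>fst F\<close> stays below the inf-convolution of \<open>snd F\<close> along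
  \<open>h\<close> at cost \<open>fst F h\<close>. A linear prevision between the two is squeezed to
  \<open>fst F h\<close> at \<open>h\<close>.\<close>

lemma fst_attained:
  assumes F: "F \<in> PADP b X" and h: "h \<in> LX X"
  shows "\<exists>G\<in>s_ADP b X F. G h = fst F h"
proof -
  let ?p = "inf_conv X (snd F) h (fst F h)"
  have p: "sublinear_on X ?p" using sublinear_on_snd[OF F] h by (rule sublinear_on_inf_conv)
  have "fst F x \<le> ?p x" if "x \<in> LX X" for x
    unfolding inf_conv_def
  proof (rule Inf_greatest, elim CollectE exE conjE)
    fix t z and l :: real
    assume zl: "t = snd F z + ennreal l * fst F h" "z \<in> LX X" "0 \<le> l" "x = addf z (smul l h)"
    have "fst F x \<le> fst F (smul l h) + snd F z"
      unfolding zl(4) addf_commute[of z] using zl h by (intro PADP_dest(5)[OF F] LX_closed)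
    also have "fst F (smul l h) = ennreal l * fst F h"
      using zl h by (intro prevision_smul[OF PADP_prevision(1)[OF F]])
    finally show "fst F x \<le> t" by (simp add: zl add.commute)
  qed
  then obtain G where G: "linear_prev X G" "fst F \<le> G" "\<And>x. x \<in> LX X \<Longrightarrow> G x \<le> ?p x"
    using sandwich[OF PADP_dest(1)[OF F] p] by blast
  have "G x \<le> snd F x" if "x \<in> LX X" for x
    using G(3)[OF that] inf_conv_le[OF that] by (rule order_trans)
  then have "G \<in> s_ADP b X F" by (rule s_ADP_I[OF F G(1,2)])
  moreover have "G h \<le> fst F h"
    using G(3)[OF h] inf_conv_self_le[OF sublinear_on_snd[OF F]] by (rule order_trans)
  then have "G h = fst F h" using G(2) by (auto simp: le_fun_def intro: antisym)
  ultimately show ?thesis by blast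
qed

lemma cone_convexD:
  "cone_convex V \<Longrightarrow> h \<in> V \<Longrightarrow> k \<in> V \<Longrightarrow> 0 \<le> a \<Longrightarrow> a \<le> 1 \<Longrightarrow> addf (smul a h) (smul (1 - a) k) \<in> V"
  by (simp add: cone_convex_def addf_def)

text \<open>Local convexity gives a convex open neighbourhood \<open>V\<close> of \<open>h\<close> on which \<open>snd F > r\<close>. The smallest
  superlinear map that is above \<open>fst F\<close> and at least \<open>r\<close> on \<open>V\<close> is then below \<open>snd F\<close>, and it is
  Scott-continuous because addition is almost open.\<close>
lemma snd_approximated:
  assumes X: "semitopological_cone_LX X" "locally_convex_LX X" "almost_open_addition_LX X"
    and F: "F \<in> PADP b X" and h: "h \<in> LX X" and r: "0 \<le> r" "ennreal r < snd F h"
  shows "\<exists>G\<in>s_ADP b X F. ennreal r \<le> G h"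
proof -
  note Fm = PADP_prevision(1)[OF F] and Fp = PADP_prevision(2)[OF F]
  have "openin (scottLX X) {k \<in> LX X. ennreal r < snd F k}"
    using prevision_mono[OF Fp] prevision_Sup[OF Fp] by (intro scott_open_superlevel) auto
  moreover have "h \<in> {k \<in> LX X. ennreal r < snd F k}" using h r(2) by simp
  ultimately obtain V where V: "openin (scottLX X) V" "cone_convex V" "h \<in> V"
    "V \<subseteq> {k \<in> LX X. ennreal r < snd F k}"
    using X(2) unfolding locally_convex_LX_def by blast
  have V_LX: "v \<in> LX X" and V_less: "ennreal r < snd F v" if "v \<in> V" for v
    using V(4) that by auto
  \<comment> \<open>Asking for \<open>z + l v \<le> x\<close> instead of equality makes
    \<open>T\<close> monotone and matches the upward closure in almost openness.\<close>
  define T where "T x = {fst F z + ennreal (r * l) | z v l.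
    z \<in> LX X \<and> v \<in> V \<and> 0 \<le> l \<and> addf z (smul l v) \<le> x}" for x
  define q where "q x = (if x \<in> LX X then Sup (T x) else 0)" for x
  have T_I: "fst F z + ennreal (r * l) \<in> T x"
    if "z \<in> LX X" "v \<in> V" "0 \<le> l" "addf z (smul l v) \<le> x" for z v l x
    using that unfolding T_def by blast
  have T_E: thesis if "t \<in> T x" "\<And>z v l. t = fst F z + ennreal (r * l) \<Longrightarrow> z \<in> LX X \<Longrightarrow> v \<in> V \<Longrightarrow>
      0 \<le> l \<Longrightarrow> addf z (smul l v) \<le> x \<Longrightarrow> thesis" for t x thesis
    using that unfolding T_def by blast
  have T_fst: "fst F x \<in> T x" if "x \<in> LX X" for x
    using T_I[of x h 0 x] that V(3) by simp
  \<comment> \<open>By homogeneity \<open>snd F (smul l v)\<close> is at least \<open>r * l\<close>,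
    and the fork inequality \<open>fst F h + snd F k \<le> snd F (h + k)\<close> absorbs the summand
    \<open>fst F z\<close>.\<close>
  have q_le: "q x \<le> snd F x" if x: "x \<in> LX X" for x
  proof -
    have "t \<le> snd F x" if "t \<in> T x" for t
      using that
    proof (rule T_E)
      fix z v and l :: real
      assume t: "t = fst F z + ennreal (r * l)" and z: "z \<in> LX X" "v \<in> V" "0 \<le> l" "addf z (smul l v) \<le> x"
      have "ennreal (r * l) = ennreal l * ennreal r" using r z by (simp add: ennreal_mult mult.commute)
      also have "\<dots> \<le> ennreal l * snd F v" using V_less[OF z(2)] by (intro mult_left_mono) auto
      also have "\<dots> = snd F (smul l v)"
        using V_LX z by (intro prevision_smul[OF Fp, symmetric])
      finally have "t \<le> fst F z + snd F (smul l v)" unfolding t by (rule add_left_mono)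
      also have "\<dots> \<le> snd F (addf z (smul l v))"
        using z V_LX by (intro PADP_dest(6)[OF F] LX_closed)
      also have "\<dots> \<le> snd F x" using z V_LX x by (intro prevision_mono[OF Fp] LX_closed)
      finally show "t \<le> snd F x" .
    qed
    then show ?thesis using x by (simp add: q_def Sup_least)
  qed
  have "prevision X q"
  proof (rule previsionI)
    fix x y assume xy: "x \<in> LX X" "y \<in> LX X" "x \<le> y"
    have "T x \<subseteq> T y" unfolding T_def using xy(3) by (blast intro: order_trans)
    then show "q x \<le> q y" using xy by (simp add: q_def Sup_subset_mono)
  next
    fix D t assume D: "D \<subseteq> LX X" "directed_set D" and "t < q (Sup D)"
    then obtain s where "s \<in> T (Sup D)" "t < s" by (auto simp: q_def Sup_in_LX less_Sup_iff)
    obtain z v l where z: "z \<in> LX X" "v \<in> V" "0 \<le> l" "addf z (smul l v) \<le> Sup D"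
      and s: "s = fst F z + ennreal (r * l)" using \<open>s \<in> T (Sup D)\<close> by (rule T_E)
    note t = \<open>t < s\<close>[unfolded s]
    have "\<exists>d\<in>D. \<exists>s\<in>T d. t \<le> s"
    \<comment> \<open>For \<open>l = 0\<close> only the Scott continuity of \<open>fst F\<close> is
      involved; the other case divides by \<open>l\<close>.\<close>
    proof (cases "l = 0")
      case True
      then have "t < fst F z" "z \<le> Sup D" using t z by auto
      then have "t < fst F (Sup D)"
        using prevision_mono[OF Fm z(1) Sup_in_LX[OF D(1)]] by auto
      then obtain d where "d \<in> D" "t < fst F d"
        unfolding prevision_Sup[OF Fm D] by (auto simp: less_SUP_iff)
      moreover from this have "fst F d \<in> T d" using D(1) by (intro T_fst) auto
      ultimately show ?thesis by (intro bexI[of _ d] bexI[of _ "fst F d"]) auto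
    next
      case False
      then have l: "0 < l" using z by simp
      \<comment> \<open>\<open>z\<close> lies in \<open>O1\<close> and \<open>smul l v\<close> in
        \<open>O2\<close>, the open set of the \<open>y\<close> with \<open>y / l\<close> in
        \<open>V\<close>. By almost openness the up-closed sum of the two is Scott-open; it contains
        \<open>Sup D\<close>, hence some \<open>d\<close> in \<open>D\<close>, and any decomposition
        below that \<open>d\<close> is good enough.\<close>
      define O1 where "O1 = {y \<in> LX X. t < fst F y + ennreal (r * l)}"
      define O2 where "O2 = {y \<in> LX X. smul (1 / l) y \<in> V}"
      have "openin (scottLX X) O1" unfolding O1_def
      proof (rule scott_open_superlevel)
        fix D' assume D': "D' \<subseteq> LX X" "directed_set D'"
        then have "D' \<noteq> {}" by (simp add: directed_set_def)
        then show "fst F (Sup D') + ennreal (r * l) \<le> (SUP d\<in>D'. fst F d + ennreal (r * l))"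
          by (simp add: prevision_Sup[OF Fm D'] ennreal_SUP_add_left)
      qed (intro add_right_mono prevision_mono[OF Fm])
      moreover have "openin (scottLX X) O2"
      proof -
        have "continuous_map (scottLX X) (scottLX X) (smul (1 / l))"
          using X(1) l by (simp add: semitopological_cone_LX_def)
        from openin_continuous_map_preimage[OF this V(1)] show ?thesis by (simp add: O2_def)
      qed
      ultimately have "openin (scottLX X) (upclosure (scottLX X) {addf u v | u v. u \<in> O1 \<and> v \<in> O2})"
        using X(3) by (simp add: almost_open_addition_LX_def)
      moreover have "Sup D \<in> upclosure (scottLX X) {addf u v | u v. u \<in> O1 \<and> v \<in> O2}"
      proof -
        have "z \<in> O1" using z t by (simp add: O1_def)
        moreover have "smul l v \<in> O2" using z l V_LX by (simp add: O2_def smul_smul smul_in_LX)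
        moreover have "spec_le (scottLX X) (addf z (smul l v)) (Sup D)"
          using z V_LX D(1) by (simp add: spec_le_scottLX addf_in_LX smul_in_LX Sup_in_LX)
        ultimately show ?thesis unfolding upclosure_def by blast
      qed
      ultimately obtain d where d: "d \<in> D"
        "d \<in> upclosure (scottLX X) {addf u v | u v. u \<in> O1 \<and> v \<in> O2}"
        using scott_open_LXD(3)[OF _ D] unfolding openin_scottLX by blast
      then obtain u w where uw: "u \<in> O1" "w \<in> O2" "addf u w \<le> d"
        by (auto simp: upclosure_def spec_le_scottLX)
      have "smul l (smul (1 / l) w) = w" using l by (simp add: smul_smul)
      then have "fst F u + ennreal (r * l) \<in> T d"
        using uw l by (intro T_I[of u "smul (1 / l) w" l d]) (auto simp: O1_def O2_def)
      moreover have "t \<le> fst F u + ennreal (r * l)" using uw(1) by (simp add: O1_def less_imp_le)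
      ultimately show ?thesis using d(1) by blast
    qed
    then obtain d s where d: "d \<in> D" "s \<in> T d" "t \<le> s" by blast
    then have "s \<le> q d" using D(1) by (auto simp: q_def intro: Sup_upper)
    then show "\<exists>d\<in>D. t \<le> q d" using d by (meson order_trans)
  next
    fix a :: real and x assume a: "0 < a" and x: "x \<in> LX X"
    have "ennreal a * t \<in> T (smul a x)" if "t \<in> T x" for t
      using that
    proof (rule T_E)
      fix z v and l :: real
      assume t: "t = fst F z + ennreal (r * l)" and z: "z \<in> LX X" "v \<in> V" "0 \<le> l" "addf z (smul l v) \<le> x"
      have "addf (smul a z) (smul (a * l) v) = smul a (addf z (smul l v))"
        using a z by (simp add: smul_addf smul_smul)
      also have "\<dots> \<le> smul a x" using z(4) by (rule smul_mono)
      finally have "fst F (smul a z) + ennreal (r * (a * l)) \<in> T (smul a x)"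
        using a z by (intro T_I[of _ v]) (auto intro: LX_closed)
      also have "fst F (smul a z) = ennreal a * fst F z"
        using a z by (intro prevision_smul[OF Fm]) auto
      also have "ennreal a * fst F z + ennreal (r * (a * l)) = ennreal a * t"
        using a r z by (simp add: t distrib_left ennreal_mult mult.left_commute)
      finally show ?thesis .
    qed
    moreover have "ennreal a * Sup (T x) = (SUP t\<in>T x. ennreal a * t)"
      using SUP_mult_left_ennreal[of "ennreal a" "\<lambda>t. t" "T x"] by simp
    ultimately show "ennreal a * q x \<le> q (smul a x)"
      using a x by (auto simp: q_def smul_in_LX intro!: Sup_subset_mono)
  next
    show "q (\<lambda>_. 0) = 0" using q_le[OF zero_in_LX] prevision_zero[OF Fp] by simp
  qed (simp add: q_def)
  moreover have "q x + q y \<le> q (addf x y)" if xy: "x \<in> LX X" "y \<in> LX X" for x y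
  proof -
    have "Sup (T x) + Sup (T y) \<le> Sup (T (addf x y))"
    proof (rule ennreal_Sup_add_le)
      fix s t assume "s \<in> T x" "t \<in> T y"
      obtain z v l where z: "z \<in> LX X" "v \<in> V" "0 \<le> l" "addf z (smul l v) \<le> x"
        and s: "s = fst F z + ennreal (r * l)" using \<open>s \<in> T x\<close> by (rule T_E)
      obtain z' v' l' where z': "z' \<in> LX X" "v' \<in> V" "0 \<le> l'" "addf z' (smul l' v') \<le> y"
        and t: "t = fst F z' + ennreal (r * l')" using \<open>t \<in> T y\<close> by (rule T_E)
      \<comment> \<open>Convexity of \<open>V\<close>: the normalized average of \<open>v\<close>
        and \<open>v'\<close> with weights \<open>l\<close> and \<open>l'\<close>. If both weights
        vanish, any element of \<open>V\<close> serves.\<close>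
      have "\<exists>w\<in>V. smul (l + l') w = addf (smul l v) (smul l' v')"
      proof (cases "l + l' = 0")
        case True
        then have "l = 0" "l' = 0" using z(3) z'(3) by auto
        then show ?thesis using V(3) by (intro bexI[of _ h]) auto
      next
        case False
        then have pos: "0 < l + l'" using z(3) z'(3) by simp
        define a where "a = l / (l + l')"
        have a: "0 \<le> a" "a \<le> 1" "(l + l') * a = l" "(l + l') * (1 - a) = l'"
          using pos z(3) z'(3) by (auto simp: a_def field_simps)
        have "smul (l + l') (addf (smul a v) (smul (1 - a) v')) = addf (smul l v) (smul l' v')"
          using pos a by (simp add: smul_addf smul_smul)
        then show ?thesis using cone_convexD[OF V(2) z(2) z'(2) a(1,2)] by blast
      qed
      then obtain w where w: "w \<in> V" "smul (l + l') w = addf (smul l v) (smul l' v')" by blast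
      have "addf (addf z z') (smul (l + l') w) = addf (addf z (smul l v)) (addf z' (smul l' v'))"
        unfolding w(2) by (simp add: addf_assoc addf_left_commute)
      also have "\<dots> \<le> addf x y" using z(4) z'(4) by (rule addf_mono)
      finally have "fst F (addf z z') + ennreal (r * (l + l')) \<in> T (addf x y)"
        using z z' w(1) by (intro T_I[of _ w]) (auto intro: LX_closed)
      then have le: "fst F (addf z z') + ennreal (r * (l + l')) \<le> Sup (T (addf x y))" by (rule Sup_upper)
      have "ennreal (r * (l + l')) = ennreal (r * l) + ennreal (r * l')"
        using r z z' by (simp add: distrib_left)
      then have "s + t = (fst F z + fst F z') + ennreal (r * (l + l'))"
        by (simp add: s t add_ac)
      also have "\<dots> \<le> fst F (addf z z') + ennreal (r * (l + l'))"
        using z z' by (intro add_right_mono smyth_prevD(2)[OF PADP_dest(1)[OF F]])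
      also note le
      finally show "s + t \<le> Sup (T (addf x y))" .
    qed (use T_fst xy in blast)+
    then show ?thesis using xy by (simp add: q_def addf_in_LX)
  qed
  ultimately have "smyth_prev X q" by (simp add: smyth_prev_def)
  then obtain G where G: "linear_prev X G" "q \<le> G" "\<And>x. x \<in> LX X \<Longrightarrow> G x \<le> snd F x"
    using sandwich[OF _ sublinear_on_snd[OF F] q_le] by blast
  have "fst F \<le> q"
    by (rule prevision_le[OF Fm]) (auto simp: q_def intro: Sup_upper T_fst)
  then have "G \<in> s_ADP b X F" using G by (intro s_ADP_I[OF F]) auto
  moreover have "ennreal r \<le> q h"
  proof -
    \<comment> \<open>The decomposition with \<open>z = 0\<close>, \<open>v = h\<close> and
      \<open>l = 1\<close>.\<close>
    have "ennreal r \<in> T h"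
      using T_I[of "\<lambda>_. 0" h 1 h] V(3) prevision_zero[OF Fm] by (simp add: zero_in_LX)
    then show ?thesis using h by (simp add: q_def Sup_upper)
  qed
  then have "ennreal r \<le> G h" by (rule order_trans[OF _ le_funD[OF G(2)]])
  ultimately show ?thesis by blast
qed

lemma s_ADP_ne: "F \<in> PADP b X \<Longrightarrow> s_ADP b X F \<noteq> {}"
  using fst_attained[OF _ zero_in_LX] by blast

lemma s_ADP_mem:
  assumes "G \<in> s_ADP b X F"
  shows "G \<in> PP b X" "fst F h \<le> G h" "G h \<le> snd F h"
  using assms by (auto simp: s_ADP_def le_fun_def)

lemma INF_s_ADP:
  assumes F: "F \<in> PADP b X"
  shows "(INF G\<in>s_ADP b X F. G h) = fst F h"
proof (cases "h \<in> LX X")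
  case True
  then obtain G where "G \<in> s_ADP b X F" "G h = fst F h" using fst_attained[OF F] by blast
  then have "(INF G\<in>s_ADP b X F. G h) \<le> fst F h" by (metis INF_lower)
  moreover have "fst F h \<le> (INF G\<in>s_ADP b X F. G h)" by (rule INF_greatest) (rule s_ADP_mem)
  ultimately show ?thesis by (rule antisym)
next
  case False
  then have "G h = 0" if "G \<in> s_ADP b X F" for G
    using prevision_outside[OF PP_prevision[OF s_ADP_mem(1)[OF that]]] by blast
  then have "(\<lambda>G. G h) ` s_ADP b X F = (\<lambda>_. 0) ` s_ADP b X F" by (rule image_cong[OF refl])
  then have "(\<lambda>G. G h) ` s_ADP b X F = {0}" using s_ADP_ne[OF F] by auto
  then have "(INF G\<in>s_ADP b X F. G h) = 0" by simp
  also have "\<dots> = fst F h" using prevision_outside[OF PADP_prevision(1)[OF F] False] by simp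
  finally show ?thesis .
qed

lemma SUP_s_ADP:
  assumes X: "semitopological_cone_LX X" "locally_convex_LX X" "almost_open_addition_LX X"
    and F: "F \<in> PADP b X"
  shows "(SUP G\<in>s_ADP b X F. G h) = snd F h"
proof (cases "h \<in> LX X")
  case True
  have "snd F h \<le> (SUP G\<in>s_ADP b X F. G h)"
  proof (rule ccontr)
    assume "\<not> ?thesis"
    then have "(SUP G\<in>s_ADP b X F. G h) < snd F h" by simp
    then obtain r where r: "0 \<le> r" "(SUP G\<in>s_ADP b X F. G h) < ennreal r" "ennreal r < snd F h"
      by (rule ennreal_dense_real)
    then obtain G where "G \<in> s_ADP b X F" "ennreal r \<le> G h"
      using snd_approximated[OF X F True] by blast
    from \<open>ennreal r \<le> G h\<close> have "ennreal r \<le> (SUP G\<in>s_ADP b X F. G h)"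
      by (rule order_trans) (rule SUP_upper[OF \<open>G \<in> s_ADP b X F\<close>])
    then show False using r(2) by simp
  qed
  moreover have "(SUP G\<in>s_ADP b X F. G h) \<le> snd F h" by (rule SUP_least) (rule s_ADP_mem)
  ultimately show ?thesis by simp
next
  case False
  then have "G h = 0" if "G \<in> s_ADP b X F" for G
    using prevision_outside[OF PP_prevision[OF s_ADP_mem(1)[OF that]]] by blast
  then have "(\<lambda>G. G h) ` s_ADP b X F = (\<lambda>_. 0) ` s_ADP b X F" by (rule image_cong[OF refl])
  then have "(\<lambda>G. G h) ` s_ADP b X F = {0}" using s_ADP_ne[OF F] by auto
  then have "(SUP G\<in>s_ADP b X F. G h) = 0" by simp
  also have "\<dots> = snd F h" using prevision_outside[OF PADP_prevision(2)[OF F] False] by simp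
  finally show ?thesis .
qed

lemma r_ADP_s_ADP:
  assumes "semitopological_cone_LX X" "locally_convex_LX X" "almost_open_addition_LX X"
    and "F \<in> PADP b X"
  shows "r_ADP (s_ADP b X F) = F"
  unfolding r_ADP_def INF_s_ADP[OF assms(4)] SUP_s_ADP[OF assms] by simp

section \<open>Convex lenses of linear previsions\<close>

lemma spec_le_PP_wk: "spec_le (PP_wk b X) G G' \<longleftrightarrow> G \<in> PP b X \<and> G' \<in> PP b X \<and> G \<le> G'"
proof
  assume le: "spec_le (PP_wk b X) G G'"
  then have PP: "G \<in> PP b X" "G' \<in> PP b X" by (auto simp: spec_le_def)
  have "G \<le> G'"
  proof (rule prevision_le[OF PP_prevision[OF PP(1)]], rule ccontr)
    fix h assume h: "h \<in> LX X" and "\<not> G h \<le> G' h"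
    then have "G' h < G h" by simp
    then obtain r where r: "0 \<le> r" "G' h < ennreal r" "ennreal r < G h" by (rule ennreal_dense_real)
    have "G \<in> {G \<in> PP b X. ennreal r < G h}" using PP r by simp
    then have "G' \<in> {G \<in> PP b X. ennreal r < G h}"
      using le openin_PP_wk[OF h r(1), of b] unfolding spec_le_def by meson
    then show False using r(2) by (auto dest: order.asym)
  qed
  with PP show "G \<in> PP b X \<and> G' \<in> PP b X \<and> G \<le> G'" by simp
next
  assume G: "G \<in> PP b X \<and> G' \<in> PP b X \<and> G \<le> G'"
  have "G' \<in> V" if V: "openin (PP_wk b X) V" "G \<in> V" for V
  proof -
    obtain I where I: "\<And>h r. (h, r) \<in> I \<Longrightarrow> ennreal r < G h"
      "\<And>G'. G' \<in> PP b X \<Longrightarrow> (\<And>h r. (h, r) \<in> I \<Longrightarrow> ennreal r < G' h) \<Longrightarrow> G' \<in> V"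
      using PP_wk_nhd[OF V] by metis
    show ?thesis
    proof (rule I(2))
      fix h r assume "(h, r) \<in> I"
      then have "ennreal r < G h" by (rule I(1))
      also have "\<dots> \<le> G' h" using G by (simp add: le_fun_def)
      finally show "ennreal r < G' h" .
    qed (use G in simp)
  qed
  with G show "spec_le (PP_wk b X) G G'" by (simp add: spec_le_def)
qed

lemma saturatedin_above: "saturatedin (PP_wk b X) {G \<in> PP b X. q \<le> G}"
  by (auto simp: saturatedin_def upclosure_def spec_le_PP_wk intro: order_trans)

text \<open>The complement is a union of sets \<open>[h > r]\<close> with \<open>p h < r\<close>,
  for an arbitrary functional \<open>p\<close>.\<close>

lemma closedin_below:
  "closedin (PP_wk b X) {G \<in> PP b X. \<forall>h\<in>LX X. G h \<le> p h}" (is "closedin _ ?C")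
proof -
  have "\<exists>T. openin (PP_wk b X) T \<and> G \<in> T \<and> T \<subseteq> PP b X - ?C" if "G \<in> PP b X - ?C" for G
  proof -
    from that obtain h where h: "h \<in> LX X" "p h < G h" by (auto simp: not_le)
    from h(2) obtain r where r: "0 \<le> r" "p h < ennreal r" "ennreal r < G h" by (rule ennreal_dense_real)
    have "{G \<in> PP b X. ennreal r < G h} \<subseteq> PP b X - ?C"
      using h(1) r(2) by (auto simp: not_le intro!: bexI[of _ h])
    moreover have "G \<in> {G \<in> PP b X. ennreal r < G h}" using that r by simp
    ultimately show ?thesis using openin_PP_wk[OF h(1) r(1), of b] by meson
  qed
  then have "openin (PP_wk b X) (PP b X - ?C)" by (subst openin_subopen) simp
  then show ?thesis by (simp add: closedin_def)
qed

text \<open>The last conclusion tests the two parts of a lens separately: being above an element of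
  \<open>L\<close> gives membership in the saturated part, being in the closure gives membership in
  the closed part.\<close>

lemma cvx_lensD:
  assumes "L \<in> cvx_lenses b X"
  shows "prev_convex L" "L \<noteq> {}" "L \<subseteq> PP b X" "compactin (PP_wk b X) L"
    "\<And>G. G \<in> PP b X \<Longrightarrow> \<exists>G'\<in>L. G' \<le> G \<Longrightarrow> G \<in> PP_wk b X closure_of L \<Longrightarrow> G \<in> L"
proof -
  obtain Q C where Q: "compactin (PP_wk b X) Q" "saturatedin (PP_wk b X) Q"
    and C: "closedin (PP_wk b X) C" and L: "L = Q \<inter> C" "L \<noteq> {}" "prev_convex L"
    using assms by (auto simp: cvx_lenses_def lenses_def)
  show "prev_convex L" "L \<noteq> {}" by (fact L)+
  show cpt: "compactin (PP_wk b X) L" unfolding L(1) using Q(1) C by (simp add: closed_Int_compactin Int_commute)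
  then show LPP: "L \<subseteq> PP b X" using compactin_subset_topspace by fastforce
  fix G assume G: "G \<in> PP b X" "\<exists>G'\<in>L. G' \<le> G" "G \<in> PP_wk b X closure_of L"
  then obtain G' where "G' \<in> Q" "G' \<in> PP b X" "G' \<le> G" using L(1) LPP by blast
  then have "G \<in> upclosure (PP_wk b X) Q" using G(1) by (auto simp: upclosure_def spec_le_PP_wk)
  then have "G \<in> Q" using Q(2) by (auto simp: saturatedin_def)
  moreover have "G \<in> C" using G(3) closure_of_minimal[of L C] C L(1) by blast
  ultimately show "G \<in> L" using L(1) by simp
qed

lemma PP_convex:
  assumes G: "G \<in> PP b X" and G': "G' \<in> PP b X" and a: "0 \<le> a" "a \<le> (1::real)"
  shows "(\<lambda>h. ennreal a * G h + ennreal (1 - a) * G' h) \<in> PP b X" (is "?H \<in> _")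
proof -
  note P = PP_prevision[OF G] and P' = PP_prevision[OF G']
  have mono: "?H h \<le> ?H k" if "h \<in> LX X" "k \<in> LX X" "h \<le> k" for h k
    using prevision_mono[OF P that] prevision_mono[OF P' that] by (intro add_mono mult_left_mono) auto
  have "prevision X ?H"
    unfolding prevision_def
  proof (intro conjI allI ballI impI)
    fix D assume D: "D \<subseteq> LX X" "directed_set D"
    have "?H (Sup D) = (SUP d\<in>D. ennreal a * G d) + (SUP d\<in>D. ennreal (1 - a) * G' d)"
      by (simp add: prevision_Sup[OF P D] prevision_Sup[OF P' D] SUP_mult_left_ennreal)
    also have "\<dots> = (SUP d\<in>D. ?H d)"
    proof (rule SUP_add_directed_ennreal[symmetric])
      fix d e assume de: "d \<in> D" "e \<in> D"
      then obtain k where k: "k \<in> D" "d \<le> k" "e \<le> k" using D(2) unfolding directed_set_def by blast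
      have "G d \<le> G k" "G' e \<le> G' k"
        using prevision_mono[OF P] prevision_mono[OF P'] k de D(1) by (simp_all add: subset_iff)
      then show "\<exists>k\<in>D. ennreal a * G d + ennreal (1 - a) * G' e \<le> ennreal a * G k + ennreal (1 - a) * G' k"
        using k(1) by (intro bexI[of _ k] add_mono mult_left_mono) auto
    qed
    finally show "?H (Sup D) = (SUP d\<in>D. ?H d)" .
  next
    fix c :: real and h assume "0 \<le> c" "h \<in> LX X"
    then show "?H (smul c h) = ennreal c * ?H h"
      by (simp add: prevision_smul[OF P] prevision_smul[OF P'] distrib_left mult.left_commute)
  next
    fix h assume "h \<notin> LX X"
    then show "?H h = 0" by (simp add: prevision_outside[OF P] prevision_outside[OF P'])
  qed (rule mono)
  moreover have "?H (addf h k) = ?H h + ?H k" if "h \<in> LX X" "k \<in> LX X" for h k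
    using that by (simp add: linear_prevD(2)[OF PP_linear[OF G]] linear_prevD(2)[OF PP_linear[OF G']]
        distrib_left add_ac)
  ultimately have lin: "linear_prev X ?H" by (simp add: linear_prev_def)
  have ca: "ennreal a + ennreal (1 - a) = 1" using a by (simp flip: ennreal_plus)
  have le: "?H (one_L X) \<le> 1"
  proof -
    have "?H (one_L X) \<le> ennreal a * 1 + ennreal (1 - a) * 1"
      using PP_one_le[OF G] PP_one_le[OF G'] by (intro add_mono mult_left_mono) auto
    then show ?thesis using ca by simp
  qed
  have eq: "?H (one_L X) = 1" if "b = Norm"
  proof -
    have "G (one_L X) = 1" "G' (one_L X) = 1"
      using normcond_one(2)[OF P _ that] normcond_one(2)[OF P' _ that] G G' by (auto simp: PP_def)
    then show ?thesis using ca by simp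
  qed
  have "?H (addf (one_L X) h) = ?H (one_L X) + ?H h" if "h \<in> LX X" for h
    using lin one_in_LX that by (rule linear_prevD(2))
  then have "normcond b X ?H"
    using le eq by (cases b) (simp_all add: normcond_def add_right_mono)
  with lin show ?thesis by (simp add: PP_def)
qed

lemma s_ADP_cvx_lens:
  assumes F: "F \<in> PADP b X"
  shows "s_ADP b X F \<in> cvx_lenses b X"
proof -
  let ?Q = "{G \<in> PP b X. fst F \<le> G}" and ?C = "{G \<in> PP b X. \<forall>h\<in>LX X. G h \<le> snd F h}"
  have "s_ADP b X F = ?Q \<inter> ?C"
    using prevision_le[OF PP_prevision, of _ b X "snd F"] by (auto simp: s_ADP_def le_fun_def)
  then have "s_ADP b X F \<in> lenses (PP_wk b X)"
    unfolding lenses_def using s_ADP_ne[OF F]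
    by (intro CollectI conjI exI[of _ ?Q] exI[of _ ?C] compactin_above[OF PADP_dest(1,3)[OF F]]
        saturatedin_above closedin_below)
  moreover have "prev_convex (s_ADP b X F)"
    unfolding prev_convex_def
  proof (intro ballI)
    fix G G' and a :: real
    assume G: "G \<in> s_ADP b X F" "G' \<in> s_ADP b X F" and a: "a \<in> {0..1}"
    have ca: "ennreal a + ennreal (1 - a) = 1" using a by (simp flip: ennreal_plus)
    have eq: "t = ennreal a * t + ennreal (1 - a) * t" for t
      using ca by (metis distrib_right mult_1)
    have "fst F h \<le> ennreal a * G h + ennreal (1 - a) * G' h" for h
      by (subst eq) (intro add_mono mult_left_mono s_ADP_mem(2)[OF G(1)] s_ADP_mem(2)[OF G(2)] zero_le)
    moreover have "ennreal a * G h + ennreal (1 - a) * G' h \<le> snd F h" for h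
      by (subst (3) eq) (intro add_mono mult_left_mono s_ADP_mem(3)[OF G(1)] s_ADP_mem(3)[OF G(2)] zero_le)
    ultimately show "(\<lambda>h. ennreal a * G h + ennreal (1 - a) * G' h) \<in> s_ADP b X F"
      using PP_convex[OF s_ADP_mem(1)[OF G(1)] s_ADP_mem(1)[OF G(2)], of a] a
      by (simp add: s_ADP_def le_fun_def)
  qed
  ultimately show ?thesis by (simp add: cvx_lenses_def)
qed

section \<open>From convex lenses to forks and back\<close>

lemma directed_finite_bound:
  assumes "directed_set D" "finite A" "A \<subseteq> D"
  shows "\<exists>d\<in>D. \<forall>e\<in>A. e \<le> d"
  using assms(2,3)
proof (induction A rule: finite_induct)
  case empty
  then show ?case using assms(1) by (auto simp: directed_set_def)
next
  case (insert e A)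
  then obtain d where d: "d \<in> D" "\<forall>e\<in>A. e \<le> d" by auto
  moreover have "e \<in> D" using insert by simp
  ultimately obtain c where "c \<in> D" "e \<le> c" "d \<le> c"
    using assms(1) unfolding directed_set_def by blast
  then show ?case using d(2) by (intro bexI[of _ c]) (auto intro: order_trans)
qed

text \<open>Compactness exchanges the infimum with directed suprema: the sets \<open>[d > r]\<close>
  for \<open>d\<close> in \<open>D\<close> cover \<open>L\<close>, finitely many suffice, and one
  element of \<open>D\<close> dominates all of these.\<close>

lemma prevision_INF_compact:
  assumes L: "compactin (PP_wk b X) L" "L \<noteq> {}"
  shows "prevision X (\<lambda>h. INF G\<in>L. G h)"
proof -
  have LPP: "L \<subseteq> PP b X" using compactin_subset_topspace[OF L(1)] by simp
  have P: "prevision X G" if "G \<in> L" for G using that LPP PP_prevision by blast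
  show ?thesis
  proof (rule previsionI)
    fix h k assume "h \<in> LX X" "k \<in> LX X" "h \<le> k"
    then show "(INF G\<in>L. G h) \<le> (INF G\<in>L. G k)"
      by (intro INF_mono) (use P prevision_mono in blast)
  next
    fix D t assume D: "D \<subseteq> LX X" "directed_set D" and t: "t < (INF G\<in>L. G (Sup D))"
    then have "t < top" by (metis top.not_eq_extremum order.strict_trans2 top_greatest)
    then obtain r where r: "0 \<le> r" "t = ennreal r" by (cases t) auto
    define N where "N d = {G \<in> PP b X. ennreal r < G d}" for d
    have "L \<subseteq> \<Union>(N ` D)"
    proof
      fix G assume G: "G \<in> L"
      then have "t < G (Sup D)" using t by (meson INF_lower order.strict_trans2)
      then obtain d where "d \<in> D" "t < G d" 
        unfolding prevision_Sup[OF P[OF G] D] by (auto simp: less_SUP_iff)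
      then show "G \<in> \<Union>(N ` D)" using G LPP r by (auto simp: N_def)
    qed
    moreover have "openin (PP_wk b X) (N d)" if "d \<in> D" for d
      unfolding N_def using that D(1) by (intro openin_PP_wk r(1)) auto
    ultimately obtain A where A: "finite A" "A \<subseteq> D" "L \<subseteq> \<Union>(N ` A)"
      using compactin_finite_subcover[OF L(1)] by metis
    obtain d where d: "d \<in> D" "\<forall>e\<in>A. e \<le> d" using directed_finite_bound[OF D(2) A(1,2)] by blast
    have "t \<le> G d" if G: "G \<in> L" for G
    proof -
      obtain e where e: "e \<in> A" "ennreal r < G e" using A(3) G by (auto simp: N_def)
      have "G e \<le> G d" using e d A(2) D(1) by (intro prevision_mono[OF P[OF G]]) auto
      then show ?thesis using e r by simp
    qed
    then show "\<exists>d\<in>D. t \<le> (INF G\<in>L. G d)" using d(1) by (intro bexI[of _ d] INF_greatest)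
  next
    fix a :: real and h assume a: "0 < a" and h: "h \<in> LX X"
    show "ennreal a * (INF G\<in>L. G h) \<le> (INF G\<in>L. G (smul a h))"
    proof (rule INF_greatest)
      fix G assume G: "G \<in> L"
      have "ennreal a * (INF G\<in>L. G h) \<le> ennreal a * G h"
        using G by (intro mult_left_mono INF_lower) auto
      also have "\<dots> = G (smul a h)" using a h by (intro prevision_smul[OF P[OF G], symmetric]) auto
      finally show "ennreal a * (INF G\<in>L. G h) \<le> G (smul a h)" .
    qed
  next
    obtain G where G: "G \<in> L" using L(2) by blast
    then have "(INF G\<in>L. G (\<lambda>_. 0)) \<le> G (\<lambda>_. 0)" by (rule INF_lower)
    then show "(INF G\<in>L. G (\<lambda>_. 0)) = 0" using prevision_zero[OF P[OF G]] by simp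
  next
    fix h assume h: "h \<notin> LX X"
    obtain G where G: "G \<in> L" using L(2) by blast
    then have "(INF G\<in>L. G h) \<le> G h" by (rule INF_lower)
    then show "(INF G\<in>L. G h) = 0" using prevision_outside[OF P[OF G] h] by simp
  qed
qed

text \<open>For the mixed inequalities, expand \<open>G (addf h k)\<close> by linearity, bound one
  of the two summands by its extremum over \<open>L\<close>, and then vary \<open>G\<close> in the
  other.\<close>

lemma r_ADP_PADP:
  assumes L: "L \<in> cvx_lenses b X"
  shows "r_ADP L \<in> PADP b X"
proof -
  note ne = cvx_lensD(2)[OF L] and LPP = cvx_lensD(3)[OF L] and cpt = cvx_lensD(4)[OF L]
  define I where "I h = (INF G\<in>L. G h)" for h
  define S where "S h = (SUP G\<in>L. G h)" for h
  have I_le: "I h \<le> G h" and le_S: "G h \<le> S h" if "G \<in> L" for G h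
    using that by (auto simp: I_def S_def intro: INF_lower SUP_upper)
  have I_ge: "c \<le> I h" if "\<And>G. G \<in> L \<Longrightarrow> c \<le> G h" for c h
    unfolding I_def using that by (rule INF_greatest)
  have S_le: "S h \<le> c" if "\<And>G. G \<in> L \<Longrightarrow> G h \<le> c" for c h
    unfolding S_def using that by (rule SUP_least)
  have I_add: "c \<le> I h + d" if "\<And>G. G \<in> L \<Longrightarrow> c \<le> G h + d" for c d h
    using ennreal_le_Inf_add[of "(\<lambda>G. G h) ` L" "{d}" c] that unfolding I_def by auto
  have S_add: "d + S h \<le> c" if "\<And>G. G \<in> L \<Longrightarrow> d + G h \<le> c" for c d h
    using ennreal_Sup_add_le[of "{d}" "(\<lambda>G. G h) ` L" c] that ne unfolding S_def by auto
  have P: "prevision X I" "prevision X S"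
    unfolding I_def[abs_def] S_def[abs_def] using LPP PP_prevision
    by (blast intro: prevision_INF_compact[OF cpt ne] prevision_SUP)+
  have add: "G (addf h k) = G h + G k" if "G \<in> L" "h \<in> LX X" "k \<in> LX X" for G h k
  proof -
    have "linear_prev X G" using that(1) LPP PP_linear by blast
    then show ?thesis using that(2,3) by (rule linear_prevD(2))
  qed
  have "smyth_prev X I"
    unfolding smyth_prev_def
  proof (intro conjI ballI P)
    fix h k assume hk: "h \<in> LX X" "k \<in> LX X"
    show "I h + I k \<le> I (addf h k)"
      by (rule I_ge) (simp add: add[OF _ hk] add_mono I_le)
  qed
  moreover have "hoare_prev X S"
    unfolding hoare_prev_def
  proof (intro conjI ballI P)
    fix h k assume hk: "h \<in> LX X" "k \<in> LX X"
    show "S (addf h k) \<le> S h + S k"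
      by (rule S_le) (simp add: add[OF _ hk] add_mono le_S)
  qed
  moreover have "I (addf h k) \<le> I h + S k" if hk: "h \<in> LX X" "k \<in> LX X" for h k
  proof (rule I_add)
    fix G assume G: "G \<in> L"
    have "I (addf h k) \<le> G (addf h k)" using G by (rule I_le)
    also have "\<dots> = G h + G k" by (rule add[OF G hk])
    also have "\<dots> \<le> G h + S k" using le_S[OF G] by (rule add_left_mono)
    finally show "I (addf h k) \<le> G h + S k" .
  qed
  moreover have "I h + S k \<le> S (addf h k)" if hk: "h \<in> LX X" "k \<in> LX X" for h k
  proof (rule S_add)
    fix G assume G: "G \<in> L"
    have "I h + G k \<le> G h + G k" using I_le[OF G] by (rule add_right_mono)
    also have "\<dots> = G (addf h k)" by (rule add[OF G hk, symmetric])
    also have "\<dots> \<le> S (addf h k)" using G by (rule le_S)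
    finally show "I h + G k \<le> S (addf h k)" .
  qed
  ultimately have fork: "is_fork X (I, S)" by (simp add: is_fork_def)
  have one: "G (one_L X) \<le> 1" if "G \<in> L" for G using PP_one_le LPP that by blast
  have one_eq: "G (one_L X) = 1" if "b = Norm" "G \<in> L" for G
    using normcond_one(2)[of X G b] that LPP by (auto simp: PP_def linear_prev_def)
  have I_upper: "I (addf (one_L X) h) \<le> 1 + I h" if h: "h \<in> LX X" for h
    unfolding add.commute[of 1]
  proof (rule I_add)
    fix G assume G: "G \<in> L"
    have "I (addf (one_L X) h) \<le> G (addf (one_L X) h)" using G by (rule I_le)
    also have "\<dots> = G (one_L X) + G h" by (rule add[OF G one_in_LX h])
    also have "\<dots> \<le> 1 + G h" using one[OF G] by (rule add_right_mono)
    finally show "I (addf (one_L X) h) \<le> G h + 1" by (simp add: add.commute)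
  qed
  have S_upper: "S (addf (one_L X) h) \<le> 1 + S h" if h: "h \<in> LX X" for h
    by (rule S_le) (simp add: add[OF _ one_in_LX h] add_mono one le_S)
  have I_lower: "1 + I h \<le> I (addf (one_L X) h)" if "b = Norm" and h: "h \<in> LX X" for h
    by (rule I_ge) (simp add: add[OF _ one_in_LX h] one_eq[OF \<open>b = Norm\<close>] add_left_mono I_le)
  have S_lower: "1 + S h \<le> S (addf (one_L X) h)" if "b = Norm" and h: "h \<in> LX X" for h
  proof (rule S_add)
    fix G assume G: "G \<in> L"
    have "1 + G h = G (addf (one_L X) h)"
      using add[OF G one_in_LX h] one_eq[OF \<open>b = Norm\<close> G] by simp
    also have "\<dots> \<le> S (addf (one_L X) h)" using G by (rule le_S)
    finally show "1 + G h \<le> S (addf (one_L X) h)" .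
  qed
  have "normcond b X I" "normcond b X S"
    using I_upper S_upper I_lower S_lower by (cases b; simp add: normcond_def antisym)+
  with fork have "(I, S) \<in> PADP b X" by (simp add: PADP_def)
  then show ?thesis by (simp add: r_ADP_def I_def[abs_def] S_def[abs_def])
qed

lemma s_ADP_r_ADP:
  assumes L: "L \<in> cvx_lenses b X"
  shows "s_ADP b X (r_ADP L) = L"
proof
  show "L \<subseteq> s_ADP b X (r_ADP L)"
    using cvx_lensD(3)[OF L] by (auto simp: s_ADP_def r_ADP_def le_fun_def intro: INF_lower SUP_upper)
  show "s_ADP b X (r_ADP L) \<subseteq> L"
  proof
    fix G assume G: "G \<in> s_ADP b X (r_ADP L)"
    have PP: "G \<in> PP b X" using G by (rule s_ADP_mem)
    have le: "(INF G'\<in>L. G' h) \<le> G h" "G h \<le> (SUP G'\<in>L. G' h)" for h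
      using s_ADP_mem(2,3)[OF G, of h] by (simp_all add: r_ADP_def)
    show "G \<in> L"
      using PP convex_set_below[OF cvx_lensD(1,4)[OF L] PP_linear[OF PP] le(1)]
        convex_set_closure[OF cvx_lensD(1-3)[OF L] PP le(2)]
      by (rule cvx_lensD(5)[OF L])
  qed
qed

text \<open>The two halves of the order match the two components. Up-closures correspond to infima
  by \<open>convex_set_below\<close>, closures to suprema by \<open>convex_set_closure\<close> and
  by closedness of the set of previsions below the supremum.\<close>

lemma lens_le_iff_fork_le:
  assumes L: "L \<in> cvx_lenses b X" and L': "L' \<in> cvx_lenses b X"
  shows "lens_le (PP_wk b X) L L' \<longleftrightarrow> fork_le (r_ADP L) (r_ADP L')"
proof -
  note LPP = cvx_lensD(3)[OF L] and L'PP = cvx_lensD(3)[OF L']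
  have "upclosure (PP_wk b X) L' \<subseteq> upclosure (PP_wk b X) L \<longleftrightarrow> (\<forall>G'\<in>L'. \<exists>G\<in>L. G \<le> G')"
  proof
    assume sub: "upclosure (PP_wk b X) L' \<subseteq> upclosure (PP_wk b X) L"
    show "\<forall>G'\<in>L'. \<exists>G\<in>L. G \<le> G'"
    proof
      fix G' assume "G' \<in> L'"
      then have "G' \<in> upclosure (PP_wk b X) L'" using L'PP by (auto simp: upclosure_def spec_le_PP_wk)
      with sub have "G' \<in> upclosure (PP_wk b X) L" by blast
      then show "\<exists>G\<in>L. G \<le> G'" by (auto simp: upclosure_def spec_le_PP_wk)
    qed
  next
    assume ex: "\<forall>G'\<in>L'. \<exists>G\<in>L. G \<le> G'"
    show "upclosure (PP_wk b X) L' \<subseteq> upclosure (PP_wk b X) L"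
    proof
      fix H assume "H \<in> upclosure (PP_wk b X) L'"
      then obtain G' where G': "G' \<in> L'" "G' \<le> H" "H \<in> PP b X" by (auto simp: upclosure_def spec_le_PP_wk)
      then obtain G where "G \<in> L" "G \<le> G'" using ex by blast
      then show "H \<in> upclosure (PP_wk b X) L"
        using G' LPP unfolding upclosure_def spec_le_PP_wk by (blast intro: order_trans)
    qed
  qed
  also have "\<dots> \<longleftrightarrow> (\<forall>h. (INF G\<in>L. G h) \<le> (INF G\<in>L'. G h))"
  proof
    assume ex: "\<forall>G'\<in>L'. \<exists>G\<in>L. G \<le> G'"
    show "\<forall>h. (INF G\<in>L. G h) \<le> (INF G\<in>L'. G h)"
      using ex by (intro allI INF_mono) (auto simp: le_fun_def)
  next
    assume le: "\<forall>h. (INF G\<in>L. G h) \<le> (INF G\<in>L'. G h)"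
    show "\<forall>G'\<in>L'. \<exists>G\<in>L. G \<le> G'"
    proof
      fix G' assume G': "G' \<in> L'"
      then have "linear_prev X G'" using L'PP PP_linear by blast
      moreover have "(INF G\<in>L. G h) \<le> G' h" for h
        using le[rule_format, of h] INF_lower[OF G', of "\<lambda>G. G h"] by (rule order_trans)
      ultimately show "\<exists>G\<in>L. G \<le> G'" by (intro convex_set_below[OF cvx_lensD(1,4)[OF L]])
    qed
  qed
  finally have 1: "upclosure (PP_wk b X) L' \<subseteq> upclosure (PP_wk b X) L \<longleftrightarrow>
    (\<forall>h. (INF G\<in>L. G h) \<le> (INF G\<in>L'. G h))" .
  have 2: "PP_wk b X closure_of L \<subseteq> PP_wk b X closure_of L' \<longleftrightarrow>
    (\<forall>h. (SUP G\<in>L. G h) \<le> (SUP G\<in>L'. G h))"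
  proof
    let ?C = "{G \<in> PP b X. \<forall>h\<in>LX X. G h \<le> (SUP G\<in>L'. G h)}"
    assume sub: "PP_wk b X closure_of L \<subseteq> PP_wk b X closure_of L'"
    have "L' \<subseteq> ?C" using L'PP by (auto intro: SUP_upper)
    then have "PP_wk b X closure_of L' \<subseteq> ?C" by (rule closure_of_minimal[OF _ closedin_below])
    moreover have "L \<subseteq> PP_wk b X closure_of L" using LPP by (simp add: closure_of_subset)
    ultimately have "L \<subseteq> ?C" using sub by blast
    show "\<forall>h. (SUP G\<in>L. G h) \<le> (SUP G\<in>L'. G h)"
    proof (intro allI SUP_least)
      fix h G assume G: "G \<in> L"
      show "G h \<le> (SUP G\<in>L'. G h)"
      proof (cases "h \<in> LX X")
        case True then show ?thesis using \<open>L \<subseteq> ?C\<close> G by blast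
      next
        case False
        moreover have "prevision X G" using G LPP PP_prevision by blast
        ultimately have "G h = 0" by (simp add: prevision_outside)
        then show ?thesis by simp
      qed
    qed
  next
    assume le: "\<forall>h. (SUP G\<in>L. G h) \<le> (SUP G\<in>L'. G h)"
    have "L \<subseteq> PP_wk b X closure_of L'"
    proof
      fix G assume G: "G \<in> L"
      have "G h \<le> (SUP G\<in>L'. G h)" for h
        using SUP_upper[OF G, of "\<lambda>G. G h"] le[rule_format, of h] by (rule order_trans)
      then show "G \<in> PP_wk b X closure_of L'"
        using G LPP by (intro convex_set_closure[OF cvx_lensD(1-3)[OF L']]) auto
    qed
    then show "PP_wk b X closure_of L \<subseteq> PP_wk b X closure_of L'"
      by (rule closure_of_minimal) simp
  qed
  show ?thesis unfolding lens_le_def fork_le_def 1 2 by (simp add: r_ADP_def le_fun_def)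
qed

section \<open>Continuity\<close>

lemma topspace_vietoris [simp]: "topspace (vietoris T P) = P"
  by (simp add: vietoris_def)

lemma openin_vietoris:
  assumes "openin T V"
  shows "openin (vietoris T P) {L \<in> P. L \<subseteq> V}" "openin (vietoris T P) {L \<in> P. L \<inter> V \<noteq> {}}"
proof -
  have "openin (vietoris T P) ({L. L \<subseteq> V} \<inter> P)"
    unfolding vietoris_def
    by (rule openin_gen_top_on, rule UnI1, rule CollectI, rule exI[of _ V], simp add: assms)
  moreover have "openin (vietoris T P) ({L. L \<inter> V \<noteq> {}} \<inter> P)"
    unfolding vietoris_def
    by (rule openin_gen_top_on, rule UnI2, rule CollectI, rule exI[of _ V], simp add: assms)
  moreover have "{L \<in> P. L \<subseteq> V} = {L. L \<subseteq> V} \<inter> P" "{L \<in> P. L \<inter> V \<noteq> {}} = {L. L \<inter> V \<noteq> {}} \<inter> P"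
    by auto
  ultimately show "openin (vietoris T P) {L \<in> P. L \<subseteq> V}" "openin (vietoris T P) {L \<in> P. L \<inter> V \<noteq> {}}"
    by simp_all
qed

lemma openin_finite_ball:
  assumes "finite M" "\<And>m. m \<in> M \<Longrightarrow> openin T {x \<in> topspace T. Q m x}"
  shows "openin T {x \<in> topspace T. \<forall>m\<in>M. Q m x}"
  using assms
proof (induction M rule: finite_induct)
  case empty
  then show ?case by simp
next
  case (insert m M)
  have "openin T ({x \<in> topspace T. Q m x} \<inter> {x \<in> topspace T. \<forall>m\<in>M. Q m x})"
    using insert by (intro openin_Int) simp_all
  also have "{x \<in> topspace T. Q m x} \<inter> {x \<in> topspace T. \<forall>m\<in>M. Q m x}
      = {x \<in> topspace T. \<forall>m\<in>insert m M. Q m x}" by auto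
  finally show ?case .
qed

text \<open>An infimum over \<open>L\<close> exceeds \<open>r\<close> iff \<open>L\<close> lies in
  \<open>[h > s]\<close> for some \<open>s > r\<close>, a union of box sets; a supremum exceeds
  \<open>r\<close> iff \<open>L\<close> meets \<open>[h > r]\<close>, a diamond set.\<close>

lemma continuous_map_r_ADP:
  "continuous_map (vietoris (PP_wk b X) (cvx_lenses b X)) (PADP_wk b X) r_ADP"
  unfolding PADP_wk_def
proof (rule continuous_map_gen_top_on)
  let ?T = "vietoris (PP_wk b X) (cvx_lenses b X)"
  show "r_ADP L \<in> PADP b X" if "L \<in> topspace ?T" for L
    using that by (simp add: r_ADP_PADP)
  fix U assume "U \<in> {{F. ennreal r < fst F h} | h r. h \<in> LX X \<and> 0 \<le> r} \<union>
    {{F. ennreal r < snd F h} | h r. h \<in> LX X \<and> 0 \<le> r}"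
  then consider h r where "h \<in> LX X" "0 \<le> r" "U = {F. ennreal r < fst F h}"
    | h r where "h \<in> LX X" "0 \<le> r" "U = {F. ennreal r < snd F h}" by blast
  then show "openin ?T {L \<in> topspace ?T. r_ADP L \<in> U}"
  proof cases
    case 1
    let ?N = "\<lambda>s. {L \<in> cvx_lenses b X. L \<subseteq> {G \<in> PP b X. ennreal s < G h}}"
    have "{L \<in> topspace ?T. r_ADP L \<in> U} = \<Union>(?N ` {r<..})"
    proof (intro set_eqI iffI)
      fix L assume "L \<in> {L \<in> topspace ?T. r_ADP L \<in> U}"
      then have L: "L \<in> cvx_lenses b X" "ennreal r < (INF G\<in>L. G h)" by (auto simp: 1 r_ADP_def)
      obtain s where s: "0 \<le> s" "ennreal r < ennreal s" "ennreal s < (INF G\<in>L. G h)"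
        using L(2) by (rule ennreal_dense_real)
      have "ennreal s < G h" if "G \<in> L" for G
        using s(3) INF_lower[OF that, of "\<lambda>G. G h"] by (rule order.strict_trans2)
      then have "L \<in> ?N s" using L(1) cvx_lensD(3)[OF L(1)] by auto
      moreover have "r < s" using s(2) 1 by (simp add: ennreal_less_iff)
      ultimately show "L \<in> \<Union>(?N ` {r<..})" by blast
    next
      fix L assume "L \<in> \<Union>(?N ` {r<..})"
      then obtain s where s: "r < s" "L \<in> cvx_lenses b X" "\<And>G. G \<in> L \<Longrightarrow> ennreal s < G h" by blast
      have "ennreal r < ennreal s" using s(1) 1 by (simp add: ennreal_less_iff)
      also have "\<dots> \<le> (INF G\<in>L. G h)" using s(3) by (intro INF_greatest less_imp_le)
      finally show "L \<in> {L \<in> topspace ?T. r_ADP L \<in> U}" using s(2) by (simp add: 1 r_ADP_def)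
    qed
    moreover have "openin ?T (?N s)" if "r < s" for s
      using that 1 by (intro openin_vietoris(1) openin_PP_wk) auto
    then have "openin ?T (\<Union>(?N ` {r<..}))" by (intro openin_Union) auto
    ultimately show ?thesis by simp
  next
    case 2
    have "{L \<in> topspace ?T. r_ADP L \<in> U} =
        {L \<in> cvx_lenses b X. L \<inter> {G \<in> PP b X. ennreal r < G h} \<noteq> {}}"
      using cvx_lensD(3) by (fastforce simp: 2 r_ADP_def less_SUP_iff)
    then show ?thesis using openin_vietoris(2)[OF openin_PP_wk] 2 by simp
  qed
qed

text \<open>If every neighbourhood \<open>N\<close> of \<open>F\<close> contains a fork with a bad
  linear prevision, the sets \<open>B N\<close> of bad previsions form a filter base.
  \<open>filtered_sandwich\<close> yields a limit \<open>G\<close> above \<open>fst F\<close> that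
  is still bad, which has to be compared with \<open>s_ADP b X F\<close>.\<close>

lemma s_ADP_subset_nhd:
  assumes F: "F \<in> PADP b X" and J: "J \<subseteq> LX X \<times> {0..}"
    and sub: "\<And>G. G \<in> s_ADP b X F \<Longrightarrow> \<exists>i\<in>J. ennreal (snd i) < G (fst i)"
  shows "\<exists>N. openin (PADP_wk b X) N \<and> F \<in> N \<and>
    (\<forall>F'\<in>N. \<forall>G\<in>s_ADP b X F'. \<exists>i\<in>J. ennreal (snd i) < G (fst i))"
proof (rule ccontr)
  assume contra: "\<not> ?thesis"
  define B where "B N = {G. \<exists>F'\<in>N. G \<in> s_ADP b X F' \<and> (\<forall>i\<in>J. G (fst i) \<le> ennreal (snd i))}" for N
  define nhd where "nhd N \<longleftrightarrow> openin (PADP_wk b X) N \<and> F \<in> N" for N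
  have ne: "B N \<noteq> {}" if "nhd N" for N
    using contra that unfolding B_def nhd_def by (simp add: not_less) blast
  have B_mono: "N \<subseteq> N' \<Longrightarrow> B N \<subseteq> B N'" for N N' by (auto simp: B_def)
  have nhd_Int: "nhd (N \<inter> N')" if "nhd N" "nhd N'" for N N'
    using that by (auto simp: nhd_def)
  have nhd_PADP: "nhd (PADP b X)"
    using F openin_topspace[of "PADP_wk b X"] by (simp add: nhd_def)
  have B_mem: "G \<in> PP b X" "\<forall>i\<in>J. G (fst i) \<le> ennreal (snd i)" if "G \<in> B N" for G N
    using that by (auto simp: B_def s_ADP_def)
  obtain G where G: "linear_prev X G" "fst F \<le> G"
    "\<And>B' h. B' \<in> B ` Collect nhd \<Longrightarrow> h \<in> LX X \<Longrightarrow> G h \<le> (SUP G'\<in>B'. G' h)"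
  proof (rule filtered_sandwich[OF PADP_dest(1)[OF F]])
    show "B ` Collect nhd \<noteq> {}" using nhd_PADP by blast
    show "linear_prev X G" if "B' \<in> B ` Collect nhd" "G \<in> B'" for B' G
      using that B_mem(1) PP_linear by blast
    fix B' h assume "B' \<in> B ` Collect nhd" and h: "h \<in> LX X"
    then obtain N where N: "nhd N" "B' = B N" by blast
    show "fst F h \<le> (SUP G\<in>B'. G h)"
    proof (rule ccontr)
      assume "\<not> ?thesis"
      then have "(SUP G\<in>B'. G h) < fst F h" by simp
      then obtain r where r: "0 \<le> r" "(SUP G\<in>B'. G h) < ennreal r" "ennreal r < fst F h"
        by (rule ennreal_dense_real)
      \<comment> \<open>Shrinking to forks whose first component exceeds \<open>r\<close> at
        \<open>h\<close> forces all bad previsions over them above \<open>r\<close> at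
        \<open>h\<close>.\<close>
      let ?N = "{F' \<in> PADP b X. ennreal r < fst F' h}"
      have "nhd ?N" using openin_PADP_wk(1)[OF h r(1)] F r(3) by (simp add: nhd_def)
      then have "nhd (N \<inter> ?N)" using N(1) by (intro nhd_Int)
      then obtain G where G: "G \<in> B (N \<inter> ?N)" using ne by blast
      then obtain F' where "F' \<in> ?N" "G \<in> s_ADP b X F'" by (auto simp: B_def)
      then have "ennreal r < G h" using s_ADP_mem(2)[of G b X F' h] by auto
      moreover have "G \<in> B'" using G B_mono[of "N \<inter> ?N" N] N(2) by blast
      then have "G h \<le> (SUP G\<in>B'. G h)" by (rule SUP_upper)
      ultimately show False using r(2) by (meson leD order.strict_trans2 less_imp_le)
    qed
  next
    fix B1 B2 assume "B1 \<in> B ` Collect nhd" "B2 \<in> B ` Collect nhd"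
    then obtain N N' where N: "nhd N" "nhd N'" "B1 = B N" "B2 = B N'" by blast
    have "B (N \<inter> N') \<subseteq> B1 \<inter> B2" using N B_mono[of "N \<inter> N'"] by simp
    moreover have "B (N \<inter> N') \<in> B ` Collect nhd" using nhd_Int[OF N(1,2)] by simp
    ultimately show "\<exists>B''\<in>B ` Collect nhd. B'' \<subseteq> B1 \<inter> B2" by blast
  qed (use that in blast)
  have G_le: "G h \<le> c" if "h \<in> LX X" "\<And>G'. G' \<in> B (PADP b X) \<Longrightarrow> G' h \<le> c" for h c
  proof -
    have "G h \<le> (SUP G'\<in>B (PADP b X). G' h)" using nhd_PADP that(1) by (intro G(3)) auto
    also have "\<dots> \<le> c" using that(2) by (rule SUP_least)
    finally show ?thesis .
  qed
  have "\<exists>G0\<in>s_ADP b X F. G0 \<le> G"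
  proof (rule convex_set_below[OF cvx_lensD(1,4)[OF s_ADP_cvx_lens[OF F]] G(1)])
    show "(INF G'\<in>s_ADP b X F. G' h) \<le> G h" for h
      using G(2) by (simp add: INF_s_ADP[OF F] le_fun_def)
  qed
  then obtain G0 where G0: "G0 \<in> s_ADP b X F" "G0 \<le> G" by blast
  obtain i where i: "i \<in> J" "ennreal (snd i) < G0 (fst i)" using sub[OF G0(1)] by blast
  have "G0 (fst i) \<le> G (fst i)" using G0(2) by (simp add: le_fun_def)
  also have "\<dots> \<le> ennreal (snd i)"
    by (rule G_le) (use i J B_mem(2) in auto)
  finally show False using i(2) by simp
qed

lemma s_ADP_box_nhd:
  assumes F: "F \<in> PADP b X" and V: "openin (PP_wk b X) V" "s_ADP b X F \<subseteq> V"
  shows "\<exists>N. openin (PADP_wk b X) N \<and> F \<in> N \<and> (\<forall>F'\<in>N. s_ADP b X F' \<subseteq> V)"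
proof -
  define basic where "basic I \<longleftrightarrow> finite I \<and> I \<subseteq> LX X \<times> {0..} \<and>
    (\<forall>G\<in>PP b X. (\<forall>i\<in>I. ennreal (snd i) < G (fst i)) \<longrightarrow> G \<in> V)" for I :: "(('a \<Rightarrow> ennreal) \<times> real) set"
  define W where "W I = {G \<in> PP b X. \<forall>i\<in>I. ennreal (snd i) < G (fst i)}" for I :: "(('a \<Rightarrow> ennreal) \<times> real) set"
  have "openin (PP_wk b X) (W I)" if "I \<in> Collect basic" for I
  proof -
    have "openin (PP_wk b X) {G \<in> topspace (PP_wk b X). \<forall>i\<in>I. ennreal (snd i) < G (fst i)}"
    proof (rule openin_finite_ball)
      show "finite I" using that by (simp add: basic_def)
      fix i assume "i \<in> I"
      then have "fst i \<in> LX X" "0 \<le> snd i" using that by (auto simp: basic_def)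
      then show "openin (PP_wk b X) {G \<in> topspace (PP_wk b X). ennreal (snd i) < G (fst i)}"
        by (simp add: openin_PP_wk)
    qed
    then show ?thesis by (simp add: W_def)
  qed
  moreover have "s_ADP b X F \<subseteq> \<Union>(W ` Collect basic)"
  proof
    fix G assume G: "G \<in> s_ADP b X F"
    then have "G \<in> V" using V(2) by blast
    obtain I where I: "finite I" "I \<subseteq> LX X \<times> {0..}" "\<And>h r. (h, r) \<in> I \<Longrightarrow> ennreal r < G h"
      "\<And>G'. G' \<in> PP b X \<Longrightarrow> (\<And>h r. (h, r) \<in> I \<Longrightarrow> ennreal r < G' h) \<Longrightarrow> G' \<in> V"
      using PP_wk_nhd[OF V(1) \<open>G \<in> V\<close>] by metis
    have "G' \<in> V" if "G' \<in> PP b X" "\<forall>i\<in>I. ennreal (snd i) < G' (fst i)" for G'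
      by (rule I(4)[OF that(1)]) (use that(2) in fastforce)
    then have "basic I" using I(1,2) by (simp add: basic_def)
    moreover have "G \<in> W I" using I(3) s_ADP_mem(1)[OF G] by (auto simp: W_def)
    ultimately show "G \<in> \<Union>(W ` Collect basic)" by blast
  qed
  ultimately obtain A where A: "finite A" "A \<subseteq> Collect basic" "s_ADP b X F \<subseteq> \<Union>(W ` A)"
    using compactin_finite_subcover[OF cvx_lensD(4)[OF s_ADP_cvx_lens[OF F]]] by metis
  txt \<open>The finite union \<open>\<Union>(W ` A)\<close> of finite intersections of subbasic sets is turned into a finite
    intersection of finite unions, indexed by choice functions.\<close>
  define C where "C = (\<Pi>\<^sub>E I\<in>A. I)"
  have "finite C" unfolding C_def using A(1,2) by (intro finite_PiE) (auto simp: basic_def)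
  have "\<exists>N. openin (PADP_wk b X) N \<and> F \<in> N \<and>
      (\<forall>F'\<in>N. \<forall>G\<in>s_ADP b X F'. \<exists>i\<in>f ` A. ennreal (snd i) < G (fst i))" if f: "f \<in> C" for f
  proof (rule s_ADP_subset_nhd[OF F])
    have fI: "f I \<in> I" if "I \<in> A" for I using f that by (auto simp: C_def)
    then show "f ` A \<subseteq> LX X \<times> {0..}" using A(2) unfolding basic_def by blast
    fix G assume "G \<in> s_ADP b X F"
    then obtain I where "I \<in> A" "G \<in> W I" using A(3) by blast
    then show "\<exists>i\<in>f ` A. ennreal (snd i) < G (fst i)" using fI by (auto simp: W_def)
  qed
  then obtain N where N: "\<And>f. f \<in> C \<Longrightarrow> openin (PADP_wk b X) (N f)" "\<And>f. f \<in> C \<Longrightarrow> F \<in> N f"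
    "\<And>f F' G. f \<in> C \<Longrightarrow> F' \<in> N f \<Longrightarrow> G \<in> s_ADP b X F' \<Longrightarrow> \<exists>i\<in>f ` A. ennreal (snd i) < G (fst i)"
    by metis
  define M where "M = {F' \<in> topspace (PADP_wk b X). \<forall>f\<in>C. F' \<in> N f}"
  have "openin (PADP_wk b X) M"
    unfolding M_def
  proof (rule openin_finite_ball[OF \<open>finite C\<close>])
    fix f assume "f \<in> C"
    then have "openin (PADP_wk b X) (topspace (PADP_wk b X) \<inter> N f)" using N(1) by blast
    then show "openin (PADP_wk b X) {F' \<in> topspace (PADP_wk b X). F' \<in> N f}" by (simp add: Int_def)
  qed
  moreover have "F \<in> M" using N(2) F by (simp add: M_def)
  moreover have "G \<in> V" if F': "F' \<in> M" and G: "G \<in> s_ADP b X F'" for F' G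
  proof -
    have "\<exists>I\<in>A. \<forall>i\<in>I. ennreal (snd i) < G (fst i)"
    proof (rule ccontr)
      assume "\<not> ?thesis"
      then have "\<forall>I\<in>A. \<exists>i. i \<in> I \<and> \<not> ennreal (snd i) < G (fst i)" by blast
      then obtain g where g: "\<And>I. I \<in> A \<Longrightarrow> g I \<in> I" "\<And>I. I \<in> A \<Longrightarrow> \<not> ennreal (snd (g I)) < G (fst (g I))"
        using bchoice[of A "\<lambda>I i. i \<in> I \<and> \<not> ennreal (snd i) < G (fst i)"] by blast
      \<comment> \<open>Restriction makes the choice function extensional, so that it belongs to the
        finite set \<open>C\<close>.\<close>
      define f where "f = restrict g A"
      have "f \<in> C" using g(1) by (simp add: f_def C_def)
      moreover from this have "F' \<in> N f" using F' by (simp add: M_def)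
      ultimately obtain i where "i \<in> f ` A" "ennreal (snd i) < G (fst i)" using N(3) G by blast
      then show False using g(2) by (auto simp: f_def)
    qed
    then obtain I where I: "I \<in> A" "\<forall>i\<in>I. ennreal (snd i) < G (fst i)" by blast
    then have "basic I" using A(2) by blast
    then show ?thesis using I(2) s_ADP_mem(1)[OF G] by (simp add: basic_def)
  qed
  ultimately show ?thesis by (intro exI[of _ M]) auto
qed

text \<open>By convexity, \<open>s\<close> of a fork meets the basic open set given by \<open>h\<^sub>i > r\<^sub>i\<close> as soon as its second
  component exceeds \<open>\<Sum> a\<^sub>i r\<^sub>i\<close> at \<open>\<Sum> a\<^sub>i h\<^sub>i\<close> for all weights \<open>a\<close>; by monotonicity and a bit of room,
  finitely many weights with denominator \<open>n\<close> suffice, and this is an open condition.\<close>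
lemma s_ADP_diamond_nhd:
  assumes X: "semitopological_cone_LX X" "locally_convex_LX X" "almost_open_addition_LX X"
    and F: "F \<in> PADP b X" and V: "openin (PP_wk b X) V" and G: "G \<in> s_ADP b X F" "G \<in> V"
  shows "\<exists>N. openin (PADP_wk b X) N \<and> F \<in> N \<and> (\<forall>F'\<in>N. s_ADP b X F' \<inter> V \<noteq> {})"
proof -
  obtain I where I: "finite I" "I \<subseteq> LX X \<times> {0..}" "\<And>h r. (h, r) \<in> I \<Longrightarrow> ennreal r < G h"
    "\<And>G'. G' \<in> PP b X \<Longrightarrow> (\<And>h r. (h, r) \<in> I \<Longrightarrow> ennreal r < G' h) \<Longrightarrow> G' \<in> V"
    using PP_wk_nhd[OF V G(2)] by metis
  have LX: "fst i \<in> LX X" and pos: "0 \<le> snd i" if "i \<in> I" for i using that I(2) by auto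
  have "\<forall>i\<in>I. \<exists>d>0. ennreal (snd i + d) \<le> G (fst i)"
  proof
    fix i assume i: "i \<in> I"
    then have "ennreal (snd i) < G (fst i)" using I(3) by simp
    then obtain s where s: "0 \<le> s" "ennreal (snd i) < ennreal s" "ennreal s < G (fst i)"
      by (rule ennreal_dense_real)
    then have "0 < s - snd i" using pos[OF i] by (simp add: ennreal_less_iff)
    moreover have "ennreal (snd i + (s - snd i)) \<le> G (fst i)" using s by simp
    ultimately show "\<exists>d>0. ennreal (snd i + d) \<le> G (fst i)" by blast
  qed
  then obtain d where d: "\<And>i. i \<in> I \<Longrightarrow> 0 < d i" "\<And>i. i \<in> I \<Longrightarrow> ennreal (snd i + d i) \<le> G (fst i)"
    by metis
  \<comment> \<open>A uniform amount of room for all of \<open>I\<close>; the inserted 1 covers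
    empty \<open>I\<close>.\<close>
  define \<delta> where "\<delta> = Min (insert 1 (d ` I))"
  have \<delta>: "0 < \<delta>" using I(1) d(1) by (simp add: \<delta>_def)
  have G_ge: "ennreal (snd i + \<delta>) \<le> G (fst i)" if "i \<in> I" for i
  proof -
    have "\<delta> \<le> d i" using I(1) that by (simp add: \<delta>_def)
    then have "ennreal (snd i + \<delta>) \<le> ennreal (snd i + d i)" by (intro ennreal_leI) simp
    then show ?thesis using d(2)[OF that] by (rule order_trans)
  qed
  define R where "R = (\<Sum>i\<in>I. snd i)"
  have R: "0 \<le> R" unfolding R_def using pos by (rule sum_nonneg)
  \<comment> \<open>Rounding weights down to multiples of \<open>1 / n\<close> loses at most
    \<open>card I / n\<close> of total weight, and the threshold is raised by \<open>R / n\<close>.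
    This \<open>n\<close> makes the gain from \<open>\<delta>\<close> on the remaining weight exceed
    that raise.\<close>
  obtain n :: nat where "(R + \<delta> * card I) / \<delta> < n" using reals_Archimedean2 by blast
  then have n: "R + \<delta> * card I < \<delta> * n" using \<delta> by (simp add: field_simps)
  have n_pos: "0 < real n"
  proof (rule ccontr)
    assume "\<not> 0 < real n"
    then have "R + \<delta> * card I < 0" using n by simp
    moreover have "0 \<le> \<delta> * card I" using \<delta> by simp
    ultimately show False using R by linarith
  qed
  \<comment> \<open>The numerators that rounding down can produce: their sum is at least
    \<open>n - card I\<close>, written additively to avoid truncated subtraction. \<open>M\<close>
    is finite, so the conditions it indexes define an open set.\<close>
  define M where "M = {m \<in> (\<Pi>\<^sub>E i\<in>I. {0..n}). n \<le> (\<Sum>i\<in>I. m i) + card I}"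
  define w :: "(('a \<Rightarrow> ennreal) \<times> real \<Rightarrow> nat) \<Rightarrow> ('a \<Rightarrow> ennreal) \<times> real \<Rightarrow> real"
    where "w m i = real (m i) / real n" for m i
  define k where "k m = lincomb I (w m) fst" for m
  \<comment> \<open>The summand \<open>R / n\<close> accounts for
    \<open>a i \<le> w m i + 1 / n\<close>: thus \<open>c m\<close> dominates the weighted sum for
    every \<open>a\<close> that rounds down to \<open>m\<close>.\<close>
  define c where "c m = (\<Sum>i\<in>I. w m i * snd i) + R / n" for m
  have w_pos: "0 \<le> w m i" for m i by (simp add: w_def)
  have k_LX: "k m \<in> LX X" for m unfolding k_def by (rule lincomb_in_LX[OF I(1) w_pos LX])
  have c_pos: "0 \<le> c m" for m
    unfolding c_def using w_pos pos R by (intro add_nonneg_nonneg sum_nonneg mult_nonneg_nonneg) auto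
  define N where "N = {F' \<in> topspace (PADP_wk b X). \<forall>m\<in>M. ennreal (c m) < snd F' (k m)}"
  have "openin (PADP_wk b X) N"
    unfolding N_def
  proof (rule openin_finite_ball)
    show "finite M" unfolding M_def using I(1) by (simp add: finite_PiE)
    show "openin (PADP_wk b X) {F' \<in> topspace (PADP_wk b X). ennreal (c m) < snd F' (k m)}" for m
      using openin_PADP_wk(2)[OF k_LX c_pos] by simp
  qed
  moreover have "F \<in> N"
  proof -
    have "ennreal (c m) < snd F (k m)" if m: "m \<in> M" for m
    proof -
      have "real n \<le> real ((\<Sum>i\<in>I. m i) + card I)" using m by (simp only: M_def mem_Collect_eq of_nat_le_iff)
      then have "real n - card I \<le> (\<Sum>i\<in>I. real (m i))" by simp
      then have "\<delta> * (real n - card I) \<le> \<delta> * (\<Sum>i\<in>I. real (m i))" using \<delta> by (intro mult_left_mono) auto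
      then have "R < \<delta> * (\<Sum>i\<in>I. real (m i))" using n by (simp add: right_diff_distrib)
      then have "R / n < \<delta> * (\<Sum>i\<in>I. real (m i)) / n" using n_pos by (rule divide_strict_right_mono)
      also have "\<dots> = (\<Sum>i\<in>I. w m i * \<delta>)"
        by (simp add: w_def sum_distrib_left sum_divide_distrib mult.commute)
      finally have "c m < (\<Sum>i\<in>I. w m i * (snd i + \<delta>))"
        by (simp add: c_def distrib_left sum.distrib)
      then have "ennreal (c m) < ennreal (\<Sum>i\<in>I. w m i * (snd i + \<delta>))"
        using c_pos by (simp add: ennreal_less_iff)
      also have "\<dots> = (\<Sum>i\<in>I. ennreal (w m i) * ennreal (snd i + \<delta>))"
        using w_pos pos \<delta> by (intro ennreal_weighted_sum[symmetric] I(1)) auto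
      also have "\<dots> \<le> (\<Sum>i\<in>I. ennreal (w m i) * G (fst i))"
        using G_ge by (intro sum_mono mult_left_mono) auto
      also have "\<dots> = G (k m)"
        unfolding k_def
        by (rule linear_prev_lincomb[OF I(1) PP_linear[OF s_ADP_mem(1)[OF G(1)]] w_pos LX, symmetric])
      also have "\<dots> \<le> snd F (k m)" by (rule s_ADP_mem(3)[OF G(1)])
      finally show ?thesis .
    qed
    then show ?thesis using F by (simp add: N_def)
  qed
  moreover have "s_ADP b X F' \<inter> V \<noteq> {}" if "F' \<in> N" for F'
  proof -
    have F': "F' \<in> PADP b X" and less: "\<And>m. m \<in> M \<Longrightarrow> ennreal (c m) < snd F' (k m)"
      using that by (auto simp: N_def)
    note lens = s_ADP_cvx_lens[OF F']
    have "\<exists>G'\<in>s_ADP b X F'. \<forall>i\<in>I. ennreal (snd i) < G' (fst i)"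
    proof (rule convex_set_meets_nhd[OF cvx_lensD(1-3)[OF lens] I(1) LX pos])
      fix a :: "('a \<Rightarrow> ennreal) \<times> real \<Rightarrow> real"
      assume a: "\<And>i. i \<in> I \<Longrightarrow> 0 \<le> a i" "sum a I = 1"
      define m where "m = restrict (\<lambda>i. nat \<lfloor>real n * a i\<rfloor>) I"
      have m_le: "real (m i) \<le> real n * a i" and m_ge: "real n * a i \<le> real (m i) + 1" if "i \<in> I" for i
      proof -
        have "0 \<le> real n * a i" using a(1)[OF that] by simp
        then have "real (m i) = of_int \<lfloor>real n * a i\<rfloor>" using that by (simp add: m_def)
        then show "real (m i) \<le> real n * a i" "real n * a i \<le> real (m i) + 1" by linarith+
      qed
      have "m i \<le> n" if "i \<in> I" for i
      proof -
        have "a i \<le> sum a I" using a(1) by (intro member_le_sum that I(1)) auto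
        then have "real n * a i \<le> real n * 1" unfolding a(2) by (rule mult_left_mono) simp
        then have "real (m i) \<le> real n" using m_le[OF that] by simp
        then show ?thesis by simp
      qed
      moreover have "real n \<le> real ((\<Sum>i\<in>I. m i) + card I)"
      proof -
        have "real n = (\<Sum>i\<in>I. real n * a i)" by (simp add: sum_distrib_left[symmetric] a(2))
        also have "\<dots> \<le> (\<Sum>i\<in>I. real (m i) + 1)" using m_ge by (rule sum_mono)
        finally show ?thesis by (simp add: sum.distrib)
      qed
      then have "n \<le> (\<Sum>i\<in>I. m i) + card I" by (simp only: of_nat_le_iff)
      ultimately have "m \<in> M" by (auto simp: M_def m_def)
      have "(\<Sum>i\<in>I. a i * snd i) \<le> (\<Sum>i\<in>I. (w m i + 1 / n) * snd i)"
      proof (intro sum_mono mult_right_mono pos)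
        fix i assume "i \<in> I"
        then have "real n * a i / n \<le> (real (m i) + 1) / n" by (intro divide_right_mono m_ge) auto
        then show "a i \<le> w m i + 1 / n" using n_pos by (simp add: w_def add_divide_distrib)
      qed
      also have "\<dots> = c m" by (simp add: c_def R_def distrib_right sum.distrib sum_divide_distrib)
      finally have "ennreal (\<Sum>i\<in>I. a i * snd i) \<le> ennreal (c m)" by (rule ennreal_leI)
      also have "\<dots> < snd F' (k m)" using \<open>m \<in> M\<close> by (rule less)
      also have "\<dots> \<le> snd F' (lincomb I a fst)"
      proof (rule prevision_mono[OF PADP_prevision(2)[OF F'] k_LX])
        show "lincomb I a fst \<in> LX X" by (rule lincomb_in_LX[OF I(1)]) (fact a LX)+
        show "k m \<le> lincomb I a fst" unfolding k_def
        proof (rule lincomb_mono)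
          fix i assume "i \<in> I"
          then have "real (m i) / n \<le> real n * a i / n" by (intro divide_right_mono m_le) auto
          then show "w m i \<le> a i" using n_pos by (simp add: w_def)
        qed
      qed
      also have "\<dots> = (SUP G\<in>s_ADP b X F'. G (lincomb I a fst))" by (rule SUP_s_ADP[OF X F', symmetric])
      finally show "ennreal (\<Sum>i\<in>I. a i * snd i) < (SUP G\<in>s_ADP b X F'. G (lincomb I a fst))" .
    qed
    then obtain G' where G': "G' \<in> s_ADP b X F'" "\<forall>i\<in>I. ennreal (snd i) < G' (fst i)" by blast
    have "G' \<in> V" by (rule I(4)[OF s_ADP_mem(1)[OF G'(1)]]) (use G'(2) in fastforce)
    with G'(1) show ?thesis by blast
  qed
  ultimately show ?thesis by (intro exI[of _ N]) blast
qed

lemma continuous_map_s_ADP: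
  assumes X: "semitopological_cone_LX X" "locally_convex_LX X" "almost_open_addition_LX X"
  shows "continuous_map (PADP_wk b X) (vietoris (PP_wk b X) (cvx_lenses b X)) (s_ADP b X)"
  unfolding vietoris_def
proof (rule continuous_map_gen_top_on)
  show "s_ADP b X F \<in> cvx_lenses b X" if "F \<in> topspace (PADP_wk b X)" for F
    using that by (simp add: s_ADP_cvx_lens)
  fix U assume "U \<in> {{L. L \<subseteq> V} | V. openin (PP_wk b X) V} \<union> {{L. L \<inter> V \<noteq> {}} | V. openin (PP_wk b X) V}"
  then consider V where "openin (PP_wk b X) V" "U = {L. L \<subseteq> V}"
    | V where "openin (PP_wk b X) V" "U = {L. L \<inter> V \<noteq> {}}" by blast
  then have nhd: "\<exists>N. openin (PADP_wk b X) N \<and> F \<in> N \<and> (\<forall>F'\<in>N. s_ADP b X F' \<in> U)"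
    if F: "F \<in> PADP b X" "s_ADP b X F \<in> U" for F
  proof cases
    case 1
    then show ?thesis using s_ADP_box_nhd[OF F(1) 1(1)] F(2) by simp
  next
    case 2
    then obtain G where "G \<in> s_ADP b X F" "G \<in> V" using F(2) by blast
    then show ?thesis using s_ADP_diamond_nhd[OF X F(1) 2(1)] 2(2) by simp
  qed
  let ?W = "{F \<in> topspace (PADP_wk b X). s_ADP b X F \<in> U}"
  have "\<exists>N. openin (PADP_wk b X) N \<and> F \<in> N \<and> N \<subseteq> ?W" if F: "F \<in> ?W" for F
  proof -
    have "F \<in> PADP b X" "s_ADP b X F \<in> U" using F by simp_all
    from nhd[OF this] obtain N where "openin (PADP_wk b X) N" "F \<in> N" "\<forall>F'\<in>N. s_ADP b X F' \<in> U"
      by blast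
    moreover from this have "N \<subseteq> ?W" using openin_subset[of "PADP_wk b X" N] by blast
    ultimately show ?thesis by blast
  qed
  then show "openin (PADP_wk b X) ?W" by (subst openin_subopen) simp
qed

theorem theorem4p17:
  fixes b :: bullet and X :: "'a topology"
  assumes "semitopological_cone_LX X"
    and "locally_convex_LX X"
    and "almost_open_addition_LX X"
    and "b = Norm \<Longrightarrow> compact_space X"
  shows "homeomorphic_maps (vietoris (PP_wk b X) (cvx_lenses b X)) (PADP_wk b X)
           r_ADP (s_ADP b X)
       \<and> bij_betw r_ADP (cvx_lenses b X) (PADP b X)
       \<and> (\<forall>L\<in>cvx_lenses b X. \<forall>L'\<in>cvx_lenses b X.
            lens_le (PP_wk b X) L L' \<longleftrightarrow> fork_le (r_ADP L) (r_ADP L'))"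
proof (intro conjI ballI)
  note r_s = r_ADP_s_ADP[OF assms(1-3)]
  show "homeomorphic_maps (vietoris (PP_wk b X) (cvx_lenses b X)) (PADP_wk b X) r_ADP (s_ADP b X)"
    unfolding homeomorphic_maps_def
    by (simp add: continuous_map_r_ADP continuous_map_s_ADP[OF assms(1-3)] s_ADP_r_ADP r_s)
  show "bij_betw r_ADP (cvx_lenses b X) (PADP b X)"
    by (rule bij_betw_byWitness[where f' = "s_ADP b X"])
      (auto simp: s_ADP_r_ADP r_s r_ADP_PADP s_ADP_cvx_lens)
qed (rule lens_le_iff_fork_le)

end
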